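(* Let $\Omega\subset\mathbb{R}^p$ be open, connected and bounded with smooth boundary $\partial\Omega$, let $n,q\ge 1$, let $L\in\mathcal{G}_\tau((\bar\Omega\times\mathbb{R}^q)^{(n)})$, $u_0\in\mathcal{G}(\partial\Omega)^q$, and define $$\mathcal{L}:\mathcal{G}(\bar\Omega)^q\to\tilde{\mathbb{R}},\qquad \mathcal{L}(u)=\int_\Omega L(x,u^{(n)}(x))\,dx,\qquad \mathcal{A}=\{w\in\mathcal{G}(\bar\Omega)^q : w|_{\partial\Omega}=u_0\}.$$ Let $u\in\mathcal{A}$ be a minimizer of $\mathcal{L}$ in $\mathcal{A}$, i.e. $\mathcal{L}(u)\le\mathcal{L}(w)$ in $\tilde{\mathbb{R}}$ for all $w\in\mathcal{A}$. Then $u$ is a solution of the system of Euler–Lagrange equations $$E_\alpha(L)=0\quad\text{in }\mathcal{G}(\Omega),\qquad \alpha=1,\dots,q,$$ (with $E_\alpha(L)$ evaluated along $u$ and its derivatives), where $$E_\alpha=\sum_J(-D)_J\frac{\partial}{\partial u^\alpha_J},$$ the sum extending over all unordered multi-indices $J=(j_1,\dots,j_k)$ with $1\le j_i\le p$ and $0\le k\le n$.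
   Context: Colombeau algebras. For a set $D$ which is an open set $\Omega\subseteq\mathbb{R}^p$ or its closure $\bar\Omega$: $\mathcal{E}_M(D)$ is the set of nets $(u_\varepsilon)_{\varepsilon\in(0,1]}$ in $C^\infty(D)$ such that for every compact $K\subset D$ and every multi-index $\alpha$ there is $N\in\mathbb{N}$ with $\sup_K|\partial^\alpha u_\varepsilon|=O(\varepsilon^{-N})$ as $\varepsilon\to0$; $\mathcal{N}(D)$ is the set of nets such that for all $K,\alpha$ and all $m\in\mathbb{N}$, $\sup_K|\partial^\alpha u_\varepsilon|=O(\varepsilon^m)$. $\mathcal{G}(D)=\mathcal{E}_M(D)/\mathcal{N}(D)$, with componentwise operations. ($C^\infty(\bar\Omega)$: functions smooth in $\Omega$ all of whose derivatives extend continuously to $\bar\Omega$.) $\mathcal{G}(\partial\Omega)$ is defined analogously on the manifold $\partial\Omega$ (estimates in charts), and restriction to $\partial\Omega$ is componentwise. $\tilde{\mathbb{R}}$ is the ring of nets of reals with $|x_\varepsilon|=O(\varepsilon^{-N})$ for some $N$, modulo nets with $|x_\varepsilon|=O(\varepsilon^m)$ for all $m$. $\tilde x\ge0$ means that $\tilde x$ has a representative with all $x_\varepsilon\ge0$; $\tilde x\le\tilde y$ means $\tilde y-\tilde x\ge0$. Jets. $(\bar\Omega\times\mathbb{R}^q)^{(n)}=\bar\Omega\times\mathbb{R}^{d}$ is the $n$-jet space, with coordinates $x\in\bar\Omega$ and $u^\alpha_J$, $1\le\alpha\le q$, $J=(j_1,\dots,j_k)$ unordered, $1\le j_i\le p$,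 $0\le k\le n$ ($u^\alpha_\emptyset=u^\alpha$), representing the partial derivatives $\partial_{j_1}\cdots\partial_{j_k}u^\alpha$. For a function $u$, $u^{(n)}(x)$ is the collection of the values of $u$ and its partial derivatives up to order $n$. $D_i=\partial_{x^i}+\sum_{\alpha,J}u^\alpha_{J,i}\,\partial_{u^\alpha_J}$ is the $i$-th total derivative and $(-D)_J=(-1)^kD_{j_1}\cdots D_{j_k}$. Tempered algebra. $\mathcal{G}_\tau((\bar\Omega\times\mathbb{R}^q)^{(n)})$ is the quotient of nets of smooth functions $L_\varepsilon$ on the jet space such that for each multi-index $\beta$ there is $N$ with $\sup_{z}(1+|z|)^{-N}|\partial^\beta L_\varepsilon(z)|=O(\varepsilon^{-N})$, modulo nets such that for each $\beta$ there is $l$ such that for all $m$, $\sup_z(1+|z|)^{-l}|\partial^\beta L_\varepsilon(z)|=O(\varepsilon^m)$; suprema are over the whole jet space. Then $L(x,u^{(n)}(x)):=[(L_\varepsilon(x,u_\varepsilon^{(n)}(x)))_\varepsilon]\in\mathcal{G}(\bar\Omega)$ is well-defined for $u\in\mathcal{G}(\bar\Omega)^q$, and integrals are defined componentwise on representatives. *)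

theory Defs
  imports "HOL-Analysis.Analysis" "HOL-Library.Multiset" "HOL-Library.Landau_Symbols"
begin

section \<open>Smooth functions\<close>

definition pdiff :: "'a::real_normed_vector \<Rightarrow> ('a \<Rightarrow> real) \<Rightarrow> 'a \<Rightarrow> real" where
  "pdiff b f x = deriv (\<lambda>t. f (x + t *\<^sub>R b)) 0"

abbreviation pdiffs :: "'a::real_normed_vector list \<Rightarrow> ('a \<Rightarrow> real) \<Rightarrow> 'a \<Rightarrow> real" where
  "pdiffs bs f \<equiv> foldr pdiff bs f"

text \<open>
  Smoothness as existence and continuity on \<open>S\<close> of all iterated partial derivatives in the
  directions \<open>B\<close>.  It is used for \<open>S\<close> open with \<open>B = Basis\<close>, where it is the class \<open>C\<^sup>\<infinity>(S)\<close>, and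
  for \<open>S\<close> relatively open in a coordinate hyperplane \<open>{y. y \<bullet> e = 0}\<close> with \<open>B = Basis - {e}\<close>,
  where it is smoothness in the remaining variables (the values outside \<open>S\<close> are irrelevant).
\<close>

definition smooth_along :: "'a::real_normed_vector set \<Rightarrow> 'a set \<Rightarrow> ('a \<Rightarrow> real) \<Rightarrow> bool" where
  "smooth_along B S f \<longleftrightarrow>
     (\<forall>bs\<in>lists B. continuous_on S (pdiffs bs f) \<and>
        (\<forall>b\<in>B. \<forall>x\<in>S. (\<lambda>t. pdiffs bs f (x + t *\<^sub>R b)) differentiable (at 0)))"

definition smooth_map :: "'a::euclidean_space set \<Rightarrow> ('a \<Rightarrow> 'a) \<Rightarrow> bool" where
  "smooth_map U \<Phi> \<longleftrightarrow> (\<forall>b\<in>Basis. smooth_along Basis U (\<lambda>x. \<Phi> x \<bullet> b))"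

text \<open>
  In the following, \<open>\<Omega>\<close> is open and \<open>D\<close> is either \<open>\<Omega>\<close> or \<open>closure \<Omega>\<close>; \<open>cinf \<Omega> D\<close> is \<open>C\<^sup>\<infinity>(D)\<close>.
  Functions on \<open>D\<close> are represented by total functions whose values outside \<open>D\<close> are irrelevant.
\<close>

definition cinf :: "'a::euclidean_space set \<Rightarrow> 'a set \<Rightarrow> ('a \<Rightarrow> real) set" where
  "cinf \<Omega> D = {f. smooth_along Basis \<Omega> f \<and> continuous_on D f \<and>
     (\<forall>bs\<in>lists Basis. \<exists>g. continuous_on D g \<and> (\<forall>x\<in>\<Omega>. g x = pdiffs bs f x))}"

text \<open>The continuous extension of a partial derivative to the boundary of \<open>\<Omega>\<close>.\<close>

definition pdbar :: "'a::euclidean_space set \<Rightarrow> 'a list \<Rightarrow> ('a \<Rightarrow> real) \<Rightarrow> 'a \<Rightarrow> real" where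
  "pdbar \<Omega> bs f x =
     (if x \<in> \<Omega> then pdiffs bs f x else Lim (at x within \<Omega>) (pdiffs bs f))"


section \<open>Colombeau algebras\<close>

type_synonym 'a net = "real \<Rightarrow> 'a \<Rightarrow> real"

text \<open>\<open>sup\<^bsub>x\<in>K\<^esub> |f\<^sub>\<epsilon>(x)| = O(g(\<epsilon>))\<close> as \<open>\<epsilon> \<rightarrow> 0+\<close>, including finiteness of the supremum for small \<open>\<epsilon>\<close>.\<close>

definition sup_bigo :: "'a set \<Rightarrow> 'a net \<Rightarrow> (real \<Rightarrow> real) \<Rightarrow> bool" where
  "sup_bigo K f g \<longleftrightarrow> (\<exists>C. \<forall>\<^sub>F \<epsilon> in at_right 0. \<forall>x\<in>K. \<bar>f \<epsilon> x\<bar> \<le> C * g \<epsilon>)"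

definition moderate :: "'a::euclidean_space set \<Rightarrow> 'a set \<Rightarrow> 'a net set" where
  "moderate \<Omega> D = {u. (\<forall>\<epsilon>\<in>{0<..1}. u \<epsilon> \<in> cinf \<Omega> D) \<and>
     (\<forall>K. compact K \<and> K \<subseteq> D \<longrightarrow> (\<forall>bs\<in>lists Basis. \<exists>N::nat.
        sup_bigo K (\<lambda>\<epsilon>. pdbar \<Omega> bs (u \<epsilon>)) (\<lambda>\<epsilon>. 1 / \<epsilon> ^ N)))}"

definition negligible_nets :: "'a::euclidean_space set \<Rightarrow> 'a set \<Rightarrow> 'a net set" where
  "negligible_nets \<Omega> D = {u. (\<forall>\<epsilon>\<in>{0<..1}. u \<epsilon> \<in> cinf \<Omega> D) \<and>
     (\<forall>K. compact K \<and> K \<subseteq> D \<longrightarrow> (\<forall>bs\<in>lists Basis. \<forall>m::nat.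
        sup_bigo K (\<lambda>\<epsilon>. pdbar \<Omega> bs (u \<epsilon>)) (\<lambda>\<epsilon>. \<epsilon> ^ m)))}"

definition net_rel :: "'a net set \<Rightarrow> 'a net set \<Rightarrow> ('a net \<times> 'a net) set" where
  "net_rel M N = {(u, v). u \<in> M \<and> v \<in> M \<and> (\<lambda>\<epsilon> x. u \<epsilon> x - v \<epsilon> x) \<in> N}"

definition colombeau_rel :: "'a::euclidean_space set \<Rightarrow> 'a set \<Rightarrow> ('a net \<times> 'a net) set" where
  "colombeau_rel \<Omega> D = net_rel (moderate \<Omega> D) (negligible_nets \<Omega> D)"

definition colombeau :: "'a::euclidean_space set \<Rightarrow> 'a set \<Rightarrow> 'a net set set" where
  "colombeau \<Omega> D = moderate \<Omega> D // colombeau_rel \<Omega> D"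


section \<open>Smooth boundary and the Colombeau algebra on the boundary\<close>

text \<open>
  A diffeomorphism \<open>\<Phi>\<close> from \<open>U\<close> onto \<open>V\<close> (with inverse \<open>\<Psi>\<close>) which flattens the boundary of \<open>\<Omega>\<close>.
  Its restriction to \<open>U \<inter> frontier \<Omega>\<close> is a chart of the boundary with values in the hyperplane
  \<open>{y. y \<bullet> e = 0}\<close>, which for one-dimensional \<open>'a\<close> is a point.
\<close>

definition boundary_chart ::
  "'a::euclidean_space set \<Rightarrow> 'a set \<Rightarrow> 'a set \<Rightarrow> ('a \<Rightarrow> 'a) \<Rightarrow> ('a \<Rightarrow> 'a) \<Rightarrow> 'a \<Rightarrow> bool" where
  "boundary_chart \<Omega> U V \<Phi> \<Psi> e \<longleftrightarrow>
     open U \<and> open V \<and> homeomorphism U V \<Phi> \<Psi> \<and> smooth_map U \<Phi> \<and> smooth_map V \<Psi> \<and> e \<in> Basis \<and>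
     \<Phi> ` (U \<inter> \<Omega>) = {y\<in>V. 0 < y \<bullet> e} \<and> \<Phi> ` (U \<inter> frontier \<Omega>) = {y\<in>V. y \<bullet> e = 0}"

definition smooth_boundary :: "'a::euclidean_space set \<Rightarrow> bool" where
  "smooth_boundary \<Omega> \<longleftrightarrow>
     (\<forall>x\<in>frontier \<Omega>. \<exists>U V \<Phi> \<Psi> e. boundary_chart \<Omega> U V \<Phi> \<Psi> e \<and> x \<in> U)"

definition bd_cinf :: "'a::euclidean_space set \<Rightarrow> ('a \<Rightarrow> real) set" where
  "bd_cinf \<Omega> = {f. \<forall>U V \<Phi> \<Psi> e. boundary_chart \<Omega> U V \<Phi> \<Psi> e \<longrightarrow>
     smooth_along (Basis - {e}) {y\<in>V. y \<bullet> e = 0} (f \<circ> \<Psi>)}"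

definition bd_moderate :: "'a::euclidean_space set \<Rightarrow> 'a net set" where
  "bd_moderate \<Omega> = {u. (\<forall>\<epsilon>\<in>{0<..1}. u \<epsilon> \<in> bd_cinf \<Omega>) \<and>
     (\<forall>U V \<Phi> \<Psi> e K. boundary_chart \<Omega> U V \<Phi> \<Psi> e \<and> compact K \<and> K \<subseteq> {y\<in>V. y \<bullet> e = 0} \<longrightarrow>
       (\<forall>bs\<in>lists (Basis - {e}). \<exists>N::nat.
          sup_bigo K (\<lambda>\<epsilon>. pdiffs bs (u \<epsilon> \<circ> \<Psi>)) (\<lambda>\<epsilon>. 1 / \<epsilon> ^ N)))}"

definition bd_negligible :: "'a::euclidean_space set \<Rightarrow> 'a net set" where
  "bd_negligible \<Omega> = {u. (\<forall>\<epsilon>\<in>{0<..1}. u \<epsilon> \<in> bd_cinf \<Omega>) \<and>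
     (\<forall>U V \<Phi> \<Psi> e K. boundary_chart \<Omega> U V \<Phi> \<Psi> e \<and> compact K \<and> K \<subseteq> {y\<in>V. y \<bullet> e = 0} \<longrightarrow>
       (\<forall>bs\<in>lists (Basis - {e}). \<forall>m::nat.
          sup_bigo K (\<lambda>\<epsilon>. pdiffs bs (u \<epsilon> \<circ> \<Psi>)) (\<lambda>\<epsilon>. \<epsilon> ^ m)))}"

definition bd_rel :: "'a::euclidean_space set \<Rightarrow> ('a net \<times> 'a net) set" where
  "bd_rel \<Omega> = net_rel (bd_moderate \<Omega>) (bd_negligible \<Omega>)"

definition bd_colombeau :: "'a::euclidean_space set \<Rightarrow> 'a net set set" where
  "bd_colombeau \<Omega> = bd_moderate \<Omega> // bd_rel \<Omega>"

text \<open>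
  Operations on classes are given by the union, over all representatives, of the class of the
  result (see \<open>UN_equiv_class\<close>); this is the class of the result for any representative whenever
  the operation is well defined.
\<close>

definition bd_restrict :: "'a::euclidean_space set \<Rightarrow> 'a net set \<Rightarrow> 'a net set" where
  "bd_restrict \<Omega> w = (\<Union>v\<in>w. bd_rel \<Omega> `` {v})"


section \<open>Generalized real numbers\<close>

definition real_moderate :: "(real \<Rightarrow> real) set" where
  "real_moderate = {x. \<exists>N::nat. x \<in> O[at_right 0](\<lambda>\<epsilon>. 1 / \<epsilon> ^ N)}"

definition real_negligible :: "(real \<Rightarrow> real) set" where
  "real_negligible = {x. \<forall>m::nat. x \<in> O[at_right 0](\<lambda>\<epsilon>. \<epsilon> ^ m)}"

definition greal_rel :: "((real \<Rightarrow> real) \<times> (real \<Rightarrow> real)) set" where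
  "greal_rel = {(x, y). x \<in> real_moderate \<and> y \<in> real_moderate \<and> (\<lambda>\<epsilon>. x \<epsilon> - y \<epsilon>) \<in> real_negligible}"

definition greals :: "(real \<Rightarrow> real) set set" where
  "greals = real_moderate // greal_rel"

definition greal_diff :: "(real \<Rightarrow> real) set \<Rightarrow> (real \<Rightarrow> real) set \<Rightarrow> (real \<Rightarrow> real) set" where
  "greal_diff X Y = (\<Union>x\<in>X. \<Union>y\<in>Y. greal_rel `` {\<lambda>\<epsilon>. x \<epsilon> - y \<epsilon>})"

definition greal_nonneg :: "(real \<Rightarrow> real) set \<Rightarrow> bool" where
  "greal_nonneg X \<longleftrightarrow> X \<in> greals \<and> (\<exists>x\<in>X. \<forall>\<epsilon>\<in>{0<..1}. 0 \<le> x \<epsilon>)"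

definition greal_le :: "(real \<Rightarrow> real) set \<Rightarrow> (real \<Rightarrow> real) set \<Rightarrow> bool" where
  "greal_le X Y \<longleftrightarrow> greal_nonneg (greal_diff Y X)"


section \<open>Jets\<close>

text \<open>
  Unordered multi-indices are multisets.  The order of the jets is a type parameter,
  \<open>n = CARD('n)\<close>, so that the \<open>n\<close>-jet space is a Euclidean space.
\<close>

typedef ('p, 'n) jet_index = "{J :: 'p multiset. size J \<le> CARD('n)}"
  by (rule exI[of _ "{#}"]) simp

instance jet_index :: (finite, type) finite
proof
  have "{J :: 'a multiset. size J \<le> CARD('b)}
          \<subseteq> mset ` {js. set js \<subseteq> UNIV \<and> length js \<le> CARD('b)}"
  proof
    fix J :: "'a multiset"
    assume "J \<in> {J. size J \<le> CARD('b)}"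
    moreover obtain js where "J = mset js"
      using ex_mset by metis
    ultimately show "J \<in> mset ` {js. set js \<subseteq> UNIV \<and> length js \<le> CARD('b)}"
      by auto
  qed
  moreover have "finite {js :: 'a list. set js \<subseteq> UNIV \<and> length js \<le> CARD('b)}"
    by (rule finite_lists_length_le) simp
  ultimately have "finite {J :: 'a multiset. size J \<le> CARD('b)}"
    using finite_subset finite_imageI by blast
  then have "finite (Abs_jet_index ` {J :: 'a multiset. size J \<le> CARD('b)} :: ('a, 'b) jet_index set)"
    by (rule finite_imageI)
  moreover have "(UNIV :: ('a, 'b) jet_index set) = Abs_jet_index ` {J. size J \<le> CARD('b)}"
    by (rule type_definition.Abs_image[OF type_definition_jet_index, symmetric])
  ultimately show "finite (UNIV :: ('a, 'b) jet_index set)"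
    by simp
qed

type_synonym ('p, 'q, 'n) jet = "(real ^ 'p) \<times> (real ^ ('q \<times> ('p, 'n) jet_index))"

text \<open>
  Total derivatives raise the order of jets, hence they act on functions on the infinite jet
  space, on which functions of jets of order \<open>n\<close> are considered by means of the projection \<open>jet_proj\<close>.
\<close>

type_synonym ('p, 'q) inf_jet = "(real ^ 'p) \<times> ('q \<times> 'p multiset \<Rightarrow> real)"

definition jet_proj :: "('p::finite, 'q::finite) inf_jet \<Rightarrow> ('p, 'q, 'n) jet" where
  "jet_proj = (\<lambda>(x, U). (x, \<chi> a. U (fst a, Rep_jet_index (snd a))))"

text \<open>
  An enumeration \<open>j\<^sub>1, \<dots>, j\<^sub>k\<close> of an unordered multi-index.  The choice is immaterial, as partial
  derivatives and total derivatives of smooth functions commute.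
\<close>

definition idx_list :: "'p multiset \<Rightarrow> 'p list" where
  "idx_list J = (SOME js. mset js = J)"

definition inf_jet_of ::
  "(real ^ 'p::finite) set \<Rightarrow> ('q \<Rightarrow> real ^ 'p \<Rightarrow> real) \<Rightarrow> real ^ 'p \<Rightarrow> ('p, 'q) inf_jet" where
  "inf_jet_of \<Omega> u x = (x, \<lambda>(\<alpha>, J). pdbar \<Omega> (map (\<lambda>i. axis i 1) (idx_list J)) (u \<alpha>) x)"

definition jet_of ::
  "(real ^ 'p::finite) set \<Rightarrow> ('q::finite \<Rightarrow> real ^ 'p \<Rightarrow> real) \<Rightarrow> real ^ 'p \<Rightarrow> ('p, 'q, 'n) jet" where
  "jet_of \<Omega> u x = jet_proj (inf_jet_of \<Omega> u x)"

definition d_x :: "'p::finite \<Rightarrow> (('p, 'q) inf_jet \<Rightarrow> real) \<Rightarrow> ('p, 'q) inf_jet \<Rightarrow> real" where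
  "d_x i F = (\<lambda>(x, U). deriv (\<lambda>t. F (x + t *\<^sub>R axis i 1, U)) 0)"

definition d_u :: "'q \<times> 'p::finite multiset \<Rightarrow> (('p, 'q) inf_jet \<Rightarrow> real) \<Rightarrow> ('p, 'q) inf_jet \<Rightarrow> real" where
  "d_u a F = (\<lambda>(x, U). deriv (\<lambda>t. F (x, U(a := t))) (U a))"

text \<open>
  The sum runs over the coordinates with a nonzero contribution; there are only finitely many of
  them, as the functions under consideration depend on jets of some finite order.
\<close>

definition total_deriv :: "'p::finite \<Rightarrow> (('p, 'q) inf_jet \<Rightarrow> real) \<Rightarrow> ('p, 'q) inf_jet \<Rightarrow> real" where
  "total_deriv i F z = d_x i F z +
     (\<Sum>(\<alpha>, J) | d_u (\<alpha>, J) F z \<noteq> 0. snd z (\<alpha>, add_mset i J) * d_u (\<alpha>, J) F z)"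

definition neg_total_deriv ::
  "'p::finite multiset \<Rightarrow> (('p, 'q) inf_jet \<Rightarrow> real) \<Rightarrow> ('p, 'q) inf_jet \<Rightarrow> real" where
  "neg_total_deriv J F z = (- 1) ^ size J * foldr total_deriv (idx_list J) F z"

definition euler_op :: "'q \<Rightarrow> (('p::finite, 'q::finite, 'n) jet \<Rightarrow> real) \<Rightarrow> ('p, 'q) inf_jet \<Rightarrow> real" where
  "euler_op \<alpha> L z = (\<Sum>J | size J \<le> CARD('n). neg_total_deriv J (d_u (\<alpha>, J) (L \<circ> jet_proj)) z)"


section \<open>Tempered generalized functions on the jet space\<close>

definition tau_moderate :: "(real ^ 'p) set \<Rightarrow> ('p::finite, 'q::finite, 'n) jet net set" where
  "tau_moderate \<Omega> = {L. (\<forall>\<epsilon>\<in>{0<..1}. L \<epsilon> \<in> cinf (\<Omega> \<times> UNIV) (closure \<Omega> \<times> UNIV)) \<and>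
     (\<forall>bs\<in>lists Basis. \<exists>N::nat. sup_bigo (closure \<Omega> \<times> UNIV)
        (\<lambda>\<epsilon> z. pdbar (\<Omega> \<times> UNIV) bs (L \<epsilon>) z / (1 + norm z) ^ N) (\<lambda>\<epsilon>. 1 / \<epsilon> ^ N))}"

definition tau_negligible :: "(real ^ 'p) set \<Rightarrow> ('p::finite, 'q::finite, 'n) jet net set" where
  "tau_negligible \<Omega> = {L. (\<forall>\<epsilon>\<in>{0<..1}. L \<epsilon> \<in> cinf (\<Omega> \<times> UNIV) (closure \<Omega> \<times> UNIV)) \<and>
     (\<forall>bs\<in>lists Basis. \<exists>l::nat. \<forall>m::nat. sup_bigo (closure \<Omega> \<times> UNIV)
        (\<lambda>\<epsilon> z. pdbar (\<Omega> \<times> UNIV) bs (L \<epsilon>) z / (1 + norm z) ^ l) (\<lambda>\<epsilon>. \<epsilon> ^ m))}"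

definition tau_colombeau :: "(real ^ 'p) set \<Rightarrow> ('p::finite, 'q::finite, 'n) jet net set set" where
  "tau_colombeau \<Omega> = tau_moderate \<Omega> // net_rel (tau_moderate \<Omega>) (tau_negligible \<Omega>)"


section \<open>The variational problem\<close>

text \<open>Elements of \<open>\<G>\<^sup>q\<close> are families of classes, indexed by the type \<open>'q\<close>.\<close>

definition tau_compose ::
  "(real ^ 'p) set \<Rightarrow> ('p::finite, 'q::finite, 'n) jet net set \<Rightarrow> ('q \<Rightarrow> (real ^ 'p) net set)
     \<Rightarrow> (real ^ 'p) net set" where
  "tau_compose \<Omega> L u = (\<Union>M\<in>L. \<Union>v\<in>Pi UNIV u.
     colombeau_rel \<Omega> (closure \<Omega>) `` {\<lambda>\<epsilon> x. M \<epsilon> (jet_of \<Omega> (\<lambda>\<alpha>. v \<alpha> \<epsilon>) x)})"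

definition functional ::
  "(real ^ 'p) set \<Rightarrow> ('p::finite, 'q::finite, 'n) jet net set \<Rightarrow> ('q \<Rightarrow> (real ^ 'p) net set)
     \<Rightarrow> (real \<Rightarrow> real) set" where
  "functional \<Omega> L u = (\<Union>f\<in>tau_compose \<Omega> L u. greal_rel `` {\<lambda>\<epsilon>. LINT x:\<Omega>|lebesgue. f \<epsilon> x})"

definition admissible ::
  "(real ^ 'p) set \<Rightarrow> ('q \<Rightarrow> (real ^ 'p::finite) net set) \<Rightarrow> ('q \<Rightarrow> (real ^ 'p) net set) set" where
  "admissible \<Omega> u0 = {w. \<forall>\<alpha>. w \<alpha> \<in> colombeau \<Omega> (closure \<Omega>) \<and> bd_restrict \<Omega> (w \<alpha>) = u0 \<alpha>}"

definition euler_along ::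
  "(real ^ 'p) set \<Rightarrow> 'q \<Rightarrow> ('p::finite, 'q::finite, 'n) jet net set \<Rightarrow> ('q \<Rightarrow> (real ^ 'p) net set)
     \<Rightarrow> (real ^ 'p) net set" where
  "euler_along \<Omega> \<alpha> L u = (\<Union>M\<in>L. \<Union>v\<in>Pi UNIV u.
     colombeau_rel \<Omega> \<Omega> `` {\<lambda>\<epsilon> x. euler_op \<alpha> (M \<epsilon>) (inf_jet_of \<Omega> (\<lambda>\<beta>. v \<beta> \<epsilon>) x)})"

definition colombeau_zero :: "'a::euclidean_space set \<Rightarrow> 'a set \<Rightarrow> 'a net set" where
  "colombeau_zero \<Omega> D = colombeau_rel \<Omega> D `` {\<lambda>\<epsilon> x. 0}"

end

theory Submission
  imports Defs
begin

text \<open>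
  A minimizer of a functional has vanishing first variation, and integration by parts turns the
  first variation into the Euler expression, tested against the variation.  In the Colombeau setting
  the argument becomes quantitative.  Fix representatives \<open>M\<close> of the Lagrangian and \<open>v\<close> of the
  minimizer, and let \<open>E\<^sub>\<epsilon>\<close> be the Euler expression of \<open>M\<^sub>\<epsilon>\<close> along \<open>v\<^sub>\<epsilon>\<close>.  It is a net of smooth functions
  all of whose derivatives are bounded on \<open>\<Omega>\<close> by powers of \<open>1 / \<epsilon>\<close>.  Let \<open>\<theta>\<close> be a smooth nonnegative
  function supported in a closed ball inside \<open>\<Omega>\<close>.  The competitor \<open>v\<^sub>\<epsilon> - \<epsilon>\<^sup>k \<theta> E\<^sub>\<epsilon>\<close> has the same
  boundary values, because it differs from \<open>v\<^sub>\<epsilon>\<close> on a compact subset of \<open>\<Omega>\<close> only.  A Taylor expansion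
  of \<open>M\<^sub>\<epsilon>\<close> in the jet variables and integration by parts show that its action minus that of \<open>v\<^sub>\<epsilon>\<close> is
  \<open>- \<epsilon>\<^sup>k \<integral> \<theta> E\<^sub>\<epsilon>\<^sup>2 + O(\<epsilon>\<^bsup>2 k - N\<^esup>)\<close> with \<open>N\<close> independent of \<open>k\<close>, whereas minimality makes
  the difference larger than \<open>- \<epsilon>\<^sup>m\<close> for every \<open>m\<close>.  With \<open>m = 2 k\<close> and \<open>k\<close> arbitrary, the integral of
  \<open>\<theta> E\<^sub>\<epsilon>\<^sup>2\<close> is \<open>O(\<epsilon>\<^sup>m)\<close> for all \<open>m\<close> (lemma \<open>euler_expr_negligible\<close>).

  From here on only the growth of the derivatives matters.  A moderate Lipschitz constant spreads a
  large value of \<open>E\<^sub>\<epsilon>\<close> over a ball whose radius is a power of \<open>\<epsilon>\<close>, so a small integral forces small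
  values (\<open>negligible_from_integral\<close>); and a function with small values and moderate second
  derivatives has small first derivatives (\<open>negligible_on_pdiff\<close>).  Hence all derivatives of \<open>E\<^sub>\<epsilon>\<close> are
  negligible on compact sets, which is the assertion.

  Two tools carry the bookkeeping.  The first is a class of nets of functions on the infinite jet
  space (\<open>jet_smooth\<close>), closed under sums, products and total derivatives, which contains the
  Lagrangian and the function \<open>\<theta>\<close>, and whose members, evaluated along \<open>v\<close>, have partial derivatives
  given by total derivatives (\<open>pdiffs_along\<close>) and bounded by powers of \<open>1 / \<epsilon>\<close>
  (\<open>along_pdiffs_bound\<close>).  Applied to the Euler expression it gives the moderateness of \<open>E\<^sub>\<epsilon>\<close> and of the
  variation.  The second is that the action does not depend on representatives up to negligible
  numbers (\<open>functional_representative\<close>, \<open>compose_well_defined\<close>), so that the inequality between the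
  classes holds for the chosen \<open>M\<close> and \<open>v\<close>.
\<close>

section \<open>Iterated partial derivatives\<close>

lemma eventually_line_in_open:
  fixes S :: "'a::real_normed_vector set"
  assumes "open S" "x \<in> S"
  shows "\<forall>\<^sub>F t in nhds (0::real). x + t *\<^sub>R b \<in> S"
proof -
  have "((\<lambda>t. x + t *\<^sub>R b) \<longlongrightarrow> x + 0 *\<^sub>R b) (nhds 0)"
    by (intro tendsto_intros filterlim_ident)
  then show ?thesis using assms by (simp add: topological_tendstoD)
qed

lemma DERIV_eventually_cong:
  assumes "(f has_real_derivative D) (at x)" "\<forall>\<^sub>F t in nhds x. f t = g t"
  shows "(g has_real_derivative D) (at x)"
  using assms DERIV_cong_ev[OF refl assms(2) refl] by simp

lemma pdiff_cong_ev:
  "\<forall>\<^sub>F t in nhds 0. f (x + t *\<^sub>R b) = g (x + t *\<^sub>R b) \<Longrightarrow> pdiff b f x = pdiff b g x"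
  unfolding pdiff_def by (rule deriv_cong_ev) simp_all

lemma pdiff_cong:
  assumes "open S" "x \<in> S" "\<And>y. y \<in> S \<Longrightarrow> f y = g y"
  shows "pdiff b f x = pdiff b g x"
  by (rule pdiff_cong_ev[OF eventually_mono[OF eventually_line_in_open[OF assms(1,2), of b]]])
     (rule assms(3))

lemma smooth_along_pdiffs:
  assumes "smooth_along B S f" "cs \<in> lists B"
  shows "smooth_along B S (pdiffs cs f)"
  unfolding smooth_along_def
proof (intro ballI conjI)
  fix bs assume bs: "bs \<in> lists B"
  then have l: "bs @ cs \<in> lists B" using assms by auto
  show "continuous_on S (pdiffs bs (pdiffs cs f))"
    using assms(1)[unfolded smooth_along_def, rule_format, OF l] by simp
  fix b x assume "b \<in> B" "x \<in> S"
  then show "(\<lambda>t. pdiffs bs (pdiffs cs f) (x + t *\<^sub>R b)) differentiable at 0"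
    using assms(1)[unfolded smooth_along_def, rule_format, OF l] by simp
qed

lemma smooth_along_pdiff:
  assumes "smooth_along B S f" "b \<in> B"
  shows "smooth_along B S (pdiff b f)"
  using smooth_along_pdiffs[OF assms(1), of "[b]"] assms(2) by simp

lemma smooth_along_continuous:
  "smooth_along B S f \<Longrightarrow> continuous_on S f"
  unfolding smooth_along_def by (metis foldr_Nil id_apply lists.Nil)

lemma smooth_along_DERIV:
  assumes f: "smooth_along B S f" and b: "b \<in> B" and x: "x + t *\<^sub>R b \<in> S"
  shows "((\<lambda>t. f (x + t *\<^sub>R b)) has_real_derivative pdiff b f (x + t *\<^sub>R b)) (at t)"
proof -
  have "(\<lambda>s. pdiffs [] f ((x + t *\<^sub>R b) + s *\<^sub>R b)) differentiable at 0"
    using f b x unfolding smooth_along_def by (metis lists.Nil)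
  then obtain D where D: "((\<lambda>s. f ((x + t *\<^sub>R b) + s *\<^sub>R b)) has_real_derivative D) (at 0)"
    by (auto simp: real_differentiable_def)
  then have "D = pdiff b f (x + t *\<^sub>R b)" using DERIV_imp_deriv[OF D] by (simp add: pdiff_def)
  with D have "((\<lambda>s. f ((x + t *\<^sub>R b) + s *\<^sub>R b)) has_real_derivative pdiff b f (x + t *\<^sub>R b)) (at 0)"
    by simp
  then have "((\<lambda>s. f (x + (s + t) *\<^sub>R b)) has_real_derivative pdiff b f (x + t *\<^sub>R b)) (at 0)"
    by (simp add: algebra_simps)
  then show ?thesis
    using DERIV_shift[of "\<lambda>s. f (x + s *\<^sub>R b)" "pdiff b f (x + t *\<^sub>R b)" 0 t] by simp
qed

lemma pdiff_eqI:
  assumes "((\<lambda>t. f (x + t *\<^sub>R b)) has_real_derivative D) (at 0)"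
  shows "pdiff b f x = D"
  using DERIV_imp_deriv[OF assms] by (simp add: pdiff_def)

text \<open>
  Partial derivatives at a point of \<open>S\<close> see the values on \<open>S\<close> only, provided that short segments in
  the given directions stay in \<open>S\<close>.  This covers open sets and also open pieces of a hyperplane with
  directions parallel to it, which is how functions on the boundary are differentiated in a chart.
\<close>

lemma pdiffs_cong_along:
  assumes S: "\<And>b x. \<lbrakk>b \<in> B; x \<in> S\<rbrakk> \<Longrightarrow> \<forall>\<^sub>F t in nhds 0. x + t *\<^sub>R b \<in> S"
    and eq: "\<And>y. y \<in> S \<Longrightarrow> f y = g y" and bs: "bs \<in> lists B" and x: "x \<in> S"
  shows "pdiffs bs f x = pdiffs bs g x"
  using bs x
proof (induction bs arbitrary: x rule: list.induct)
  case (Cons b bs)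
  have "pdiff b (pdiffs bs f) x = pdiff b (pdiffs bs g) x"
    by (rule pdiff_cong_ev[OF eventually_mono[OF S[of b x]]]) (use Cons in auto)
  then show ?case by simp
qed (use eq in simp)

lemma smooth_along_cong_along:
  assumes S: "\<And>b x. \<lbrakk>b \<in> B; x \<in> S\<rbrakk> \<Longrightarrow> \<forall>\<^sub>F t in nhds 0. x + t *\<^sub>R b \<in> S"
    and eq: "\<And>y. y \<in> S \<Longrightarrow> f y = g y" and f: "smooth_along B S f"
  shows "smooth_along B S g"
  unfolding smooth_along_def
proof (intro ballI conjI)
  fix bs assume bs: "bs \<in> lists B"
  have e: "pdiffs bs f x = pdiffs bs g x" if "x \<in> S" for x
    by (rule pdiffs_cong_along[OF S eq bs that])
  show "continuous_on S (pdiffs bs g)"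
    using smooth_along_continuous[OF smooth_along_pdiffs[OF f bs]] e by (simp cong: continuous_on_cong)
  fix b x assume b: "b \<in> B" and x: "x \<in> S"
  have "((\<lambda>t. pdiffs bs f (x + t *\<^sub>R b)) has_real_derivative pdiff b (pdiffs bs f) (x + 0 *\<^sub>R b)) (at 0)"
    by (rule smooth_along_DERIV[OF smooth_along_pdiffs[OF f bs] b]) (use x in simp)
  then have "((\<lambda>t. pdiffs bs g (x + t *\<^sub>R b)) has_real_derivative pdiff b (pdiffs bs f) (x + 0 *\<^sub>R b)) (at 0)"
    by (rule DERIV_eventually_cong) (rule eventually_mono[OF S[OF b x]], rule e)
  then show "(\<lambda>t. pdiffs bs g (x + t *\<^sub>R b)) differentiable at 0"
    by (auto simp: real_differentiable_def)
qed

lemma pdiffs_cong: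
  assumes "open S" "x \<in> S" "\<And>y. y \<in> S \<Longrightarrow> f y = g y"
  shows "pdiffs bs f x = pdiffs bs g x"
  by (rule pdiffs_cong_along[where B = UNIV and S = S])
     (use assms eventually_line_in_open in auto)

lemma smooth_along_cong:
  assumes S: "open S" and eq: "\<And>y. y \<in> S \<Longrightarrow> f y = g y" and f: "smooth_along B S f"
  shows "smooth_along B S g"
  by (rule smooth_along_cong_along[OF eventually_line_in_open[OF S] eq f])

lemma pdiffs_lincomb:
  fixes c d :: real
  assumes S: "open S" and f: "smooth_along B S f" and g: "smooth_along B S g"
    and bs: "bs \<in> lists B" and x: "x \<in> S"
  shows "pdiffs bs (\<lambda>x. c * f x + d * g x) x = c * pdiffs bs f x + d * pdiffs bs g x"
  using bs x
proof (induction bs arbitrary: x rule: list.induct)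
  case (Cons b bs)
  have "pdiff b (pdiffs bs (\<lambda>x. c * f x + d * g x)) x
      = pdiff b (\<lambda>x. c * pdiffs bs f x + d * pdiffs bs g x) x"
    by (rule pdiff_cong[OF S Cons.prems(2)]) (use Cons in auto)
  also have "\<dots> = c * pdiff b (pdiffs bs f) x + d * pdiff b (pdiffs bs g) x"
  proof (rule pdiff_eqI)
    have "((\<lambda>t. pdiffs bs h (x + t *\<^sub>R b)) has_real_derivative pdiff b (pdiffs bs h) x) (at 0)"
      if "smooth_along B S h" for h
      using smooth_along_DERIV[OF smooth_along_pdiffs[OF that], of bs b x 0] Cons.prems by auto
    from this[OF f] this[OF g]
    show "((\<lambda>t. c * pdiffs bs f (x + t *\<^sub>R b) + d * pdiffs bs g (x + t *\<^sub>R b)) has_real_derivative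
      c * pdiff b (pdiffs bs f) x + d * pdiff b (pdiffs bs g) x) (at 0)"
      by (intro DERIV_add DERIV_cmult)
  qed
  finally show ?case by simp
qed simp

lemma smooth_along_lincomb:
  fixes c d :: real
  assumes S: "open S" and f: "smooth_along B S f" and g: "smooth_along B S g"
  shows "smooth_along B S (\<lambda>x. c * f x + d * g x)"
  unfolding smooth_along_def
proof (intro ballI conjI)
  fix bs assume bs: "bs \<in> lists B"
  have c: "continuous_on S (pdiffs bs h)" if "smooth_along B S h" for h
    using smooth_along_continuous[OF smooth_along_pdiffs[OF that bs]] .
  have "continuous_on S (\<lambda>x. c * pdiffs bs f x + d * pdiffs bs g x)"
    by (intro continuous_intros c f g)
  then show "continuous_on S (pdiffs bs (\<lambda>x. c * f x + d * g x))"
    using pdiffs_lincomb[OF S f g bs] by (simp cong: continuous_on_cong)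
  fix b x assume b: "b \<in> B" and x: "x \<in> S"
  have "((\<lambda>t. pdiffs bs h (x + t *\<^sub>R b)) has_real_derivative pdiff b (pdiffs bs h) x) (at 0)"
    if "smooth_along B S h" for h
    using smooth_along_DERIV[OF smooth_along_pdiffs[OF that bs] b, of x 0] x by auto
  from this[OF f] this[OF g]
  have "((\<lambda>t. c * pdiffs bs f (x + t *\<^sub>R b) + d * pdiffs bs g (x + t *\<^sub>R b)) has_real_derivative
      c * pdiff b (pdiffs bs f) x + d * pdiff b (pdiffs bs g) x) (at 0)"
    by (intro DERIV_add DERIV_cmult)
  moreover have "\<forall>\<^sub>F t in nhds 0. c * pdiffs bs f (x + t *\<^sub>R b) + d * pdiffs bs g (x + t *\<^sub>R b)
       = pdiffs bs (\<lambda>x. c * f x + d * g x) (x + t *\<^sub>R b)"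
    by (rule eventually_mono[OF eventually_line_in_open[OF S x, of b]])
       (use pdiffs_lincomb[OF S f g bs] in simp)
  ultimately have "((\<lambda>t. pdiffs bs (\<lambda>x. c * f x + d * g x) (x + t *\<^sub>R b)) has_real_derivative
      c * pdiff b (pdiffs bs f) x + d * pdiff b (pdiffs bs g) x) (at 0)"
    using DERIV_cong_ev by fast
  then show "(\<lambda>t. pdiffs bs (\<lambda>x. c * f x + d * g x) (x + t *\<^sub>R b)) differentiable at 0"
    by (auto simp: real_differentiable_def)
qed

lemma pdiffs_zero [simp]: "pdiffs bs (\<lambda>x. 0) = (\<lambda>x. 0)"
  by (induction bs) (auto simp: pdiff_def)

lemma smooth_along_zero [simp]: "smooth_along B S (\<lambda>x. 0)"
  by (simp add: smooth_along_def)

text \<open>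
  Two applications of the mean value theorem express the second difference over a parallelogram by
  a mixed derivative at an inner point.  The left-hand side is symmetric in \<open>a\<close> and \<open>b\<close>, hence the
  mixed derivatives in the two orders agree at nearby points; this is the proof of \<open>pdiff_commute\<close>.
\<close>

lemma second_difference_eq:
  fixes f :: "'a::real_normed_vector \<Rightarrow> real"
  assumes f: "smooth_along B S f" and a: "a \<in> B" and b: "b \<in> B" and h: "0 < h"
    and S: "\<And>s t. \<lbrakk>0 \<le> s; s \<le> h; 0 \<le> t; t \<le> h\<rbrakk> \<Longrightarrow> x + s *\<^sub>R a + t *\<^sub>R b \<in> S"
  obtains s t where "0 < s" "s < h" "0 < t" "t < h"
    "f (x + h *\<^sub>R a + h *\<^sub>R b) - f (x + h *\<^sub>R a) - f (x + h *\<^sub>R b) + f x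
       = h\<^sup>2 * pdiff b (pdiff a f) (x + s *\<^sub>R a + t *\<^sub>R b)"
proof -
  let ?g = "\<lambda>s. f (x + h *\<^sub>R b + s *\<^sub>R a) - f (x + s *\<^sub>R a)"
  let ?g' = "\<lambda>s. pdiff a f (x + h *\<^sub>R b + s *\<^sub>R a) - pdiff a f (x + s *\<^sub>R a)"
  have "DERIV ?g s :> ?g' s" if "0 \<le> s" "s \<le> h" for s
    by (intro DERIV_diff smooth_along_DERIV[OF f a])
       (use S[of s h] S[of s 0] that h in \<open>auto simp: algebra_simps\<close>)
  from MVT2[OF h this] obtain s where s: "0 < s" "s < h" "?g h - ?g 0 = h * ?g' s" by auto
  let ?k = "\<lambda>t. pdiff a f (x + s *\<^sub>R a + t *\<^sub>R b)"
  have "DERIV ?k t :> pdiff b (pdiff a f) (x + s *\<^sub>R a + t *\<^sub>R b)" if "0 \<le> t" "t \<le> h" for t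
    by (intro smooth_along_DERIV[OF smooth_along_pdiff[OF f a] b]) (use S[of s t] that s in auto)
  from MVT2[OF h this] obtain t where t: "0 < t" "t < h"
    "?k h - ?k 0 = h * pdiff b (pdiff a f) (x + s *\<^sub>R a + t *\<^sub>R b)" by auto
  have "?g h - ?g 0 = h * (?k h - ?k 0)" using s(3) by (simp add: algebra_simps)
  then have "?g h - ?g 0 = h\<^sup>2 * pdiff b (pdiff a f) (x + s *\<^sub>R a + t *\<^sub>R b)"
    using t(3) by (simp add: power2_eq_square)
  moreover have "?g h - ?g 0 = f (x + h *\<^sub>R a + h *\<^sub>R b) - f (x + h *\<^sub>R a) - f (x + h *\<^sub>R b) + f x"
    by (simp add: algebra_simps)
  ultimately show thesis using that s t by metis
qed

lemma pdiff_commute: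
  fixes f :: "'a::real_normed_vector \<Rightarrow> real"
  assumes f: "smooth_along B S f" and S: "open S" and a: "a \<in> B" and b: "b \<in> B" and x: "x \<in> S"
  shows "pdiff a (pdiff b f) x = pdiff b (pdiff a f) x"
proof -
  obtain r where r: "r > 0" "ball x r \<subseteq> S" using S x open_contains_ball by blast
  \<comment> \<open>the parallelogram with sides \<open>h n *\<^sub>R a\<close> and \<open>h n *\<^sub>R b\<close> lies in the ball and shrinks to \<open>x\<close>\<close>
  define h :: "nat \<Rightarrow> real" where "h n = r / (norm a + norm b + 1) / (real n + 1)" for n
  have h0: "h n > 0" for n using r by (simp add: h_def add_nonneg_pos)
  have pos: "norm a + norm b + 1 > 0" by (simp add: add_nonneg_pos)
  have hr: "h n * (norm a + norm b + 1) \<le> r" for n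
  proof -
    have "h n * (norm a + norm b + 1) = r / (real n + 1)" using pos by (simp add: h_def)
    also have "\<dots> \<le> r / 1" using r by (intro divide_left_mono) auto
    finally show ?thesis by simp
  qed
  have inS: "x + s *\<^sub>R a + t *\<^sub>R b \<in> S" if "0 \<le> s" "s \<le> h n" "0 \<le> t" "t \<le> h n" for s t n
  proof -
    have "norm (s *\<^sub>R a + t *\<^sub>R b) \<le> s * norm a + t * norm b"
      using norm_triangle_ineq[of "s *\<^sub>R a" "t *\<^sub>R b"] that by simp
    also have "\<dots> \<le> h n * norm a + h n * norm b"
      using that by (intro add_mono mult_right_mono) auto
    also have "\<dots> < h n * (norm a + norm b + 1)" using h0[of n] by (simp add: algebra_simps)
    finally have "norm (s *\<^sub>R a + t *\<^sub>R b) < r" using hr[of n] by linarith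
    then have "x + (s *\<^sub>R a + t *\<^sub>R b) \<in> ball x r"
      by (metis add_diff_cancel_left' dist_norm dist_commute mem_ball)
    then show ?thesis using r(2) by (auto simp: add.assoc)
  qed
  have "\<exists>s t s' t'. 0 < s \<and> s < h n \<and> 0 < t \<and> t < h n \<and> 0 < s' \<and> s' < h n \<and> 0 < t' \<and> t' < h n \<and>
    pdiff b (pdiff a f) (x + s *\<^sub>R a + t *\<^sub>R b) = pdiff a (pdiff b f) (x + s' *\<^sub>R a + t' *\<^sub>R b)" for n
  proof -
    obtain s t where 1: "0 < s" "s < h n" "0 < t" "t < h n"
    "f (x + h n *\<^sub>R a + h n *\<^sub>R b) - f (x + h n *\<^sub>R a) - f (x + h n *\<^sub>R b) + f x
       = (h n)\<^sup>2 * pdiff b (pdiff a f) (x + s *\<^sub>R a + t *\<^sub>R b)"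
      using second_difference_eq[OF f a b h0[of n] inS[where n = n]] by blast
    have inS': "x + t *\<^sub>R b + s *\<^sub>R a \<in> S" if "0 \<le> t" "t \<le> h n" "0 \<le> s" "s \<le> h n" for s t n
      using inS[OF that(3,4,1,2)] by (simp add: algebra_simps)
    obtain t' s' where 2: "0 < s'" "s' < h n" "0 < t'" "t' < h n"
    "f (x + h n *\<^sub>R b + h n *\<^sub>R a) - f (x + h n *\<^sub>R b) - f (x + h n *\<^sub>R a) + f x
       = (h n)\<^sup>2 * pdiff a (pdiff b f) (x + t' *\<^sub>R b + s' *\<^sub>R a)"
      using second_difference_eq[OF f b a h0[of n] inS'[where n = n]] by blast
    have "(h n)\<^sup>2 * pdiff b (pdiff a f) (x + s *\<^sub>R a + t *\<^sub>R b)
        = (h n)\<^sup>2 * pdiff a (pdiff b f) (x + s' *\<^sub>R a + t' *\<^sub>R b)"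
      using 1(5) 2(5) by (simp add: algebra_simps)
    then show ?thesis using 1 2 h0[of n] by (metis mult_cancel_left power_eq_0_iff less_irrefl)
  qed
  then obtain s t s' t' where st: "\<And>n. 0 < s n \<and> s n < h n \<and> 0 < t n \<and> t n < h n \<and> 0 < s' n \<and> s' n < h n \<and> 0 < t' n \<and> t' n < h n \<and>
    pdiff b (pdiff a f) (x + s n *\<^sub>R a + t n *\<^sub>R b) = pdiff a (pdiff b f) (x + s' n *\<^sub>R a + t' n *\<^sub>R b)"
    by metis
  have hlim: "h \<longlonglongrightarrow> 0"
  proof -
    have "(\<lambda>n. (r / (norm a + norm b + 1)) * (1 / real (Suc n))) \<longlonglongrightarrow> (r / (norm a + norm b + 1)) * 0"
      by (intro tendsto_intros LIMSEQ_Suc[OF lim_1_over_n])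
    then show ?thesis by (simp add: h_def[abs_def] add.commute)
  qed
  have sq: "k \<longlonglongrightarrow> 0" if "\<And>n. 0 < k n \<and> k n < h n" for k
    by (rule real_tendsto_sandwich[OF _ _ tendsto_const hlim])
       (use that less_imp_le in \<open>auto intro!: always_eventually\<close>)
  have lims: "(\<lambda>n. g (x + k n *\<^sub>R a + l n *\<^sub>R b)) \<longlonglongrightarrow> g x"
    if g: "continuous_on S g" and "k \<longlonglongrightarrow> 0" "l \<longlonglongrightarrow> 0" for g :: "'a \<Rightarrow> real" and k l
  proof -
    have "(\<lambda>n. x + k n *\<^sub>R a + l n *\<^sub>R b) \<longlonglongrightarrow> x + 0 *\<^sub>R a + 0 *\<^sub>R b"
      using that by (intro tendsto_intros)
    moreover have "isCont g x" using g S x continuous_on_eq_continuous_at by blast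
    ultimately show ?thesis using isCont_tendsto_compose[of x g] by simp
  qed
  have c: "continuous_on S (pdiff c (pdiff d f))" if "c \<in> B" "d \<in> B" for c d
    using smooth_along_continuous smooth_along_pdiff f that by blast
  have "(\<lambda>n. pdiff b (pdiff a f) (x + s n *\<^sub>R a + t n *\<^sub>R b)) \<longlonglongrightarrow> pdiff b (pdiff a f) x"
    by (rule lims[OF c[OF b a] sq sq]) (use st in auto)
  moreover have "(\<lambda>n. pdiff a (pdiff b f) (x + s' n *\<^sub>R a + t' n *\<^sub>R b)) \<longlonglongrightarrow> pdiff a (pdiff b f) x"
    by (rule lims[OF c[OF a b] sq sq]) (use st in auto)
  ultimately show ?thesis using st LIMSEQ_unique by simp
qed

lemma pdiffs_move_front:
  assumes f: "smooth_along B S f" and S: "open S" and B: "cs @ b # ds \<in> lists B" and x: "x \<in> S"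
  shows "pdiffs (cs @ b # ds) f x = pdiffs (b # cs @ ds) f x"
  using B x
proof (induction cs arbitrary: x rule: list.induct)
  case (Cons c cs)
  have "pdiffs ((c # cs) @ b # ds) f x = pdiff c (pdiffs (b # cs @ ds) f) x"
    using pdiff_cong[OF S Cons.prems(2), of "pdiffs (cs @ b # ds) f"] Cons by simp
  also have "\<dots> = pdiff b (pdiff c (pdiffs (cs @ ds) f)) x"
    using pdiff_commute[OF smooth_along_pdiffs[OF f] S, of "cs @ ds" c b x] Cons.prems by auto
  finally show ?case by simp
qed simp

text \<open>
  Multi-indices are unordered, but every derivative is taken along some list.  This lemma makes the
  choice of the list immaterial.
\<close>

lemma pdiffs_permute:
  assumes f: "smooth_along B S f" and S: "open S"
    and "bs \<in> lists B" "mset bs = mset cs" "x \<in> S"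
  shows "pdiffs bs f x = pdiffs cs f x"
  using assms(3-)
proof (induction bs arbitrary: cs x rule: list.induct)
  case (Cons b bs)
  have "b \<in> set cs" using Cons.prems(2) by (metis list.set_intros(1) set_mset_mset)
  then obtain c1 c2 where cs: "cs = c1 @ b # c2" by (meson split_list)
  have "set (b # bs) = set cs" using Cons.prems(2) by (metis set_mset_mset)
  then have B: "c1 @ b # c2 \<in> lists B" using Cons.prems(1) cs by auto
  have "pdiffs (b # bs) f x = pdiff b (pdiffs (c1 @ c2) f) x"
    using pdiff_cong[OF S Cons.prems(3), of "pdiffs bs f" "pdiffs (c1 @ c2) f"] Cons.IH[of "c1 @ c2"]
      Cons.prems cs by simp
  also have "\<dots> = pdiffs cs f x" using pdiffs_move_front[OF f S B Cons.prems(3)] cs by simp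
  finally show ?case .
qed simp

section \<open>Nets of functions on the infinite jet space\<close>

lemma eventually_at_right_0_less:
  "0 < c \<Longrightarrow> \<forall>\<^sub>F \<epsilon> in at_right (0::real). 0 < \<epsilon> \<and> \<epsilon> < c"
  using eventually_at_right_real[of 0 c] by (auto elim: eventually_mono)

lemma eventually_const_times_le_1:
  "\<forall>\<^sub>F \<epsilon> in at_right 0. 0 < \<epsilon> \<and> C * \<epsilon> \<le> (1::real)"
proof -
  have "\<forall>\<^sub>F \<epsilon> in at_right 0. 0 < \<epsilon> \<and> \<epsilon> < 1 / (\<bar>C\<bar> + 1)"
    by (intro eventually_at_right_0_less) (simp add: add_nonneg_pos)
  then show ?thesis
  proof eventually_elim
    case (elim \<epsilon>)
    then have "(\<bar>C\<bar> + 1) * \<epsilon> < 1" by (simp add: pos_less_divide_eq add_nonneg_pos mult.commute)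
    moreover have "C * \<epsilon> \<le> (\<bar>C\<bar> + 1) * \<epsilon>" using elim by (intro mult_right_mono) auto
    ultimately show ?case using elim by linarith
  qed
qed

lemma add_le_inverse_powers:
  fixes \<epsilon> :: real
  assumes "0 < \<epsilon>" "\<epsilon> < 1/2" "a \<le> 1 / \<epsilon> ^ m" "b \<le> 1 / \<epsilon> ^ n"
  shows "a + b \<le> 1 / \<epsilon> ^ Suc (m + n)"
proof -
  have "1 / \<epsilon> ^ m \<le> 1 / \<epsilon> ^ (m + n)" "1 / \<epsilon> ^ n \<le> 1 / \<epsilon> ^ (m + n)"
    using assms by (intro divide_left_mono power_decreasing; simp)+
  moreover have "2 * (1 / \<epsilon> ^ (m + n)) \<le> (1 / \<epsilon>) * (1 / \<epsilon> ^ (m + n))"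
    using assms by (intro mult_right_mono) (auto simp: field_simps)
  ultimately show ?thesis using assms by simp
qed

lemma inverse_power_mono:
  fixes \<epsilon> :: real
  assumes "0 < \<epsilon>" "\<epsilon> \<le> 1" "m \<le> n"
  shows "1 / \<epsilon> ^ m \<le> 1 / \<epsilon> ^ n"
  using assms by (intro divide_left_mono power_decreasing) auto

text \<open>
  The coordinates of the infinite jet space are the \<open>x\<^sup>i\<close> (\<open>Inl i\<close>) and the \<open>u\<^sup>\<alpha>\<^sub>J\<close> (\<open>Inr (\<alpha>, J)\<close>).
  Treating both kinds of partial derivatives as derivatives along a shift at \<open>0\<close> gives one proof of
  the product rule for both.
\<close>

fun shift :: "'p + ('q \<times> 'p multiset) \<Rightarrow> real \<Rightarrow> ('p::finite, 'q) inf_jet \<Rightarrow> ('p, 'q) inf_jet" where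
  "shift (Inl i) t (x, U) = (x + t *\<^sub>R axis i 1, U)"
| "shift (Inr a) t (x, U) = (x, U(a := U a + t))"

definition jet_pd :: "'p + ('q \<times> 'p multiset) \<Rightarrow> (('p::finite, 'q) inf_jet \<Rightarrow> real) \<Rightarrow> ('p, 'q) inf_jet \<Rightarrow> real" where
  "jet_pd d F z = deriv (\<lambda>t. F (shift d t z)) 0"

lemma shift_0 [simp]: "shift d 0 z = z"
  by (cases d; cases z) auto

lemma d_x_eq: "d_x i = jet_pd (Inl i)"
  by (auto simp: fun_eq_iff d_x_def jet_pd_def)

lemma deriv_shift_0: "deriv (f :: real \<Rightarrow> real) c = deriv (\<lambda>t. f (c + t)) 0"
  unfolding deriv_def using DERIV_shift[of f _ 0 c] by (simp add: add.commute)

lemma d_u_eq: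
  fixes a :: "'q \<times> 'p::finite multiset"
  shows "d_u a = jet_pd (Inr a)"
proof (intro ext)
  fix F :: "('p, 'q) inf_jet \<Rightarrow> real" and z :: "('p, 'q) inf_jet"
  obtain x U where z: "z = (x, U)" by (cases z)
  show "d_u a F z = jet_pd (Inr a) F z"
    unfolding d_u_def jet_pd_def z using deriv_shift_0[of "\<lambda>t. F (x, U(a := t))" "U a"] by simp
qed

abbreviation jet_le :: "nat \<Rightarrow> ('q \<times> 'p multiset \<Rightarrow> real) \<Rightarrow> real \<Rightarrow> bool" where
  "jet_le r U B \<equiv> \<forall>a. size (snd a) \<le> r \<longrightarrow> \<bar>U a\<bar> \<le> B"

abbreviation jet_growth ::
  "(real ^ 'p::finite) set \<Rightarrow> nat \<Rightarrow> nat \<Rightarrow> (real \<Rightarrow> ('p, 'q) inf_jet \<Rightarrow> real) \<Rightarrow> nat \<Rightarrow> bool" where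
  "jet_growth \<Omega> r N F N' \<equiv> \<forall>\<^sub>F \<epsilon> in at_right 0. \<forall>x\<in>\<Omega>. \<forall>U.
     jet_le r U (1 / \<epsilon> ^ N) \<longrightarrow> \<bar>F \<epsilon> (x, U)\<bar> \<le> 1 / \<epsilon> ^ N'"

text \<open>
  Functions of jets of order at most \<open>r\<close> over \<open>\<Omega>\<close>, partially differentiable in all coordinates.  The last
  clause replaces temperedness: jets bounded by a power of \<open>1 / \<epsilon>\<close> are mapped to values bounded by a
  power of \<open>1 / \<epsilon>\<close>.  It follows from polynomial growth, is stable under all operations below, and gives
  moderate values along moderate nets.
\<close>

definition jet_regular :: "(real ^ 'p::finite) set \<Rightarrow> nat \<Rightarrow> (real \<Rightarrow> ('p, 'q) inf_jet \<Rightarrow> real) \<Rightarrow> bool" where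
  "jet_regular \<Omega> r F \<longleftrightarrow>
     (\<forall>\<epsilon>\<in>{0<..1}. continuous_on (\<Omega> \<times> UNIV) (F \<epsilon>) \<and>
        (\<forall>z\<in>\<Omega> \<times> UNIV. \<forall>d. (\<lambda>t. F \<epsilon> (shift d t z)) differentiable (at 0)) \<and>
        (\<forall>x\<in>\<Omega>. \<forall>U V. (\<forall>a. size (snd a) \<le> r \<longrightarrow> U a = V a) \<longrightarrow> F \<epsilon> (x, U) = F \<epsilon> (x, V))) \<and>
     (\<forall>N::nat. \<exists>N'::nat. jet_growth \<Omega> r N F N')"

text \<open>
  Iterated partial derivatives up to order \<open>k\<close> are regular.  Counting the order makes the closure
  properties provable by induction, since the derivative of a product is a sum of products of one
  order less.
\<close>

primrec jet_tame :: "(real ^ 'p::finite) set \<Rightarrow> nat \<Rightarrow> nat \<Rightarrow> (real \<Rightarrow> ('p, 'q) inf_jet \<Rightarrow> real) \<Rightarrow> bool" where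
  "jet_tame \<Omega> r 0 F = jet_regular \<Omega> r F"
| "jet_tame \<Omega> r (Suc k) F = (jet_regular \<Omega> r F \<and> (\<forall>d. jet_tame \<Omega> r k (\<lambda>\<epsilon>. jet_pd d (F \<epsilon>))))"

lemma jet_tame_regular: "jet_tame \<Omega> r k F \<Longrightarrow> jet_regular \<Omega> r F"
  by (cases k) auto

lemma jet_tame_SucD: "jet_tame \<Omega> r (Suc k) F \<Longrightarrow> jet_tame \<Omega> r k F"
proof (induction k arbitrary: F)
  case (Suc k)
  then show ?case by (metis jet_tame.simps(2))
qed simp

lemma jet_regularD:
  assumes "jet_regular \<Omega> r F" "\<epsilon> \<in> {0<..1}"
  shows "continuous_on (\<Omega> \<times> UNIV) (F \<epsilon>)"
    and "z \<in> \<Omega> \<times> UNIV \<Longrightarrow> ((\<lambda>t. F \<epsilon> (shift d t z)) has_real_derivative jet_pd d (F \<epsilon>) z) (at 0)"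
    and "\<lbrakk>x \<in> \<Omega>; \<And>a. size (snd a) \<le> r \<Longrightarrow> U a = V a\<rbrakk> \<Longrightarrow> F \<epsilon> (x, U) = F \<epsilon> (x, V)"
proof -
  show "continuous_on (\<Omega> \<times> UNIV) (F \<epsilon>)" using assms unfolding jet_regular_def by blast
  show "x \<in> \<Omega> \<Longrightarrow> (\<And>a. size (snd a) \<le> r \<Longrightarrow> U a = V a) \<Longrightarrow> F \<epsilon> (x, U) = F \<epsilon> (x, V)"
    using assms unfolding jet_regular_def by blast
  assume "z \<in> \<Omega> \<times> UNIV"
  then have "(\<lambda>t. F \<epsilon> (shift d t z)) differentiable (at 0)"
    using assms unfolding jet_regular_def by blast
  then obtain D where D: "((\<lambda>t. F \<epsilon> (shift d t z)) has_real_derivative D) (at 0)"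
    by (auto simp: real_differentiable_def)
  then show "((\<lambda>t. F \<epsilon> (shift d t z)) has_real_derivative jet_pd d (F \<epsilon>) z) (at 0)"
    using DERIV_imp_deriv[OF D] by (simp add: jet_pd_def)
qed

lemma jet_regular_growth:
  assumes "jet_regular \<Omega> r F"
  obtains N' :: nat where "jet_growth \<Omega> r N F N'"
  using assms unfolding jet_regular_def by blast

lemma jet_pd_eqI:
  "((\<lambda>t. F (shift d t z)) has_real_derivative D) (at 0) \<Longrightarrow> jet_pd d F z = D"
  by (simp add: jet_pd_def DERIV_imp_deriv)

lemma eventually_shift_in:
  assumes "open \<Omega>" "z \<in> \<Omega> \<times> UNIV"
  shows "\<forall>\<^sub>F t in nhds 0. shift d t z \<in> \<Omega> \<times> UNIV"
proof -
  obtain x U where z: "z = (x, U)" by (cases z)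
  show ?thesis
  proof (cases d)
    case (Inl i)
    show ?thesis using eventually_line_in_open[of \<Omega> x "axis i 1"] assms Inl z by auto
  qed (use assms z in auto)
qed

lemma jet_pd_cong:
  assumes "open \<Omega>" "z \<in> \<Omega> \<times> UNIV" "\<And>z. z \<in> \<Omega> \<times> UNIV \<Longrightarrow> F z = G z"
  shows "jet_pd d F z = jet_pd d G z"
  unfolding jet_pd_def
  by (rule deriv_cong_ev[OF eventually_mono[OF eventually_shift_in[OF assms(1,2), of d]]])
     (use assms(3) in auto)

lemma jet_regularI:
  assumes "\<And>\<epsilon>. \<epsilon> \<in> {0<..1} \<Longrightarrow> continuous_on (\<Omega> \<times> UNIV) (F \<epsilon>)"
    and "\<And>\<epsilon> z d. \<lbrakk>\<epsilon> \<in> {0<..1}; z \<in> \<Omega> \<times> UNIV\<rbrakk> \<Longrightarrow> \<exists>D. ((\<lambda>t. F \<epsilon> (shift d t z)) has_real_derivative D) (at 0)"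
    and "\<And>\<epsilon> x U V. \<lbrakk>\<epsilon> \<in> {0<..1}; x \<in> \<Omega>; \<And>a. size (snd a) \<le> r \<Longrightarrow> U a = V a\<rbrakk> \<Longrightarrow> F \<epsilon> (x, U) = F \<epsilon> (x, V)"
    and "\<And>N. \<exists>N'::nat. jet_growth \<Omega> r N F N'"
  shows "jet_regular \<Omega> r F"
  unfolding jet_regular_def real_differentiable_def
  using assms(1,2,4) by (auto intro: assms(3))

lemma jet_regular_cong:
  fixes F G :: "real \<Rightarrow> ('p::finite, 'q) inf_jet \<Rightarrow> real"
  assumes \<Omega>: "open \<Omega>" and F: "jet_regular \<Omega> r F"
    and eq: "\<And>\<epsilon> z. \<lbrakk>\<epsilon> \<in> {0<..1}; z \<in> \<Omega> \<times> UNIV\<rbrakk> \<Longrightarrow> F \<epsilon> z = G \<epsilon> z"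
  shows "jet_regular \<Omega> r G"
proof (rule jet_regularI)
  fix \<epsilon> :: real assume \<epsilon>: "\<epsilon> \<in> {0<..1}"
  show "continuous_on (\<Omega> \<times> UNIV) (G \<epsilon>)"
    using jet_regularD(1)[OF F \<epsilon>] eq[OF \<epsilon>] by (simp cong: continuous_on_cong)
  fix x and U V :: "'q \<times> 'p multiset \<Rightarrow> real" assume x: "x \<in> \<Omega>" and UV: "\<And>a. size (snd a) \<le> r \<Longrightarrow> U a = V a"
  show "G \<epsilon> (x, U) = G \<epsilon> (x, V)" using jet_regularD(3)[OF F \<epsilon> x UV] eq[OF \<epsilon>] x by simp
next
  fix \<epsilon> :: real and z :: "('p, 'q) inf_jet" and d assume \<epsilon>: "\<epsilon> \<in> {0<..1}" and z: "z \<in> \<Omega> \<times> UNIV"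
  have "\<forall>\<^sub>F t in nhds 0. F \<epsilon> (shift d t z) = G \<epsilon> (shift d t z)"
    by (rule eventually_mono[OF eventually_shift_in[OF \<Omega> z, of d]]) (rule eq[OF \<epsilon>])
  then show "\<exists>D. ((\<lambda>t. G \<epsilon> (shift d t z)) has_real_derivative D) (at 0)"
    using jet_regularD(2)[OF F \<epsilon> z, of d] DERIV_cong_ev[OF refl, of "\<lambda>t. F \<epsilon> (shift d t z)" "\<lambda>t. G \<epsilon> (shift d t z)" 0] by auto
next
  fix N
  obtain N' where "jet_growth \<Omega> r N F N'"
    using jet_regular_growth[OF F] .
  then have "jet_growth \<Omega> r N G N'"
    using eventually_at_right_0_less[of 1, simplified]
    by eventually_elim (use eq in auto)
  then show "\<exists>N'::nat. jet_growth \<Omega> r N G N'" by blast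
qed

lemma jet_tame_cong:
  fixes F G :: "real \<Rightarrow> ('p::finite, 'q) inf_jet \<Rightarrow> real"
  assumes \<Omega>: "open \<Omega>" and "jet_tame \<Omega> r k F"
    and "\<And>\<epsilon> z. \<lbrakk>\<epsilon> \<in> {0<..1}; z \<in> \<Omega> \<times> UNIV\<rbrakk> \<Longrightarrow> F \<epsilon> z = G \<epsilon> z"
  shows "jet_tame \<Omega> r k G"
  using assms(2,3)
proof (induction k arbitrary: F G)
  case 0
  then show ?case using jet_regular_cong[OF \<Omega>, of r F G] by simp
next
  case (Suc k)
  have "jet_tame \<Omega> r k (\<lambda>\<epsilon>. jet_pd d (G \<epsilon>))" for d
  proof (rule Suc.IH)
    show "jet_tame \<Omega> r k (\<lambda>\<epsilon>. jet_pd d (F \<epsilon>))" using Suc.prems by simp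
    show "jet_pd d (F \<epsilon>) z = jet_pd d (G \<epsilon>) z" if "\<epsilon> \<in> {0<..1}" "z \<in> \<Omega> \<times> UNIV" for \<epsilon> z
      by (rule jet_pd_cong[OF \<Omega> that(2)]) (rule Suc.prems(2)[OF that(1)])
  qed
  then show ?case using Suc.prems jet_regular_cong[OF \<Omega>, of r F G] by simp
qed

text \<open>
  Needed because a total derivative raises the order of the jets by one.
\<close>

lemma jet_tame_mono:
  fixes F :: "real \<Rightarrow> ('p::finite, 'q) inf_jet \<Rightarrow> real"
  assumes "jet_tame \<Omega> r k F" "r \<le> s"
  shows "jet_tame \<Omega> s k F"
proof -
  have reg: "jet_regular \<Omega> s F" if F: "jet_regular \<Omega> r F" for F :: "real \<Rightarrow> ('p, 'q) inf_jet \<Rightarrow> real"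
  proof (rule jet_regularI)
    fix \<epsilon> :: real assume \<epsilon>: "\<epsilon> \<in> {0<..1}"
    show "continuous_on (\<Omega> \<times> UNIV) (F \<epsilon>)" using jet_regularD(1)[OF F \<epsilon>] .
    fix x and U V :: "'q \<times> 'p multiset \<Rightarrow> real" assume x: "x \<in> \<Omega>" and UV: "\<And>a. size (snd a) \<le> s \<Longrightarrow> U a = V a"
    show "F \<epsilon> (x, U) = F \<epsilon> (x, V)"
      by (rule jet_regularD(3)[OF F \<epsilon> x]) (use UV assms(2) in auto)
  next
    fix \<epsilon> :: real and z :: "('p, 'q) inf_jet" and d assume \<epsilon>: "\<epsilon> \<in> {0<..1}" and z: "z \<in> \<Omega> \<times> UNIV"
    show "\<exists>D. ((\<lambda>t. F \<epsilon> (shift d t z)) has_real_derivative D) (at 0)"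
      using jet_regularD(2)[OF F \<epsilon> z, of d] by blast
  next
    fix N
    obtain N' where "jet_growth \<Omega> r N F N'"
      using jet_regular_growth[OF F] .
    then have "jet_growth \<Omega> s N F N'"
      by eventually_elim (use assms(2) in \<open>meson order_trans\<close>)
    then show "\<exists>N'::nat. jet_growth \<Omega> s N F N'" by blast
  qed
  show ?thesis using assms(1) by (induction k arbitrary: F) (auto simp: reg)
qed

lemma jet_regular_combine:
  fixes F G :: "real \<Rightarrow> ('p::finite, 'q) inf_jet \<Rightarrow> real" and h :: "real \<Rightarrow> real \<Rightarrow> real"
  assumes F: "jet_regular \<Omega> r F" and G: "jet_regular \<Omega> r G"
    and cont: "\<And>f g :: ('p, 'q) inf_jet \<Rightarrow> real. \<lbrakk>continuous_on (\<Omega> \<times> UNIV) f; continuous_on (\<Omega> \<times> UNIV) g\<rbrakk> \<Longrightarrow>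
      continuous_on (\<Omega> \<times> UNIV) (\<lambda>z. h (f z) (g z))"
    and deriv: "\<And>f g a b. \<lbrakk>(f has_real_derivative a) (at 0); (g has_real_derivative b) (at 0)\<rbrakk> \<Longrightarrow>
      \<exists>D. ((\<lambda>t. h (f t) (g t)) has_real_derivative D) (at 0)"
    and growth: "\<And>m n. \<exists>k::nat. \<forall>(\<epsilon>::real) a b. 0 < \<epsilon> \<and> \<epsilon> < 1/2 \<and> \<bar>a\<bar> \<le> 1 / \<epsilon> ^ m \<and> \<bar>b\<bar> \<le> 1 / \<epsilon> ^ n \<longrightarrow>
      \<bar>h a b\<bar> \<le> 1 / \<epsilon> ^ k"
  shows "jet_regular \<Omega> r (\<lambda>\<epsilon> z. h (F \<epsilon> z) (G \<epsilon> z))"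
proof (rule jet_regularI)
  fix \<epsilon> :: real assume \<epsilon>: "\<epsilon> \<in> {0<..1}"
  show "continuous_on (\<Omega> \<times> UNIV) (\<lambda>z. h (F \<epsilon> z) (G \<epsilon> z))"
    by (rule cont[OF jet_regularD(1)[OF F \<epsilon>] jet_regularD(1)[OF G \<epsilon>]])
  fix x and U V :: "'q \<times> 'p multiset \<Rightarrow> real" assume x: "x \<in> \<Omega>" and UV: "\<And>a. size (snd a) \<le> r \<Longrightarrow> U a = V a"
  show "h (F \<epsilon> (x, U)) (G \<epsilon> (x, U)) = h (F \<epsilon> (x, V)) (G \<epsilon> (x, V))"
    using jet_regularD(3)[OF F \<epsilon> x UV] jet_regularD(3)[OF G \<epsilon> x UV] by simp
next
  fix \<epsilon> :: real and z :: "('p, 'q) inf_jet" and d assume \<epsilon>: "\<epsilon> \<in> {0<..1}" and z: "z \<in> \<Omega> \<times> UNIV"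
  show "\<exists>D. ((\<lambda>t. h (F \<epsilon> (shift d t z)) (G \<epsilon> (shift d t z))) has_real_derivative D) (at 0)"
    by (rule deriv[OF jet_regularD(2)[OF F \<epsilon> z] jet_regularD(2)[OF G \<epsilon> z]])
next
  fix N
  obtain m where m: "jet_growth \<Omega> r N F m" using jet_regular_growth[OF F] .
  obtain n where n: "jet_growth \<Omega> r N G n" using jet_regular_growth[OF G] .
  obtain k :: nat where k: "\<forall>(\<epsilon>::real) a b. 0 < \<epsilon> \<and> \<epsilon> < 1/2 \<and> \<bar>a\<bar> \<le> 1 / \<epsilon> ^ m \<and> \<bar>b\<bar> \<le> 1 / \<epsilon> ^ n \<longrightarrow> \<bar>h a b\<bar> \<le> 1 / \<epsilon> ^ k"
    using growth by blast
  have "jet_growth \<Omega> r N (\<lambda>\<epsilon> z. h (F \<epsilon> z) (G \<epsilon> z)) k"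
    using m n eventually_at_right_0_less[of "1/2", simplified]
  proof eventually_elim
    case (elim \<epsilon>)
    show ?case by (intro ballI allI impI k[rule_format]) (use elim in auto)
  qed
  then show "\<exists>N'. jet_growth \<Omega> r N (\<lambda>\<epsilon> z. h (F \<epsilon> z) (G \<epsilon> z)) N'" by blast
qed

lemma jet_regular_add:
  assumes "jet_regular \<Omega> r F" "jet_regular \<Omega> r G"
  shows "jet_regular \<Omega> r (\<lambda>\<epsilon> z. F \<epsilon> z + G \<epsilon> z)"
proof (rule jet_regular_combine[OF assms])
  fix m n :: nat
  show "\<exists>k::nat. \<forall>(\<epsilon>::real) a b. 0 < \<epsilon> \<and> \<epsilon> < 1/2 \<and> \<bar>a\<bar> \<le> 1 / \<epsilon> ^ m \<and> \<bar>b\<bar> \<le> 1 / \<epsilon> ^ n \<longrightarrow> \<bar>a + b\<bar> \<le> 1 / \<epsilon> ^ k"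
    by (intro exI[of _ "Suc (m + n)"] allI impI order_trans[OF abs_triangle_ineq] add_le_inverse_powers) auto
qed (auto intro: continuous_on_add DERIV_add)

lemma jet_regular_mult:
  assumes "jet_regular \<Omega> r F" "jet_regular \<Omega> r G"
  shows "jet_regular \<Omega> r (\<lambda>\<epsilon> z. F \<epsilon> z * G \<epsilon> z)"
proof (rule jet_regular_combine[OF assms])
  fix m n :: nat
  have "\<bar>a * b\<bar> \<le> 1 / \<epsilon> ^ (m + n)" if "0 < \<epsilon>" "\<bar>a\<bar> \<le> 1 / \<epsilon> ^ m" "\<bar>b\<bar> \<le> 1 / \<epsilon> ^ n" for \<epsilon> a b :: real
  proof -
    have "\<bar>a\<bar> * \<bar>b\<bar> \<le> (1 / \<epsilon> ^ m) * (1 / \<epsilon> ^ n)" by (intro mult_mono) (use that in auto)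
    then show ?thesis by (simp add: abs_mult power_add)
  qed
  then show "\<exists>k::nat. \<forall>(\<epsilon>::real) a b. 0 < \<epsilon> \<and> \<epsilon> < 1/2 \<and> \<bar>a\<bar> \<le> 1 / \<epsilon> ^ m \<and> \<bar>b\<bar> \<le> 1 / \<epsilon> ^ n \<longrightarrow> \<bar>a * b\<bar> \<le> 1 / \<epsilon> ^ k"
    by (intro exI[of _ "m + n"]) blast
qed (auto intro: continuous_on_mult DERIV_mult)

lemma jet_tame_add:
  fixes F G :: "real \<Rightarrow> ('p::finite, 'q) inf_jet \<Rightarrow> real"
  assumes \<Omega>: "open \<Omega>" and "jet_tame \<Omega> r k F" "jet_tame \<Omega> r k G"
  shows "jet_tame \<Omega> r k (\<lambda>\<epsilon> z. F \<epsilon> z + G \<epsilon> z)"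
  using assms(2,3)
proof (induction k arbitrary: F G)
  case (Suc k)
  then have F: "jet_regular \<Omega> r F" and G: "jet_regular \<Omega> r G" by auto
  have "jet_tame \<Omega> r k (\<lambda>\<epsilon>. jet_pd d (\<lambda>z. F \<epsilon> z + G \<epsilon> z))" for d
  proof (rule jet_tame_cong[OF \<Omega>])
    show "jet_tame \<Omega> r k (\<lambda>\<epsilon> z. jet_pd d (F \<epsilon>) z + jet_pd d (G \<epsilon>) z)"
      using Suc by auto
    fix \<epsilon> :: real and z :: "('p, 'q) inf_jet" assume \<epsilon>: "\<epsilon> \<in> {0<..1}" and z: "z \<in> \<Omega> \<times> UNIV"
    show "jet_pd d (F \<epsilon>) z + jet_pd d (G \<epsilon>) z = jet_pd d (\<lambda>z. F \<epsilon> z + G \<epsilon> z) z"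
      by (rule jet_pd_eqI[symmetric])
         (intro DERIV_add jet_regularD(2)[OF F \<epsilon> z] jet_regularD(2)[OF G \<epsilon> z])
  qed
  then show ?case using jet_regular_add[OF F G] by simp
qed (simp add: jet_regular_add)

lemma jet_tame_mult:
  fixes F G :: "real \<Rightarrow> ('p::finite, 'q) inf_jet \<Rightarrow> real"
  assumes \<Omega>: "open \<Omega>" and "jet_tame \<Omega> r k F" "jet_tame \<Omega> r k G"
  shows "jet_tame \<Omega> r k (\<lambda>\<epsilon> z. F \<epsilon> z * G \<epsilon> z)"
  using assms(2,3)
proof (induction k arbitrary: F G)
  case (Suc k)
  then have F: "jet_regular \<Omega> r F" and G: "jet_regular \<Omega> r G" by auto
  have "jet_tame \<Omega> r k (\<lambda>\<epsilon>. jet_pd d (\<lambda>z. F \<epsilon> z * G \<epsilon> z))" for d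
  proof (rule jet_tame_cong[OF \<Omega>])
    show "jet_tame \<Omega> r k (\<lambda>\<epsilon> z. jet_pd d (F \<epsilon>) z * G \<epsilon> z + jet_pd d (G \<epsilon>) z * F \<epsilon> z)"
      by (intro jet_tame_add[OF \<Omega>] Suc.IH) (use Suc.prems jet_tame_SucD in auto)
    fix \<epsilon> :: real and z :: "('p, 'q) inf_jet" assume \<epsilon>: "\<epsilon> \<in> {0<..1}" and z: "z \<in> \<Omega> \<times> UNIV"
    show "jet_pd d (F \<epsilon>) z * G \<epsilon> z + jet_pd d (G \<epsilon>) z * F \<epsilon> z = jet_pd d (\<lambda>z. F \<epsilon> z * G \<epsilon> z) z"
      using DERIV_mult[OF jet_regularD(2)[OF F \<epsilon> z] jet_regularD(2)[OF G \<epsilon> z], of d d]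
      by (intro jet_pd_eqI[symmetric]) simp
  qed
  then show ?case using jet_regular_mult[OF F G] by simp
qed (simp add: jet_regular_mult)

lemma jet_pd_const: "jet_pd d (\<lambda>z. c) = (\<lambda>z. 0)"
  by (auto simp: jet_pd_def fun_eq_iff)

lemma jet_tame_const: "jet_tame \<Omega> r k (\<lambda>\<epsilon> z. c)"
proof -
  have reg: "jet_regular \<Omega> r (\<lambda>\<epsilon> z. c)" for c
  proof (rule jet_regularI)
    have "\<forall>\<^sub>F \<epsilon> in at_right 0. \<bar>c\<bar> \<le> 1 / \<epsilon> ^ 1"
      by (rule eventually_mono[OF eventually_const_times_le_1[of "\<bar>c\<bar>"]]) (simp add: pos_le_divide_eq)
    then show "\<exists>N'::nat. \<forall>\<^sub>F \<epsilon> in at_right 0. \<forall>x\<in>\<Omega>. \<forall>U.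
        jet_le r U (1 / \<epsilon> ^ N) \<longrightarrow> \<bar>c\<bar> \<le> 1 / \<epsilon> ^ N'" for N
      by (intro exI[of _ 1]) (auto elim!: eventually_mono)
  qed (auto intro!: continuous_intros DERIV_const)
  show ?thesis by (induction k arbitrary: c) (auto simp: jet_pd_const reg)
qed

lemma jet_tame_coord:
  assumes "size (snd a) \<le> r"
  shows "jet_tame \<Omega> r k (\<lambda>\<epsilon> z. snd z a)"
proof -
  have D: "((\<lambda>t. snd (shift d t z) a) has_real_derivative (if d = Inr a then 1 else 0)) (at 0)"
    for z :: "('a, 'b) inf_jet" and d
  proof -
    obtain x U where z: "z = (x, U)" by (cases z)
    show ?thesis by (cases d) (auto simp: z intro!: derivative_eq_intros)
  qed
  have reg: "jet_regular \<Omega> r (\<lambda>\<epsilon> z. snd z a)"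
  proof (rule jet_regularI)
    show "continuous_on (\<Omega> \<times> UNIV) (\<lambda>z. snd z a)"
      by (rule continuous_on_product_then_coordinatewise[OF continuous_on_snd]) (rule continuous_on_id)
    show "\<exists>N'::nat. \<forall>\<^sub>F \<epsilon> in at_right 0. \<forall>x\<in>\<Omega>. \<forall>U.
        jet_le r U (1 / \<epsilon> ^ N) \<longrightarrow> \<bar>snd (x, U) a\<bar> \<le> 1 / \<epsilon> ^ N'" for N
      using assms by (cases a) (intro exI[of _ N] always_eventually, auto)
  qed (use assms D in auto)
  have "jet_pd d (\<lambda>z. snd z a) = (\<lambda>z. if d = Inr a then 1 else 0)" for d :: "'a + 'b \<times> 'a multiset"
    using jet_pd_eqI[OF D] by (auto simp: fun_eq_iff)
  then show ?thesis using reg by (cases k) (auto intro: jet_tame_const)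
qed

lemma jet_tame_sum:
  assumes \<Omega>: "open \<Omega>" and "finite A" "\<And>a. a \<in> A \<Longrightarrow> jet_tame \<Omega> r k (F a)"
  shows "jet_tame \<Omega> r k (\<lambda>\<epsilon> z. \<Sum>a\<in>A. F a \<epsilon> z)"
  using assms(2,3)
  by (induction A rule: finite_induct) (auto intro: jet_tame_const jet_tame_add[OF \<Omega>])

lemma finite_multisets_size_le: "finite {J :: 'p::finite multiset. size J \<le> n}"
proof (rule finite_subset)
  show "{J :: 'p multiset. size J \<le> n} \<subseteq> mset ` {js. set js \<subseteq> UNIV \<and> length js \<le> n}"
  proof
    fix J :: "'p multiset" assume J: "J \<in> {J. size J \<le> n}"
    obtain js where "J = mset js" using ex_mset by metis
    with J show "J \<in> mset ` {js. set js \<subseteq> UNIV \<and> length js \<le> n}" by auto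
  qed
  show "finite (mset ` {js. set js \<subseteq> (UNIV :: 'p set) \<and> length js \<le> n})"
    by (intro finite_imageI finite_lists_length_le) simp
qed

text \<open>
  The finiteness of the types of indices enters here: a function of jets of finite order depends on
  finitely many coordinates.
\<close>

lemma finite_jet_coords: "finite {a :: 'q::finite \<times> 'p::finite multiset. size (snd a) \<le> r}"
proof -
  have "{a :: 'q \<times> 'p multiset. size (snd a) \<le> r} = UNIV \<times> {J. size J \<le> r}" by auto
  then show ?thesis by (simp add: finite_cartesian_product finite_multisets_size_le)
qed

text \<open>
  The sum in the total derivative runs over the coordinates with nonzero derivative, a set that
  depends on the point.  As functions of \<open>r\<close>-jets have zero derivative in the coordinates of higher
  order, the sum can be taken over the fixed finite set of coordinates of order at most \<open>r\<close>.
\<close>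

lemma total_deriv_eq:
  fixes F :: "real \<Rightarrow> ('p::finite, 'q::finite) inf_jet \<Rightarrow> real"
  assumes F: "jet_regular \<Omega> r F" and \<epsilon>: "\<epsilon> \<in> {0<..1}" and z: "z \<in> \<Omega> \<times> UNIV"
  shows "total_deriv i (F \<epsilon>) z = jet_pd (Inl i) (F \<epsilon>) z +
     (\<Sum>a | size (snd a) \<le> r. snd z (fst a, add_mset i (snd a)) * jet_pd (Inr a) (F \<epsilon>) z)"
proof -
  have 0: "jet_pd (Inr a) (F \<epsilon>) z = 0" if "\<not> size (snd a) \<le> r" for a
  proof (rule jet_pd_eqI)
    obtain x U where xU: "z = (x, U)" by (cases z)
    have "F \<epsilon> (shift (Inr a) t z) = F \<epsilon> z" for t
      unfolding xU shift.simps by (rule jet_regularD(3)[OF F \<epsilon>]) (use z xU that in auto)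
    then show "((\<lambda>t. F \<epsilon> (shift (Inr a) t z)) has_real_derivative 0) (at 0)" by simp
  qed
  have "(\<Sum>(\<alpha>, J) | jet_pd (Inr (\<alpha>, J)) (F \<epsilon>) z \<noteq> 0. snd z (\<alpha>, add_mset i J) * jet_pd (Inr (\<alpha>, J)) (F \<epsilon>) z)
      = (\<Sum>(\<alpha>, J) | size J \<le> r. snd z (\<alpha>, add_mset i J) * jet_pd (Inr (\<alpha>, J)) (F \<epsilon>) z)"
    by (rule sum.mono_neutral_left)
       (use finite_jet_coords[where 'p='p and 'q='q, of r] 0 in \<open>auto simp: case_prod_unfold\<close>)
  then show ?thesis by (simp add: total_deriv_def d_x_eq d_u_eq case_prod_unfold)
qed

lemma jet_tame_total_deriv:
  fixes F :: "real \<Rightarrow> ('p::finite, 'q::finite) inf_jet \<Rightarrow> real"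
  assumes \<Omega>: "open \<Omega>" and F: "jet_tame \<Omega> r (Suc k) F"
  shows "jet_tame \<Omega> (Suc r) k (\<lambda>\<epsilon>. total_deriv i (F \<epsilon>))"
proof (rule jet_tame_cong[OF \<Omega>])
  have D: "jet_tame \<Omega> (Suc r) k (\<lambda>\<epsilon>. jet_pd d (F \<epsilon>))" for d
    by (rule jet_tame_mono[of _ r]) (use F in auto)
  show "jet_tame \<Omega> (Suc r) k (\<lambda>\<epsilon> z. jet_pd (Inl i) (F \<epsilon>) z +
     (\<Sum>a | size (snd a) \<le> r. snd z (fst a, add_mset i (snd a)) * jet_pd (Inr a) (F \<epsilon>) z))"
    by (intro jet_tame_add[OF \<Omega>] jet_tame_sum[OF \<Omega>] jet_tame_mult[OF \<Omega>] D jet_tame_coord finite_jet_coords) auto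
next
  fix \<epsilon> :: real and z :: "('p, 'q) inf_jet" assume "\<epsilon> \<in> {0<..1}" "z \<in> \<Omega> \<times> UNIV"
  then show "jet_pd (Inl i) (F \<epsilon>) z +
     (\<Sum>a | size (snd a) \<le> r. snd z (fst a, add_mset i (snd a)) * jet_pd (Inr a) (F \<epsilon>) z) = total_deriv i (F \<epsilon>) z"
    by (rule total_deriv_eq[OF jet_tame_regular[OF F], symmetric])
qed

definition jet_smooth :: "(real ^ 'p::finite) set \<Rightarrow> nat \<Rightarrow> (real \<Rightarrow> ('p, 'q) inf_jet \<Rightarrow> real) \<Rightarrow> bool" where
  "jet_smooth \<Omega> r F \<longleftrightarrow> (\<forall>k. jet_tame \<Omega> r k F)"

lemma jet_smooth_total_derivs:
  fixes F :: "real \<Rightarrow> ('p::finite, 'q::finite) inf_jet \<Rightarrow> real"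
  assumes \<Omega>: "open \<Omega>" and F: "jet_smooth \<Omega> r F"
  shows "jet_smooth \<Omega> (r + length is) (\<lambda>\<epsilon>. foldr total_deriv is (F \<epsilon>))"
proof (induction "is")
  case (Cons i "is")
  have "jet_tame \<Omega> (Suc (r + length is)) k (\<lambda>\<epsilon>. total_deriv i (foldr total_deriv is (F \<epsilon>)))" for k
    using Cons jet_tame_total_deriv[OF \<Omega>, of "r + length is" k] unfolding jet_smooth_def by blast
  then show ?case by (simp add: jet_smooth_def)
qed (use F in simp)

section \<open>The chain rule along a function\<close>

text \<open>
  The fibres of the infinite jet space carry the product topology, so convergence is coordinatewise.
\<close>

lemma tendsto_fun_coordinates:
  fixes f :: "'c \<Rightarrow> 'a \<Rightarrow> real"
  assumes "\<And>a. ((\<lambda>t. f t a) \<longlongrightarrow> l a) F"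
  shows "(f \<longlongrightarrow> l) F"
proof -
  have "limitin (product_topology (\<lambda>a. euclidean) UNIV) f l F"
    unfolding limitin_componentwise using assms by auto
  then show ?thesis by (simp add: euclidean_product_topology)
qed

text \<open>
  The form of the mean value theorem used throughout: the end points may come in either order or
  coincide.
\<close>

lemma mean_value_between:
  fixes f f' :: "real \<Rightarrow> real"
  assumes D: "\<And>s. \<bar>s - a\<bar> \<le> \<bar>b - a\<bar> \<Longrightarrow> (f has_real_derivative f' s) (at s)"
  obtains \<xi> where "\<bar>\<xi> - a\<bar> \<le> \<bar>b - a\<bar>" "f b - f a = (b - a) * f' \<xi>"
proof (cases a b rule: linorder_cases)
  case less
  from MVT2[OF less, of f f'] D that show thesis by force
next
  case greater
  from MVT2[OF greater, of f f'] D obtain z where z: "b < z" "z < a" "f a - f b = (a - b) * f' z" by force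
  then have "f b - f a = (b - a) * f' z" by (simp add: algebra_simps)
  with z that[of z] show thesis by auto
qed (use that[of a] in auto)

text \<open>
  Continuity of the partial derivatives gives the chain rule as in finite dimensions: the jet
  coordinates in \<open>B\<close> are switched on one at a time, and the increment due to each is evaluated with
  the mean value theorem.  The factor \<open>c\<close> allows both for moving the base point (\<open>c = 1\<close>) and for
  curves inside a fibre (\<open>c = 0\<close>).
\<close>

lemma jet_chain_rule_partial:
  fixes F :: "('p::finite, 'q) inf_jet \<Rightarrow> real"
  assumes \<Omega>: "open \<Omega>" and x: "x \<in> \<Omega>"
    and D: "\<And>z d. z \<in> \<Omega> \<times> UNIV \<Longrightarrow> ((\<lambda>t. F (shift d t z)) has_real_derivative jet_pd d F z) (at 0)"
    and C: "\<And>a. continuous_on (\<Omega> \<times> UNIV) (jet_pd (Inr a) F)"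
    and "finite B" and "\<And>a. a \<in> B \<Longrightarrow> ((\<lambda>t. U t a) has_real_derivative U' a) (at 0)"
  shows "((\<lambda>t. F (x + (c * t) *\<^sub>R axis i 1, \<lambda>a. if a \<in> B then U t a else U 0 a)) has_real_derivative
     c * jet_pd (Inl i) F (x, U 0) + (\<Sum>a\<in>B. U' a * jet_pd (Inr a) F (x, U 0))) (at 0)"
  using assms(5,6)
proof (induction B rule: finite_induct)
  case empty
  have "((\<lambda>s. F (x + s *\<^sub>R axis i 1, U 0)) has_real_derivative jet_pd (Inl i) F (x, U 0)) (at (c * 0))"
    using D[of "(x, U 0)" "Inl i"] x by simp
  moreover have "((\<lambda>t. c * t) has_real_derivative c) (at 0)"
    by (auto intro!: derivative_eq_intros)
  ultimately have "((\<lambda>t. F (x + (c * t) *\<^sub>R axis i 1, U 0)) has_real_derivative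
      jet_pd (Inl i) F (x, U 0) * c) (at 0)"
    by (rule DERIV_chain2)
  then show ?case by (simp add: mult.commute)
next
  case (insert a B)
  define y where "y t = x + (c * t) *\<^sub>R axis i 1" for t
  define V where "V t = (\<lambda>b. if b \<in> B then U t b else U 0 b)" for t
  have W: "(\<lambda>b. if b \<in> insert a B then U t b else U 0 b) = (V t)(a := U t a)" for t
    using insert.hyps by (auto simp: V_def)
  have V_a: "V t = (V t)(a := U 0 a)" for t
    using insert.hyps by (auto simp: V_def)
  let ?D = "jet_pd (Inr a) F"
  have D': "((\<lambda>s. F (w, X(a := s))) has_real_derivative ?D (w, X(a := s))) (at s)" if "w \<in> \<Omega>" for w X s
  proof -
    have "((\<lambda>t. F (w, X(a := s + t))) has_real_derivative ?D (w, X(a := s))) (at 0)"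
      using D[of "(w, X(a := s))" "Inr a"] that by simp
    then show ?thesis
      using DERIV_shift[of "\<lambda>t. F (w, X(a := t))" _ 0 s] by (simp add: add.commute)
  qed
  have "\<exists>\<xi>. \<bar>\<xi> - U 0 a\<bar> \<le> \<bar>U t a - U 0 a\<bar> \<and>
      (y t \<in> \<Omega> \<longrightarrow> F (y t, (V t)(a := U t a)) - F (y t, V t) = (U t a - U 0 a) * ?D (y t, (V t)(a := \<xi>)))" for t
  proof (cases "y t \<in> \<Omega>")
    case True
    obtain \<xi> where "\<bar>\<xi> - U 0 a\<bar> \<le> \<bar>U t a - U 0 a\<bar>"
      "F (y t, (V t)(a := U t a)) - F (y t, (V t)(a := U 0 a)) = (U t a - U 0 a) * ?D (y t, (V t)(a := \<xi>))"
      using mean_value_between[OF D'[OF True, of "V t"]] by blast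
    then show ?thesis using V_a[of t] by auto
  qed auto
  then obtain \<xi> where \<xi>: "\<And>t. \<bar>\<xi> t - U 0 a\<bar> \<le> \<bar>U t a - U 0 a\<bar>"
    "\<And>t. y t \<in> \<Omega> \<Longrightarrow> F (y t, (V t)(a := U t a)) - F (y t, V t) = (U t a - U 0 a) * ?D (y t, (V t)(a := \<xi> t))"
    by metis
  have Ulim: "((\<lambda>t. U t b) \<longlongrightarrow> U 0 b) (at 0)" if "b \<in> insert a B" for b
    using DERIV_isCont[OF insert.prems[OF that]] by (simp add: isCont_def)
  have xilim: "(\<xi> \<longlongrightarrow> U 0 a) (at 0)"
  proof (rule LIM_zero_cancel)
    have "((\<lambda>t. U t a - U 0 a) \<longlongrightarrow> U 0 a - U 0 a) (at 0)" by (intro tendsto_intros Ulim) simp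
    then show "((\<lambda>t. \<xi> t - U 0 a) \<longlongrightarrow> 0) (at 0)"
      by (intro Lim_null_comparison[where g = "\<lambda>t. \<bar>U t a - U 0 a\<bar>" and f = "\<lambda>t. \<xi> t - U 0 a"])
         (use \<xi>(1) in \<open>auto intro!: always_eventually tendsto_rabs_zero\<close>)
  qed
  have ylim: "(y \<longlongrightarrow> x) (at 0)"
  proof -
    have "((\<lambda>t. x + (c * t) *\<^sub>R axis i 1) \<longlongrightarrow> x + (c * 0) *\<^sub>R axis i 1) (at 0)"
      by (intro tendsto_intros)
    then show ?thesis by (simp add: y_def[abs_def])
  qed
  have "((\<lambda>t. (V t)(a := \<xi> t)) \<longlongrightarrow> U 0) (at 0)"
  proof (rule tendsto_fun_coordinates)
    fix b show "((\<lambda>t. ((V t)(a := \<xi> t)) b) \<longlongrightarrow> U 0 b) (at 0)"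
      using xilim Ulim[of b] by (cases "b = a"; cases "b \<in> B") (auto simp: V_def)
  qed
  then have zlim: "((\<lambda>t. (y t, (V t)(a := \<xi> t))) \<longlongrightarrow> (x, U 0)) (at 0)"
    using ylim by (intro tendsto_Pair)
  have ev: "\<forall>\<^sub>F t in at 0. y t \<in> \<Omega>"
    using ylim \<Omega> x topological_tendstoD by blast
  have Dlim: "((\<lambda>t. ?D (y t, (V t)(a := \<xi> t))) \<longlongrightarrow> ?D (x, U 0)) (at 0)"
    by (rule continuous_on_tendsto_compose[OF C zlim]) (use x ev in auto)
  have "((\<lambda>t. (U t a - U 0 a) / t) \<longlongrightarrow> U' a) (at 0)"
    using insert.prems[of a] by (simp add: DERIV_def)
  then have lim: "((\<lambda>t. (U t a - U 0 a) / t * ?D (y t, (V t)(a := \<xi> t))) \<longlongrightarrow> U' a * ?D (x, U 0)) (at 0)"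
    using Dlim by (rule tendsto_mult)
  have q0: "V 0 = U 0" "(V 0)(a := U 0 a) = U 0" by (auto simp: V_def)
  have "((\<lambda>t. F (y t, (V t)(a := U t a)) - F (y t, V t)) has_real_derivative U' a * ?D (x, U 0)) (at 0)"
    unfolding DERIV_def
  proof (rule Lim_transform_eventually[OF lim])
    show "\<forall>\<^sub>F t in at 0. (U t a - U 0 a) / t * ?D (y t, (V t)(a := \<xi> t)) =
      (F (y (0 + t), (V (0 + t))(a := U (0 + t) a)) - F (y (0 + t), V (0 + t)) -
        (F (y 0, (V 0)(a := U 0 a)) - F (y 0, V 0))) / t"
      using ev by eventually_elim (simp add: \<xi>(2) q0)
  qed
  moreover have "((\<lambda>t. F (y t, V t)) has_real_derivative
      c * jet_pd (Inl i) F (x, U 0) + (\<Sum>a\<in>B. U' a * jet_pd (Inr a) F (x, U 0))) (at 0)"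
    using insert.IH insert.prems by (simp add: y_def[abs_def] V_def[abs_def])
  ultimately have "((\<lambda>t. (F (y t, (V t)(a := U t a)) - F (y t, V t)) + F (y t, V t)) has_real_derivative
     U' a * ?D (x, U 0) + (c * jet_pd (Inl i) F (x, U 0) + (\<Sum>a\<in>B. U' a * jet_pd (Inr a) F (x, U 0)))) (at 0)"
    by (rule DERIV_add)
  then show ?case unfolding W using insert.hyps by (simp add: y_def algebra_simps)
qed

lemma jet_chain_rule:
  fixes F :: "real \<Rightarrow> ('p::finite, 'q::finite) inf_jet \<Rightarrow> real"
  assumes \<Omega>: "open \<Omega>" and F: "jet_tame \<Omega> r (Suc 0) F" and \<epsilon>: "\<epsilon> \<in> {0<..1}" and x: "x \<in> \<Omega>"
    and U: "\<And>a. size (snd a) \<le> r \<Longrightarrow> ((\<lambda>t. U t a) has_real_derivative U' a) (at 0)"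
  shows "((\<lambda>t. F \<epsilon> (x + (c * t) *\<^sub>R axis i 1, U t)) has_real_derivative
     c * jet_pd (Inl i) (F \<epsilon>) (x, U 0) + (\<Sum>a | size (snd a) \<le> r. U' a * jet_pd (Inr a) (F \<epsilon>) (x, U 0))) (at 0)"
proof -
  let ?B = "{a :: 'q \<times> 'p multiset. size (snd a) \<le> r}"
  have R: "jet_regular \<Omega> r F" and R': "jet_regular \<Omega> r (\<lambda>\<epsilon>. jet_pd d (F \<epsilon>))" for d using F by auto
  have *: "((\<lambda>t. F \<epsilon> (x + (c * t) *\<^sub>R axis i 1, \<lambda>a. if a \<in> ?B then U t a else U 0 a)) has_real_derivative
     c * jet_pd (Inl i) (F \<epsilon>) (x, U 0) + (\<Sum>a\<in>?B. U' a * jet_pd (Inr a) (F \<epsilon>) (x, U 0))) (at 0)"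
    by (rule jet_chain_rule_partial[OF \<Omega> x jet_regularD(2)[OF R \<epsilon>] jet_regularD(1)[OF R' \<epsilon>] finite_jet_coords])
       (use U in auto)
  have "((\<lambda>t. x + (c * t) *\<^sub>R axis i 1) \<longlongrightarrow> x + (c * 0) *\<^sub>R axis i 1) (nhds 0)"
    by (intro tendsto_intros filterlim_ident)
  then have "\<forall>\<^sub>F t in nhds 0. x + (c * t) *\<^sub>R axis i 1 \<in> \<Omega>"
    using \<Omega> x by (simp add: topological_tendstoD)
  then have "\<forall>\<^sub>F t in nhds 0. F \<epsilon> (x + (c * t) *\<^sub>R axis i 1, \<lambda>a. if a \<in> ?B then U t a else U 0 a)
      = F \<epsilon> (x + (c * t) *\<^sub>R axis i 1, U t)"
    by (rule eventually_mono) (rule jet_regularD(3)[OF R \<epsilon>], auto)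
  with * show ?thesis by (rule DERIV_eventually_cong)
qed

abbreviation jet_along :: "(real ^ 'p::finite) set \<Rightarrow> ('q \<Rightarrow> real ^ 'p \<Rightarrow> real) \<Rightarrow> real ^ 'p \<Rightarrow> 'q \<times> 'p multiset \<Rightarrow> real" where
  "jet_along \<Omega> v x \<equiv> snd (inf_jet_of \<Omega> v x)"

lemma inf_jet_of_eq: "inf_jet_of \<Omega> v x = (x, jet_along \<Omega> v x)"
  by (simp add: inf_jet_of_def)

lemma fst_inf_jet_of [simp]: "fst (inf_jet_of \<Omega> v x) = x"
  by (simp add: inf_jet_of_def)

lemma mset_idx_list [simp]: "mset (idx_list J) = J"
  unfolding idx_list_def by (rule someI_ex) (rule ex_mset)

abbreviation axes :: "'p list \<Rightarrow> (real ^ 'p::finite) list" where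
  "axes js \<equiv> map (\<lambda>i. axis i 1) js"

lemma axes_in_Basis: "axes js \<in> lists Basis"
  by (auto simp: axis_in_Basis_iff)

lemma Basis_list_eq_axes:
  assumes "bs \<in> lists (Basis :: (real ^ 'p::finite) set)"
  obtains js where "bs = axes js"
proof -
  have "\<exists>js. bs = axes js"
    using assms
  proof (induction bs rule: list.induct)
    case (Cons b bs)
    then obtain js where "bs = axes js" by auto
    moreover obtain i where "b = axis i 1" using Cons.prems by (auto simp: Basis_vec_def)
    ultimately have "b # bs = axes (i # js)" by simp
    then show ?case by (intro exI[of _ "i # js"])
  qed simp
  then show thesis using that by blast
qed

lemma jet_along_in:
  "x \<in> \<Omega> \<Longrightarrow> jet_along \<Omega> v x a = pdiffs (axes (idx_list (snd a))) (v (fst a)) x"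
  by (simp add: inf_jet_of_def pdbar_def case_prod_unfold)

lemma jet_along_pdiffs:
  assumes \<Omega>: "open \<Omega>" and v: "smooth_along Basis \<Omega> (v \<alpha>)" and x: "x \<in> \<Omega>"
  shows "pdiffs (axes js) (v \<alpha>) x = jet_along \<Omega> v x (\<alpha>, mset js)"
  using pdiffs_permute[OF v \<Omega> axes_in_Basis, of js "axes (idx_list (mset js))" x] x
  by (simp add: jet_along_in mset_map)

text \<open>
  Differentiating the coordinate \<open>u\<^sup>\<alpha>\<^sub>J\<close> of the jet of a function gives the coordinate \<open>u\<^sup>\<alpha>\<^bsub>J,i\<^esub>\<close>.  The
  enumeration of the enlarged multi-index need not extend that of \<open>J\<close>, which is why partial
  derivatives have to commute.
\<close>

lemma DERIV_jet_along:
  assumes \<Omega>: "open \<Omega>" and v: "\<And>\<beta>. smooth_along Basis \<Omega> (v \<beta>)" and x: "x \<in> \<Omega>"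
  shows "((\<lambda>t. jet_along \<Omega> v (x + t *\<^sub>R axis i 1) a) has_real_derivative
    jet_along \<Omega> v x (fst a, add_mset i (snd a))) (at 0)"
proof -
  let ?bs = "axes (idx_list (snd a))"
  have s: "smooth_along Basis \<Omega> (pdiffs ?bs (v (fst a)))"
    by (rule smooth_along_pdiffs[OF v axes_in_Basis])
  have "((\<lambda>t. pdiffs ?bs (v (fst a)) (x + t *\<^sub>R axis i 1)) has_real_derivative
      pdiff (axis i 1) (pdiffs ?bs (v (fst a))) x) (at 0)"
    using smooth_along_DERIV[OF s, of "axis i 1" x 0] x by (simp add: axis_in_Basis_iff)
  moreover have "pdiff (axis i 1) (pdiffs ?bs (v (fst a))) x = jet_along \<Omega> v x (fst a, add_mset i (snd a))"
    using jet_along_pdiffs[OF \<Omega> v x, where \<alpha> = "fst a" and js = "i # idx_list (snd a)"] by simp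
  moreover have "\<forall>\<^sub>F t in nhds 0. pdiffs ?bs (v (fst a)) (x + t *\<^sub>R axis i 1) = jet_along \<Omega> v (x + t *\<^sub>R axis i 1) a"
    by (rule eventually_mono[OF eventually_line_in_open[OF \<Omega> x, of "axis i 1"]]) (simp add: jet_along_in)
  ultimately show ?thesis using DERIV_eventually_cong by simp
qed

text \<open>
  Total derivatives are made for this: they compute the partial derivatives of a differential
  function along any smooth function.
\<close>

lemma DERIV_along:
  fixes F :: "real \<Rightarrow> ('p::finite, 'q::finite) inf_jet \<Rightarrow> real"
  assumes \<Omega>: "open \<Omega>" and F: "jet_tame \<Omega> r (Suc 0) F" and \<epsilon>: "\<epsilon> \<in> {0<..1}"
    and v: "\<And>\<beta>. smooth_along Basis \<Omega> (v \<beta>)" and x: "x \<in> \<Omega>"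
  shows "((\<lambda>t. F \<epsilon> (inf_jet_of \<Omega> v (x + t *\<^sub>R axis i 1))) has_real_derivative
    total_deriv i (F \<epsilon>) (inf_jet_of \<Omega> v x)) (at 0)"
proof -
  let ?U = "\<lambda>t. jet_along \<Omega> v (x + t *\<^sub>R axis i 1)"
  have "((\<lambda>t. F \<epsilon> (x + (1 * t) *\<^sub>R axis i 1, ?U t)) has_real_derivative
     1 * jet_pd (Inl i) (F \<epsilon>) (x, ?U 0) +
     (\<Sum>a | size (snd a) \<le> r. jet_along \<Omega> v x (fst a, add_mset i (snd a)) * jet_pd (Inr a) (F \<epsilon>) (x, ?U 0))) (at 0)"
    by (rule jet_chain_rule[OF \<Omega> F \<epsilon> x]) (rule DERIV_jet_along[OF \<Omega> v x])
  moreover have "inf_jet_of \<Omega> v x \<in> \<Omega> \<times> UNIV" using x by (simp add: mem_Times_iff)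
  ultimately show ?thesis
    using total_deriv_eq[OF jet_tame_regular[OF F] \<epsilon>, of "inf_jet_of \<Omega> v x" i]
    by (simp add: inf_jet_of_eq[symmetric])
qed

lemma pdiffs_along:
  fixes F :: "real \<Rightarrow> ('p::finite, 'q::finite) inf_jet \<Rightarrow> real"
  assumes \<Omega>: "open \<Omega>" and F: "jet_smooth \<Omega> r F" and \<epsilon>: "\<epsilon> \<in> {0<..1}"
    and v: "\<And>\<beta>. smooth_along Basis \<Omega> (v \<beta>)" and x: "x \<in> \<Omega>"
  shows "pdiffs (axes js) (\<lambda>x. F \<epsilon> (inf_jet_of \<Omega> v x)) x = foldr total_deriv js (F \<epsilon>) (inf_jet_of \<Omega> v x)"
  using x
proof (induction js arbitrary: x)
  case (Cons i js)
  have "jet_smooth \<Omega> (r + length js) (\<lambda>\<epsilon>. foldr total_deriv js (F \<epsilon>))"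
    by (rule jet_smooth_total_derivs[OF \<Omega> F])
  then have t: "jet_tame \<Omega> (r + length js) (Suc 0) (\<lambda>\<epsilon>. foldr total_deriv js (F \<epsilon>))"
    unfolding jet_smooth_def by blast
  have "pdiff (axis i 1) (pdiffs (axes js) (\<lambda>x. F \<epsilon> (inf_jet_of \<Omega> v x))) x
      = pdiff (axis i 1) (\<lambda>x. foldr total_deriv js (F \<epsilon>) (inf_jet_of \<Omega> v x)) x"
    by (rule pdiff_cong[OF \<Omega> Cons.prems]) (rule Cons.IH)
  also have "\<dots> = total_deriv i (foldr total_deriv js (F \<epsilon>)) (inf_jet_of \<Omega> v x)"
    by (rule pdiff_eqI) (rule DERIV_along[OF \<Omega> t \<epsilon> v Cons.prems])
  finally show ?case by simp
qed simp

lemma continuous_on_inf_jet_of: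
  assumes \<Omega>: "open \<Omega>" and v: "\<And>\<beta>. smooth_along Basis \<Omega> (v \<beta>)"
  shows "continuous_on \<Omega> (inf_jet_of \<Omega> v)"
proof -
  have "continuous_on \<Omega> (\<lambda>x. (x, jet_along \<Omega> v x))"
  proof (intro continuous_on_Pair continuous_on_id continuous_on_coordinatewise_then_product)
    fix a :: "'b \<times> 'a multiset"
    have "continuous_on \<Omega> (pdiffs (axes (idx_list (snd a))) (v (fst a)))"
      by (intro smooth_along_continuous[OF smooth_along_pdiffs[OF v axes_in_Basis]])
    then show "continuous_on \<Omega> (\<lambda>x. jet_along \<Omega> v x a)"
      by (simp add: jet_along_in cong: continuous_on_cong)
  qed
  then show ?thesis by (simp add: inf_jet_of_eq[symmetric])
qed

lemma smooth_along_along: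
  fixes F :: "real \<Rightarrow> ('p::finite, 'q::finite) inf_jet \<Rightarrow> real"
  assumes \<Omega>: "open \<Omega>" and F: "jet_smooth \<Omega> r F" and \<epsilon>: "\<epsilon> \<in> {0<..1}"
    and v: "\<And>\<beta>. smooth_along Basis \<Omega> (v \<beta>)"
  shows "smooth_along Basis \<Omega> (\<lambda>x. F \<epsilon> (inf_jet_of \<Omega> v x))"
  unfolding smooth_along_def
proof (intro ballI conjI)
  fix bs :: "(real ^ 'p) list" assume "bs \<in> lists Basis"
  then obtain js where bs: "bs = axes js" using Basis_list_eq_axes by blast
  let ?G = "\<lambda>\<epsilon>. foldr total_deriv js (F \<epsilon>)"
  have G: "jet_smooth \<Omega> (r + length js) ?G"
    by (rule jet_smooth_total_derivs[OF \<Omega> F])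
  then have t: "jet_tame \<Omega> (r + length js) (Suc 0) ?G"
    unfolding jet_smooth_def by blast
  have eq: "pdiffs bs (\<lambda>x. F \<epsilon> (inf_jet_of \<Omega> v x)) x = ?G \<epsilon> (inf_jet_of \<Omega> v x)" if "x \<in> \<Omega>" for x
    using pdiffs_along[OF \<Omega> F \<epsilon> v that] bs by simp
  have "continuous_on \<Omega> (?G \<epsilon> \<circ> inf_jet_of \<Omega> v)"
  proof (intro continuous_on_compose continuous_on_inf_jet_of[OF \<Omega> v])
    show "continuous_on (inf_jet_of \<Omega> v ` \<Omega>) (?G \<epsilon>)"
      by (rule continuous_on_subset[OF jet_regularD(1)[OF jet_tame_regular[OF t] \<epsilon>]])
         (simp add: image_subset_iff mem_Times_iff)
  qed
  then show "continuous_on \<Omega> (pdiffs bs (\<lambda>x. F \<epsilon> (inf_jet_of \<Omega> v x)))"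
    by (simp add: eq cong: continuous_on_cong)
  fix b :: "real ^ 'p" and x assume "b \<in> Basis" and x: "x \<in> \<Omega>"
  then obtain i where b: "b = axis i 1" by (auto simp: Basis_vec_def)
  have "((\<lambda>t. ?G \<epsilon> (inf_jet_of \<Omega> v (x + t *\<^sub>R b))) has_real_derivative
      total_deriv i (?G \<epsilon>) (inf_jet_of \<Omega> v x)) (at 0)"
    using DERIV_along[OF \<Omega> t \<epsilon> v x] b by simp
  moreover have "\<forall>\<^sub>F t in nhds 0. ?G \<epsilon> (inf_jet_of \<Omega> v (x + t *\<^sub>R b))
      = pdiffs bs (\<lambda>x. F \<epsilon> (inf_jet_of \<Omega> v x)) (x + t *\<^sub>R b)"
    by (rule eventually_mono[OF eventually_line_in_open[OF \<Omega> x, of b]]) (simp add: eq)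
  ultimately have "((\<lambda>t. pdiffs bs (\<lambda>x. F \<epsilon> (inf_jet_of \<Omega> v x)) (x + t *\<^sub>R b)) has_real_derivative
      total_deriv i (?G \<epsilon>) (inf_jet_of \<Omega> v x)) (at 0)"
    by (rule DERIV_eventually_cong)
  then show "(\<lambda>t. pdiffs bs (\<lambda>x. F \<epsilon> (inf_jet_of \<Omega> v x)) (x + t *\<^sub>R b)) differentiable at 0"
    by (auto simp: real_differentiable_def)
qed

section \<open>Lagrangians and functions of the base point\<close>

lemma continuous_on_jet_proj:
  "continuous_on S (jet_proj :: ('p::finite, 'q::finite) inf_jet \<Rightarrow> ('p, 'q, 'n::finite) jet)"
proof -
  have "continuous_on S (\<lambda>z :: ('p, 'q) inf_jet. (fst z, \<chi> a. snd z (fst a, Rep_jet_index (snd a :: ('p, 'n) jet_index))))"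
    by (intro continuous_on_Pair continuous_on_vec_lambda continuous_on_fst continuous_on_id
          continuous_on_product_then_coordinatewise[OF continuous_on_snd])
  then show ?thesis by (simp add: jet_proj_def case_prod_unfold)
qed

text \<open>
  Coordinates of the \<open>n\<close>-jet space are shifted along a basis vector, and coordinates of higher order
  are forgotten.  Partial derivatives of functions of \<open>n\<close>-jets, regarded on the infinite jet space,
  are therefore ordinary partial derivatives on the \<open>n\<close>-jet space, or zero.
\<close>

lemma jet_proj_shift:
  fixes d :: "'p::finite + 'q::finite \<times> 'p multiset"
  obtains (coord) b :: "('p, 'q, 'n::finite) jet" where "b \<in> Basis" "\<And>z t. jet_proj (shift d t z) = jet_proj z + t *\<^sub>R b"
  | (const) "\<And>z t. (jet_proj (shift d t z) :: ('p, 'q, 'n) jet) = jet_proj z"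
proof (cases d)
  case (Inl i)
  have "(axis i 1, 0) \<in> (Basis :: ('p, 'q, 'n) jet set)" by (auto simp: Basis_prod_def axis_in_Basis_iff)
  moreover have "jet_proj (shift d t z) = jet_proj z + t *\<^sub>R ((axis i 1, 0) :: ('p, 'q, 'n) jet)" for t z
    by (cases z) (simp add: Inl jet_proj_def)
  ultimately show thesis using coord by blast
next
  case (Inr a)
  obtain \<alpha> J where a: "a = (\<alpha>, J)" by (cases a)
  show thesis
  proof (cases "size J \<le> CARD('n)")
    case True
    let ?e = "axis (\<alpha>, Abs_jet_index J :: ('p, 'n) jet_index) (1::real)"
    have eq: "(\<beta>, Rep_jet_index K) = (\<alpha>, J) \<longleftrightarrow> (\<beta>, K) = (\<alpha>, Abs_jet_index J)"
      for \<beta> and K :: "('p, 'n) jet_index"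
      using True Abs_jet_index_inverse[of J, where 'n='n] Rep_jet_index_inverse[of K] by auto
    have "(0, ?e) \<in> (Basis :: ('p, 'q, 'n) jet set)" by (auto simp: Basis_prod_def axis_in_Basis_iff)
    moreover have "jet_proj (shift d t z) = jet_proj z + t *\<^sub>R ((0, ?e) :: ('p, 'q, 'n) jet)" for t z
      using eq Abs_jet_index_inverse[of J, where 'n='n] True
      by (cases z) (auto simp: Inr a jet_proj_def vec_eq_iff axis_def)
    ultimately show thesis using coord by blast
  next
    case False
    have "(\<beta>, Rep_jet_index K) \<noteq> (\<alpha>, J)" for \<beta> and K :: "('p, 'n) jet_index"
      using Rep_jet_index[of K] False by auto
    then have "(jet_proj (shift d t z) :: ('p, 'q, 'n) jet) = jet_proj z" for t z
      by (cases z) (auto simp: Inr a jet_proj_def vec_eq_iff)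
    then show thesis using const by blast
  qed
qed

text \<open>
  Along jets bounded by a power of \<open>1 / \<epsilon>\<close> the weight \<open>1 + |z|\<close> is bounded by a power of \<open>1 / \<epsilon>\<close>; the
  base point contributes a bounded amount because \<open>\<Omega>\<close> is bounded.
\<close>

lemma jet_proj_growth:
  fixes \<Omega> :: "(real ^ 'p::finite) set"
  assumes \<Omega>: "bounded \<Omega>"
  shows "\<forall>\<^sub>F \<epsilon> in at_right 0. \<forall>x\<in>\<Omega>. \<forall>U. jet_le CARD('n) U (1 / \<epsilon> ^ N) \<longrightarrow>
      1 + norm (jet_proj (x, U) :: ('p, 'q::finite, 'n::finite) jet) \<le> 1 / \<epsilon> ^ Suc N"
proof -
  obtain R where R: "R > 0" "\<And>x. x \<in> \<Omega> \<Longrightarrow> norm x \<le> R"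
    using \<Omega> bounded_pos by blast
  define m where "m = real (card (UNIV :: ('q \<times> ('p, 'n) jet_index) set))"
  have m: "m \<ge> 0" by (simp add: m_def)
  show ?thesis
    using eventually_const_times_le_1[of "1 + R + m"]
  proof eventually_elim
    case (elim \<epsilon>)
    then have \<epsilon>: "0 < \<epsilon>" "1 + R + m \<le> 1 / \<epsilon>" by (auto simp: pos_le_divide_eq)
    have \<epsilon>1: "1 / \<epsilon> ^ 0 \<le> 1 / \<epsilon> ^ N"
    proof (rule inverse_power_mono)
      have "1 \<le> 1 / \<epsilon>" using \<epsilon> R(1) m by linarith
      then show "\<epsilon> \<le> 1" using \<epsilon> by (simp add: field_simps)
    qed (use \<epsilon> in auto)
    show ?case
    proof (intro ballI allI impI)
      fix x U assume x: "x \<in> \<Omega>" and U: "\<forall>a :: 'q \<times> 'p multiset. size (snd a) \<le> CARD('n) \<longrightarrow> \<bar>U a\<bar> \<le> 1 / \<epsilon> ^ N"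
      define w :: "real ^ ('q \<times> ('p, 'n) jet_index)" where "w = (\<chi> a. U (fst a, Rep_jet_index (snd a)))"
      have z: "jet_proj (x, U) = (x, w)" by (simp add: jet_proj_def w_def)
      have "norm w \<le> (\<Sum>a\<in>UNIV. \<bar>w $ a\<bar>)" by (rule norm_le_l1_cart)
      also have "\<dots> \<le> (\<Sum>a\<in>(UNIV :: ('q \<times> ('p, 'n) jet_index) set). 1 / \<epsilon> ^ N)"
        by (intro sum_mono) (use U Rep_jet_index in \<open>auto simp: w_def\<close>)
      finally have "norm w \<le> m / \<epsilon> ^ N" by (simp add: m_def)
      then have "norm (x, w) \<le> R + m / \<epsilon> ^ N"
        using R(2)[OF x] norm_Pair_le[of x w] by linarith
      moreover have "1 + R \<le> (1 + R) * (1 / \<epsilon> ^ N)"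
        using \<epsilon>1 R mult_left_mono[of 1 "1 / \<epsilon> ^ N" "1 + R"] by simp
      ultimately have "1 + norm (x, w) \<le> (1 + R + m) * (1 / \<epsilon> ^ N)"
        by (simp add: algebra_simps add_divide_distrib)
      also have "\<dots> \<le> (1 / \<epsilon>) * (1 / \<epsilon> ^ N)"
        using \<epsilon> by (intro mult_right_mono) auto
      finally show "1 + norm (jet_proj (x, U) :: ('p, 'q, 'n) jet) \<le> 1 / \<epsilon> ^ Suc N" by (simp add: z)
    qed
  qed
qed

lemma fst_jet_proj [simp]: "fst (jet_proj z) = fst z"
  by (simp add: jet_proj_def case_prod_unfold)

lemma tau_moderate_growth:
  fixes M :: "('p::finite, 'q::finite, 'n::finite) jet net"
  assumes \<Omega>: "bounded \<Omega>" and M: "M \<in> tau_moderate \<Omega>" and bs: "bs \<in> lists Basis"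
  shows "\<exists>N'::nat. \<forall>\<^sub>F \<epsilon> in at_right 0. \<forall>x\<in>\<Omega>. \<forall>U.
        jet_le CARD('n) U (1 / \<epsilon> ^ N) \<longrightarrow> \<bar>pdiffs bs (M \<epsilon>) (jet_proj (x, U))\<bar> \<le> 1 / \<epsilon> ^ N'"
proof -
  obtain K :: nat and C where C: "\<forall>\<^sub>F \<epsilon> in at_right 0. \<forall>z\<in>closure \<Omega> \<times> UNIV.
      \<bar>pdbar (\<Omega> \<times> UNIV) bs (M \<epsilon>) z / (1 + norm z) ^ K\<bar> \<le> C * (1 / \<epsilon> ^ K)"
    using M bs unfolding tau_moderate_def sup_bigo_def by fast
  have "\<forall>\<^sub>F \<epsilon> in at_right 0. \<forall>x\<in>\<Omega>. \<forall>U. jet_le CARD('n) U (1 / \<epsilon> ^ N) \<longrightarrow>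
      \<bar>pdiffs bs (M \<epsilon>) (jet_proj (x, U))\<bar> \<le> 1 / \<epsilon> ^ (Suc K + Suc N * K)"
    using C jet_proj_growth[OF \<Omega>, where 'q='q and 'n='n, of N] eventually_const_times_le_1[of C]
  proof eventually_elim
    case (elim \<epsilon>)
    then have \<epsilon>: "0 < \<epsilon>" "C \<le> 1 / \<epsilon>" by (auto simp: pos_le_divide_eq)
    show ?case
    proof (intro ballI allI impI)
      fix x U assume x: "x \<in> \<Omega>" and U: "\<forall>a :: 'q \<times> 'p multiset. size (snd a) \<le> CARD('n) \<longrightarrow> \<bar>U a\<bar> \<le> 1 / \<epsilon> ^ N"
      define z :: "('p, 'q, 'n) jet" where "z = jet_proj (x, U)"
      have n: "1 + norm z \<le> 1 / \<epsilon> ^ Suc N" using elim(2) x U unfolding z_def by blast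
      have z: "z \<in> \<Omega> \<times> UNIV" using x by (simp add: z_def mem_Times_iff)
      then have "\<bar>pdiffs bs (M \<epsilon>) z / (1 + norm z) ^ K\<bar> \<le> C * (1 / \<epsilon> ^ K)"
        using elim(1) closure_subset[of \<Omega>] by (force simp: pdbar_def)
      then have "\<bar>pdiffs bs (M \<epsilon>) z\<bar> \<le> C * (1 / \<epsilon> ^ K) * (1 + norm z) ^ K"
        by (simp add: abs_divide divide_le_eq add_pos_nonneg)
      also have "\<dots> \<le> (1 / \<epsilon>) * (1 / \<epsilon> ^ K) * (1 / \<epsilon> ^ Suc N) ^ K"
        using \<epsilon> n by (intro mult_mono power_mono) auto
      also have "(1 / \<epsilon> ^ Suc N) ^ K = 1 / \<epsilon> ^ (Suc N * K)"
        by (simp only: power_divide power_one power_mult)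
      also have "1 / \<epsilon> * (1 / \<epsilon> ^ K) * (1 / \<epsilon> ^ (Suc N * K)) = 1 / \<epsilon> ^ (Suc K + Suc N * K)"
        by (simp only: power_add power_Suc times_divide_times_eq mult_1)
      finally show "\<bar>pdiffs bs (M \<epsilon>) (jet_proj (x, U))\<bar> \<le> 1 / \<epsilon> ^ (Suc K + Suc N * K)"
        by (simp only: z_def)
    qed
  qed
  then show ?thesis by blast
qed

lemma jet_smooth_tau_moderate:
  fixes M :: "('p::finite, 'q::finite, 'n::finite) jet net"
  assumes \<Omega>: "bounded \<Omega>" and M: "M \<in> tau_moderate \<Omega>"
  shows "jet_smooth \<Omega> CARD('n) (\<lambda>\<epsilon>. M \<epsilon> \<circ> jet_proj)"
proof -
  have S: "smooth_along Basis (\<Omega> \<times> UNIV) (M \<epsilon>)" if "\<epsilon> \<in> {0<..1}" for \<epsilon>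
    using M that by (auto simp: tau_moderate_def cinf_def)
  have proj_in: "jet_proj z \<in> \<Omega> \<times> (UNIV :: (real ^ ('q \<times> ('p, 'n) jet_index)) set)"
    if "z \<in> \<Omega> \<times> UNIV" for z using that by (auto simp: jet_proj_def)
  have "jet_tame \<Omega> CARD('n) k (\<lambda>\<epsilon>. pdiffs bs (M \<epsilon>) \<circ> jet_proj)" if "bs \<in> lists Basis" for bs k
    using that
  proof (induction k arbitrary: bs)
    have reg: "jet_regular \<Omega> CARD('n) (\<lambda>\<epsilon>. pdiffs bs (M \<epsilon>) \<circ> jet_proj)" if bs: "bs \<in> lists Basis" for bs
    proof (rule jet_regularI)
      fix \<epsilon> :: real assume \<epsilon>: "\<epsilon> \<in> {0<..1}"
      note s = smooth_along_pdiffs[OF S[OF \<epsilon>] bs]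
      show "continuous_on (\<Omega> \<times> UNIV) (pdiffs bs (M \<epsilon>) \<circ> jet_proj)"
        by (intro continuous_on_compose continuous_on_jet_proj
              continuous_on_subset[OF smooth_along_continuous[OF s]]) (use proj_in in blast)+
      fix z d assume z: "z \<in> \<Omega> \<times> (UNIV :: ('q \<times> 'p multiset \<Rightarrow> real) set)"
      show "\<exists>D. ((\<lambda>t. (pdiffs bs (M \<epsilon>) \<circ> jet_proj) (shift d t z)) has_real_derivative D) (at 0)"
      proof (cases d rule: jet_proj_shift[where 'n='n])
        case (coord b)
        have "((\<lambda>t. pdiffs bs (M \<epsilon>) (jet_proj z + t *\<^sub>R b)) has_real_derivative
            pdiff b (pdiffs bs (M \<epsilon>)) (jet_proj z + 0 *\<^sub>R b)) (at 0)"
          by (rule smooth_along_DERIV[OF s coord(1)]) (use proj_in[OF z] in simp)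
        then show ?thesis using coord by auto
      next
        case const
        then show ?thesis by (auto intro: DERIV_const)
      qed
    next
      fix \<epsilon> :: real and x and U V :: "'q \<times> 'p multiset \<Rightarrow> real"
      assume UV: "\<And>a. size (snd a) \<le> CARD('n) \<Longrightarrow> U a = V a"
      have "size (Rep_jet_index (J :: ('p, 'n) jet_index)) \<le> CARD('n)" for J
        using Rep_jet_index[of J] by simp
      then have "(jet_proj (x, U) :: ('p, 'q, 'n) jet) = jet_proj (x, V)"
        using UV by (auto simp: jet_proj_def vec_eq_iff)
      then show "(pdiffs bs (M \<epsilon>) \<circ> jet_proj) (x, U) = (pdiffs bs (M \<epsilon>) \<circ> jet_proj) (x, V)" by simp
    next
      fix N
      show "\<exists>N'::nat. \<forall>\<^sub>F \<epsilon> in at_right 0. \<forall>x\<in>\<Omega>. \<forall>U. jet_le CARD('n) U (1 / \<epsilon> ^ N) \<longrightarrow>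
          \<bar>(pdiffs bs (M \<epsilon>) \<circ> jet_proj) (x, U)\<bar> \<le> 1 / \<epsilon> ^ N'"
        using tau_moderate_growth[OF \<Omega> M bs, of N] by simp
    qed
    {
      case 0
      then show ?case using reg unfolding jet_tame.simps by blast
    next
      case (Suc k)
      have "jet_tame \<Omega> CARD('n) k (\<lambda>\<epsilon>. jet_pd d (pdiffs bs (M \<epsilon>) \<circ> jet_proj))" for d
      proof (cases d rule: jet_proj_shift[where 'n='n])
        case (coord b)
        have eq: "jet_pd d (pdiffs bs (M \<epsilon>) \<circ> jet_proj) = pdiffs (b # bs) (M \<epsilon>) \<circ> jet_proj" for \<epsilon>
          by (auto simp: fun_eq_iff jet_pd_def pdiff_def coord(2))
        have "b # bs \<in> lists Basis" using Suc.prems coord(1) by simp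
        from Suc.IH[OF this] show ?thesis by (simp only: eq)
      next
        case const
        have "jet_pd d (pdiffs bs (M \<epsilon>) \<circ> jet_proj) = (\<lambda>z. 0)" for \<epsilon>
          by (auto simp: fun_eq_iff jet_pd_def const)
        then show ?thesis using jet_tame_const by simp
      qed
      then show ?case using reg[OF Suc.prems] unfolding jet_tame.simps by blast
    }
  qed
  from this[of "[]"] show ?thesis by (simp add: jet_smooth_def)
qed

text \<open>
  Embeds cutoff functions into the class of nets on the jet space, so that the product of a cutoff
  with the Euler expression is again in that class.
\<close>

lemma jet_smooth_base_function:
  fixes f :: "real ^ 'p::finite \<Rightarrow> real"
  assumes f: "smooth_along Basis \<Omega> f" and B: "\<And>bs. bs \<in> lists Basis \<Longrightarrow> \<exists>C. \<forall>x\<in>\<Omega>. \<bar>pdiffs bs f x\<bar> \<le> C"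
  shows "jet_smooth \<Omega> r (\<lambda>\<epsilon> z :: ('p, 'q) inf_jet. f (fst z))"
proof -
  have "jet_tame \<Omega> r k (\<lambda>\<epsilon> z :: ('p, 'q) inf_jet. pdiffs bs f (fst z))" if "bs \<in> lists Basis" for bs k
    using that
  proof (induction k arbitrary: bs)
    have D: "((\<lambda>t. pdiffs bs f (fst (shift d t z))) has_real_derivative
        (case d of Inl i \<Rightarrow> pdiffs (axis i 1 # bs) f (fst z) | Inr a \<Rightarrow> 0)) (at 0)"
      if "z \<in> \<Omega> \<times> UNIV" "bs \<in> lists Basis" for z :: "('p, 'q) inf_jet" and d bs
    proof -
      obtain x U where z: "z = (x, U)" by (cases z)
      show ?thesis
      proof (cases d)
        case (Inl i)
        show ?thesis
          using smooth_along_DERIV[OF smooth_along_pdiffs[OF f that(2)], of "axis i 1" x 0] that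
          by (simp add: Inl z axis_in_Basis_iff)
      qed (simp add: z)
    qed
    have reg: "jet_regular \<Omega> r (\<lambda>\<epsilon> z :: ('p, 'q) inf_jet. pdiffs bs f (fst z))" if bs: "bs \<in> lists Basis" for bs
    proof (rule jet_regularI)
      show "continuous_on (\<Omega> \<times> UNIV) (\<lambda>z :: ('p, 'q) inf_jet. pdiffs bs f (fst z))"
        by (rule continuous_on_compose2[OF smooth_along_continuous[OF smooth_along_pdiffs[OF f bs]]
              continuous_on_fst[OF continuous_on_id]]) auto
      show "\<exists>D. ((\<lambda>t. pdiffs bs f (fst (shift d t z))) has_real_derivative D) (at 0)"
        if "z \<in> \<Omega> \<times> UNIV" for z :: "('p, 'q) inf_jet" and d
        using D[OF that bs] by blast
    next
      fix N
      obtain C where C: "\<forall>x\<in>\<Omega>. \<bar>pdiffs bs f x\<bar> \<le> C" using B[OF bs] by blast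
      have "\<forall>\<^sub>F \<epsilon> in at_right 0. \<bar>C\<bar> \<le> 1 / \<epsilon> ^ 1"
        by (rule eventually_mono[OF eventually_const_times_le_1[of "\<bar>C\<bar>"]]) (simp add: pos_le_divide_eq)
      then have "\<forall>\<^sub>F \<epsilon> in at_right 0. \<forall>x\<in>\<Omega>. \<forall>U :: 'q \<times> 'p multiset \<Rightarrow> real.
        jet_le r U (1 / \<epsilon> ^ N) \<longrightarrow> \<bar>pdiffs bs f (fst (x, U))\<bar> \<le> 1 / \<epsilon> ^ 1"
        by (rule eventually_mono) (use C in force)
      then show "\<exists>N'::nat. \<forall>\<^sub>F \<epsilon> in at_right 0. \<forall>x\<in>\<Omega>. \<forall>U :: 'q \<times> 'p multiset \<Rightarrow> real.
        jet_le r U (1 / \<epsilon> ^ N) \<longrightarrow> \<bar>pdiffs bs f (fst (x, U))\<bar> \<le> 1 / \<epsilon> ^ N'"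
        by blast
    qed simp
    {
      case 0
      then show ?case using reg by simp
    next
      case (Suc k)
      have "jet_pd (Inl i) (\<lambda>z :: ('p, 'q) inf_jet. pdiffs bs f (fst z)) = (\<lambda>z. pdiffs (axis i 1 # bs) f (fst z))" for i
        by (auto simp: fun_eq_iff jet_pd_def pdiff_def)
      moreover have "jet_pd (Inr a) (\<lambda>z :: ('p, 'q) inf_jet. pdiffs bs f (fst z)) = (\<lambda>z. 0)" for a
        by (auto simp: fun_eq_iff jet_pd_def)
      moreover have "jet_tame \<Omega> r k (\<lambda>\<epsilon> z :: ('p, 'q) inf_jet. pdiffs (axis i 1 # bs) f (fst z))" for i
        using Suc.IH[of "axis i 1 # bs"] Suc.prems by (simp add: axis_in_Basis_iff)
      ultimately have "jet_tame \<Omega> r k (\<lambda>\<epsilon>. jet_pd d (\<lambda>z :: ('p, 'q) inf_jet. pdiffs bs f (fst z)))" for d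
        by (cases d) (auto intro: jet_tame_const)
      then show ?case using reg[OF Suc.prems] by simp
    }
  qed
  from this[of "[]"] show ?thesis by (simp add: jet_smooth_def)
qed

section \<open>Smooth bump functions\<close>

text \<open>
  The functions \<open>t\<^bsup>-k\<^esup> exp(-1/t)\<close>, extended by zero to \<open>t \<le> 0\<close>.  Derivatives of each are combinations
  of others, and this family is all that is needed to differentiate \<open>exp(-1/t)\<close> infinitely often.
\<close>

definition flat_fun :: "nat \<Rightarrow> real \<Rightarrow> real" where
  "flat_fun k t = (if t > 0 then exp (- inverse t) * inverse t ^ k else 0)"

lemma DERIV_flat_fun:
  "(flat_fun k has_real_derivative flat_fun (k + 2) t - real k * flat_fun (k + 1) t) (at t)"
proof (cases t "0 :: real" rule: linorder_cases)
  case less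
  have "((\<lambda>t. 0) has_real_derivative 0) (at t)" by simp
  moreover have "\<forall>\<^sub>F s in nhds t. 0 = flat_fun k s"
    using eventually_nhds_in_open[of "{..<0}" t] less by (auto simp: flat_fun_def elim!: eventually_mono)
  ultimately have "(flat_fun k has_real_derivative 0) (at t)" by (rule DERIV_eventually_cong)
  then show ?thesis using less by (simp add: flat_fun_def)
next
  case equal
  have "((\<lambda>h. flat_fun k h / h) \<longlongrightarrow> 0) (at 0)"
  proof (rule filterlim_split_at)
    show "((\<lambda>h. flat_fun k h / h) \<longlongrightarrow> 0) (at_left 0)"
      by (rule Lim_transform_eventually[OF tendsto_const])
         (use eventually_at_left_real[of "-1" 0] in \<open>auto simp: flat_fun_def elim!: eventually_mono\<close>)
    have "((\<lambda>h. inverse h ^ Suc k / exp (inverse h)) \<longlongrightarrow> (0::real)) (at_right 0)"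
      using filterlim_compose[OF tendsto_power_div_exp_0 filterlim_inverse_at_top_right] .
    moreover have "\<forall>\<^sub>F h in at_right 0. inverse h ^ Suc k / exp (inverse h) = flat_fun k h / h"
      using eventually_at_right_0_less[of 1, simplified]
      by eventually_elim (simp add: flat_fun_def exp_minus field_simps)
    ultimately show "((\<lambda>h. flat_fun k h / h) \<longlongrightarrow> 0) (at_right 0)"
      by (rule Lim_transform_eventually)
  qed
  then show ?thesis using equal by (simp add: DERIV_def flat_fun_def)
next
  case greater
  have "((\<lambda>t. exp (- inverse t) * inverse t ^ k) has_real_derivative
      exp (- inverse t) * inverse t ^ (k + 2) - real k * (exp (- inverse t) * inverse t ^ (k + 1))) (at t)"
  proof -
    have i: "(inverse has_real_derivative - (inverse t ^ 2)) (at t)"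
      using DERIV_inverse[of t] greater by (simp add: numeral_2_eq_2)
    have "((\<lambda>t. inverse t ^ k) has_real_derivative - real k * inverse t ^ (k + 1)) (at t)"
    proof (induction k)
      case (Suc k)
      show ?case using DERIV_mult[OF i Suc] by (simp add: algebra_simps power2_eq_square)
    qed simp
    moreover have "((\<lambda>t. exp (- inverse t)) has_real_derivative exp (- inverse t) * (inverse t ^ 2)) (at t)"
      using DERIV_chain2[OF DERIV_exp DERIV_minus[OF i]] by simp
    ultimately have "((\<lambda>t. inverse t ^ k * exp (- inverse t)) has_real_derivative
      (- real k * inverse t ^ (k + 1)) * exp (- inverse t) + (exp (- inverse t) * inverse t ^ 2) * inverse t ^ k) (at t)"
      by (rule DERIV_mult)
    then show ?thesis by (simp add: algebra_simps power2_eq_square)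
  qed
  moreover have "\<forall>\<^sub>F s in nhds t. exp (- inverse s) * inverse s ^ k = flat_fun k s"
    using eventually_nhds_in_open[of "{0<..}" t] greater by (auto simp: flat_fun_def elim!: eventually_mono)
  ultimately have "(flat_fun k has_real_derivative
      exp (- inverse t) * inverse t ^ (k + 2) - real k * (exp (- inverse t) * inverse t ^ (k + 1))) (at t)"
    by (rule DERIV_eventually_cong)
  then show ?thesis using greater by (simp add: flat_fun_def)
qed

text \<open>
  An algebra of functions containing \<open>exp(-1/(r\<^sup>2 - |x - x0|\<^sup>2))\<close>, extended by zero, and closed under
  directional derivatives.  Since its members are continuous, all of them are smooth.
\<close>

inductive_set bump_algebra :: "'a::euclidean_space \<Rightarrow> real \<Rightarrow> ('a \<Rightarrow> real) set" for x0 r where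
  flat: "(\<lambda>x. flat_fun k (r\<^sup>2 - (x - x0) \<bullet> (x - x0))) \<in> bump_algebra x0 r"
| coord: "(\<lambda>x. (x - x0) \<bullet> b) \<in> bump_algebra x0 r"
| const: "(\<lambda>x. c) \<in> bump_algebra x0 r"
| add: "f \<in> bump_algebra x0 r \<Longrightarrow> g \<in> bump_algebra x0 r \<Longrightarrow> (\<lambda>x. f x + g x) \<in> bump_algebra x0 r"
| mult: "f \<in> bump_algebra x0 r \<Longrightarrow> g \<in> bump_algebra x0 r \<Longrightarrow> (\<lambda>x. f x * g x) \<in> bump_algebra x0 r"

lemma bump_algebra_deriv:
  assumes "f \<in> bump_algebra x0 r"
  shows "\<exists>f'\<in>bump_algebra x0 r. \<forall>x. ((\<lambda>t. f (x + t *\<^sub>R b)) has_real_derivative f' x) (at 0)"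
  using assms
proof (induction rule: bump_algebra.induct)
  case (flat k)
  let ?\<rho> = "\<lambda>x. r\<^sup>2 - (x - x0) \<bullet> (x - x0)"
  let ?f' = "\<lambda>x. (flat_fun (k + 2) (?\<rho> x) + (- real k) * flat_fun (k + 1) (?\<rho> x)) * ((-2) * ((x - x0) \<bullet> b))"
  have "?f' \<in> bump_algebra x0 r"
    by (intro bump_algebra.intros)
  moreover have "((\<lambda>t. flat_fun k (?\<rho> (x + t *\<^sub>R b))) has_real_derivative ?f' x) (at 0)" for x
  proof -
    have "((\<lambda>t. ?\<rho> (x + t *\<^sub>R b)) has_real_derivative (-2) * ((x - x0) \<bullet> b)) (at 0)"
    proof -
      have e: "?\<rho> (x + t *\<^sub>R b) = ?\<rho> x - 2 * t * ((x - x0) \<bullet> b) - t * t * (b \<bullet> b)" for t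
        by (simp add: algebra_simps inner_commute)
      show ?thesis unfolding e by (auto intro!: derivative_eq_intros)
    qed
    moreover have "(flat_fun k has_real_derivative flat_fun (k + 2) (?\<rho> x) + (- real k) * flat_fun (k + 1) (?\<rho> x))
        (at (?\<rho> (x + 0 *\<^sub>R b)))"
      using DERIV_flat_fun[of k "?\<rho> x"] by simp
    ultimately show ?thesis by (rule DERIV_chain2[rotated])
  qed
  ultimately show ?case by (intro bexI[of _ ?f'] allI)
next
  case (coord c)
  have "((\<lambda>t. (x + t *\<^sub>R b - x0) \<bullet> c) has_real_derivative b \<bullet> c) (at 0)" for x
  proof -
    have e: "(x + t *\<^sub>R b - x0) \<bullet> c = (x - x0) \<bullet> c + t * (b \<bullet> c)" for t by (simp add: algebra_simps)
    show ?thesis unfolding e by (auto intro!: derivative_eq_intros)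
  qed
  then show ?case by (intro bexI[of _ "\<lambda>x. b \<bullet> c"] allI bump_algebra.const)
next
  case (const c)
  then show ?case using bump_algebra.const[of 0 x0 r] by (auto intro!: bexI[of _ "\<lambda>x. 0"])
next
  case (add f g)
  then obtain f' g' where "f' \<in> bump_algebra x0 r" "g' \<in> bump_algebra x0 r"
    "\<And>x. ((\<lambda>t. f (x + t *\<^sub>R b)) has_real_derivative f' x) (at 0)"
    "\<And>x. ((\<lambda>t. g (x + t *\<^sub>R b)) has_real_derivative g' x) (at 0)" by auto
  then show ?case
    by (intro bexI[of _ "\<lambda>x. f' x + g' x"] allI DERIV_add bump_algebra.add)
next
  case (mult f g)
  then obtain f' g' where *: "f' \<in> bump_algebra x0 r" "g' \<in> bump_algebra x0 r"
    "\<And>x. ((\<lambda>t. f (x + t *\<^sub>R b)) has_real_derivative f' x) (at 0)"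
    "\<And>x. ((\<lambda>t. g (x + t *\<^sub>R b)) has_real_derivative g' x) (at 0)" by auto
  have "((\<lambda>t. f (x + t *\<^sub>R b) * g (x + t *\<^sub>R b)) has_real_derivative f' x * g x + g' x * f x) (at 0)" for x
    using DERIV_mult[OF *(3,4)] by simp
  moreover have "(\<lambda>x. f' x * g x + g' x * f x) \<in> bump_algebra x0 r"
    using * mult.hyps by (intro bump_algebra.intros)
  ultimately show ?case by (intro bexI[of _ "\<lambda>x. f' x * g x + g' x * f x"] allI)
qed

lemma bump_algebra_continuous:
  assumes "f \<in> bump_algebra x0 r"
  shows "continuous_on UNIV f"
  using assms
proof (induction rule: bump_algebra.induct)
  case (flat k)
  have "continuous_on UNIV (flat_fun k)"
    using DERIV_isCont[OF DERIV_flat_fun] by (simp add: continuous_on_eq_continuous_at)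
  then show ?case
    by (rule continuous_on_compose2) (auto intro!: continuous_intros)
qed (auto intro!: continuous_intros)

lemma smooth_along_bump_algebra:
  assumes f: "f \<in> bump_algebra x0 r"
  shows "smooth_along B UNIV f"
proof -
  have D: "pdiff b f \<in> bump_algebra x0 r \<and> (\<lambda>t. f (x + t *\<^sub>R b)) differentiable (at 0)"
    if f: "f \<in> bump_algebra x0 r" for f b x
  proof -
    obtain f' where f': "f' \<in> bump_algebra x0 r"
      "\<And>x. ((\<lambda>t. f (x + t *\<^sub>R b)) has_real_derivative f' x) (at 0)"
      using bump_algebra_deriv[OF f] by blast
    have "pdiff b f = f'" using pdiff_eqI[OF f'(2)] by auto
    then show ?thesis using f' by (auto simp: real_differentiable_def)
  qed
  have "pdiffs bs f \<in> bump_algebra x0 r" for bs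
    by (induction bs) (use f D in auto)
  then show ?thesis using D bump_algebra_continuous unfolding smooth_along_def by blast
qed

lemma bump_exists:
  fixes x0 :: "'a::euclidean_space"
  assumes r: "r > 0"
  obtains \<theta> :: "'a \<Rightarrow> real" and c where "smooth_along Basis UNIV \<theta>" "\<And>x. 0 \<le> \<theta> x"
    "\<And>x. x \<notin> ball x0 r \<Longrightarrow> \<theta> x = 0" "c > 0" "\<And>x. x \<in> cball x0 (r/2) \<Longrightarrow> c \<le> \<theta> x"
proof
  let ?\<rho> = "\<lambda>x. r\<^sup>2 - (x - x0) \<bullet> (x - x0)"
  let ?g = "\<lambda>x. flat_fun 0 (?\<rho> x)"
  have \<rho>: "?\<rho> x = r\<^sup>2 - (dist x0 x)\<^sup>2" for x
  proof -
    have "dist x0 x = norm (x - x0)" by (metis dist_commute dist_norm)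
    then show ?thesis by (simp add: power2_norm_eq_inner)
  qed
  show "smooth_along Basis UNIV ?g" by (rule smooth_along_bump_algebra[OF bump_algebra.flat])
  show "0 \<le> ?g x" for x by (simp add: flat_fun_def)
  show "?g x = 0" if "x \<notin> ball x0 r" for x
  proof -
    have "r\<^sup>2 \<le> (dist x0 x)\<^sup>2" using that r by (intro power_mono) auto
    then show ?thesis unfolding \<rho> by (simp add: flat_fun_def)
  qed
  show "0 < flat_fun 0 (3/4 * r\<^sup>2)" using r by (simp add: flat_fun_def)
  show "flat_fun 0 (3/4 * r\<^sup>2) \<le> ?g x" if "x \<in> cball x0 (r/2)" for x
  proof -
    have "(dist x0 x)\<^sup>2 \<le> (r/2)\<^sup>2" using that by (intro power_mono) auto
    then have le: "3/4 * r\<^sup>2 \<le> r\<^sup>2 - (dist x0 x)\<^sup>2" by (simp add: power2_eq_square)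
    have pos: "0 < 3/4 * r\<^sup>2" using r by simp
    then have "inverse (r\<^sup>2 - (dist x0 x)\<^sup>2) \<le> inverse (3/4 * r\<^sup>2)" using le by (intro le_imp_inverse_le) auto
    moreover have "0 < r\<^sup>2 - (dist x0 x)\<^sup>2" using le pos by linarith
    ultimately show ?thesis unfolding \<rho> using pos by (simp add: flat_fun_def)
  qed
qed

section \<open>Integration by parts\<close>

lemma continuous_on_extend_zero:
  fixes h :: "'a::t2_space \<Rightarrow> real"
  assumes \<Omega>: "open \<Omega>" and K: "compact K" "K \<subseteq> \<Omega>" and h: "continuous_on \<Omega> h"
    and 0: "\<And>x. x \<in> \<Omega> - K \<Longrightarrow> h x = 0"
  shows "continuous_on UNIV (\<lambda>x. if x \<in> \<Omega> then h x else 0)" (is "continuous_on UNIV ?g")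
proof -
  have "continuous_on \<Omega> ?g" using h by (simp cong: continuous_on_cong)
  moreover have "continuous_on (- K) ?g"
    using continuous_on_cong[of "- K" "- K" ?g "\<lambda>x. 0"] 0 by (simp add: continuous_on_const)
  moreover have "open (- K)" using K compact_imp_closed by auto
  ultimately have "continuous_on (\<Omega> \<union> - K) ?g" using \<Omega> by (intro continuous_on_open_Un)
  moreover have "\<Omega> \<union> - K = UNIV" using K by auto
  ultimately show ?thesis by simp
qed

lemma integrable_compact_support:
  fixes g :: "'a::euclidean_space \<Rightarrow> real"
  assumes g: "continuous_on UNIV g" and K: "compact K" and 0: "\<And>x. x \<notin> K \<Longrightarrow> g x = 0"
  shows "integrable lborel g"
proof -
  have "integrable lborel (\<lambda>x. indicator K x *\<^sub>R g x)"
    by (rule borel_integrable_compact[OF K continuous_on_subset[OF g]]) auto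
  moreover have "(\<lambda>x. indicator K x *\<^sub>R g x) = g" using 0 by (auto simp: fun_eq_iff indicator_def)
  ultimately show ?thesis by simp
qed

lemma integral_compact_support:
  fixes h :: "'a::euclidean_space \<Rightarrow> real"
  assumes \<Omega>: "open \<Omega>" and K: "compact K" "K \<subseteq> \<Omega>" and h: "continuous_on \<Omega> h"
    and 0: "\<And>x. x \<in> \<Omega> - K \<Longrightarrow> h x = 0"
  shows "set_integrable lebesgue \<Omega> h"
    and "(LINT x:\<Omega>|lebesgue. h x) = (LINT x|lborel. (if x \<in> \<Omega> then h x else 0))"
proof -
  let ?g = "\<lambda>x. if x \<in> \<Omega> then h x else 0"
  have e: "(\<lambda>x. indicator \<Omega> x *\<^sub>R h x) = ?g" by (auto simp: indicator_def)
  have c: "continuous_on UNIV ?g" by (rule continuous_on_extend_zero[OF \<Omega> K h 0])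
  then have m: "?g \<in> borel_measurable lborel" by (simp add: borel_measurable_continuous_onI)
  have "integrable lborel ?g" by (rule integrable_compact_support[OF c K(1)]) (use 0 in auto)
  then show "set_integrable lebesgue \<Omega> h"
    unfolding set_integrable_def e using integrable_completion[OF m] by simp
  show "(LINT x:\<Omega>|lebesgue. h x) = (LINT x|lborel. ?g x)"
    unfolding set_lebesgue_integral_def e using integral_completion[OF m] by simp
qed

text \<open>
  The integral of \<open>g\<close> is invariant under translations, so the difference quotients of \<open>g\<close> have integral
  zero.  They converge to \<open>g'\<close> and are dominated by the maximum of \<open>|g'|\<close> on a ball that contains the
  support and its translates.
\<close>

lemma integral_directional_derivative:
  fixes g g' :: "'a::euclidean_space \<Rightarrow> real"
  assumes g: "continuous_on UNIV g" and g': "continuous_on UNIV g'"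
    and D: "\<And>x. ((\<lambda>t. g (x + t *\<^sub>R b)) has_real_derivative g' x) (at 0)"
    and K: "compact K" and 0: "\<And>x. x \<notin> K \<Longrightarrow> g x = 0" and zero': "\<And>x. x \<notin> K \<Longrightarrow> g' x = 0"
  shows "(LINT x|lborel. g' x) = 0"
proof -
  obtain R where R: "R > 0" "\<And>x. x \<in> K \<Longrightarrow> norm x \<le> R"
    using compact_imp_bounded[OF K] bounded_pos by blast
  obtain B where B: "\<And>x. \<bar>g' x\<bar> \<le> B" "B \<ge> 0"
  proof -
    have "compact (g' ` K)" using K g' by (intro compact_continuous_image continuous_on_subset[OF g']) auto
    then obtain B where B: "\<forall>y\<in>g' ` K. norm y \<le> B" using compact_imp_bounded bounded_iff by blast
    have "\<bar>g' x\<bar> \<le> max B 0" for x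
      using B zero'[of x] by (cases "x \<in> K") (auto simp: le_max_iff_disj)
    then show thesis using that by force
  qed
  define h where "h n = 1 / real (Suc n)" for n
  have h: "0 < h n" "h n \<le> 1" for n by (auto simp: h_def)
  let ?s = "\<lambda>n x. (g (x + h n *\<^sub>R b) - g x) / h n"
  have D': "((\<lambda>t. g (x + t *\<^sub>R b)) has_real_derivative g' (x + t *\<^sub>R b)) (at t)" for x t
  proof -
    have "((\<lambda>s. g (x + (s + t) *\<^sub>R b)) has_real_derivative g' (x + t *\<^sub>R b)) (at 0)"
      using D[of "x + t *\<^sub>R b"] by (simp add: algebra_simps)
    then show ?thesis using DERIV_shift[of "\<lambda>s. g (x + s *\<^sub>R b)" "g' (x + t *\<^sub>R b)" 0 t] by simp
  qed
  let ?w = "\<lambda>x. indicator (cball 0 (R + norm b)) x *\<^sub>R B"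
  have gm: "g \<in> borel_measurable lborel" using g by (simp add: borel_measurable_continuous_onI)
  have gi: "integrable lborel g" by (rule integrable_compact_support[OF g K 0])
  have gs: "integrable lborel (\<lambda>x. g (x + c)) \<and> (LINT x|lborel. g (x + c)) = (LINT x|lborel. g x)" for c
  proof -
    have m: "(+) c \<in> measurable lborel borel" by simp
    have "integrable (distr lborel borel ((+) c)) g" using gi by (simp add: lborel_distr_plus)
    then have "integrable lborel (\<lambda>x. g (c + x))" using integrable_distr[OF m] by blast
    moreover have "(LINT x|distr lborel borel ((+) c). g x) = (LINT x|lborel. g (c + x))"
      by (rule integral_distr[OF m]) (use gm in simp)
    ultimately show ?thesis by (simp add: lborel_distr_plus add.commute)
  qed
  have "(\<lambda>n. LINT x|lborel. ?s n x) \<longlonglongrightarrow> (LINT x|lborel. g' x)"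
  proof (rule integral_dominated_convergence[where w = ?w])
    show "g' \<in> borel_measurable lborel" using g' by (simp add: borel_measurable_continuous_onI)
    show "?s n \<in> borel_measurable lborel" for n
    proof -
      have "continuous_on UNIV (?s n)"
        by (intro continuous_intros continuous_on_compose2[OF g] g) (use h[of n] in auto)
      then show ?thesis by (simp add: borel_measurable_continuous_onI)
    qed
    show "integrable lborel ?w"
      by (rule borel_integrable_compact) auto
    show "AE x in lborel. (\<lambda>n. ?s n x) \<longlonglongrightarrow> g' x"
    proof (rule AE_I2)
      fix x
      have "((\<lambda>t. (g (x + t *\<^sub>R b) - g x) / t) \<longlongrightarrow> g' x) (at 0)"
        using D[of x] by (simp add: DERIV_def)
      moreover have "filterlim h (at 0) sequentially"
        unfolding filterlim_at using h LIMSEQ_Suc[OF lim_1_over_n] by (auto simp: h_def[abs_def] less_imp_neq)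
      ultimately show "(\<lambda>n. ?s n x) \<longlonglongrightarrow> g' x"
        by (rule filterlim_compose)
    qed
    show "AE x in lborel. norm (?s n x) \<le> ?w x" for n
    proof (rule AE_I2)
      fix x
      show "norm (?s n x) \<le> ?w x"
      proof (cases "x \<in> cball 0 (R + norm b)")
        case True
        obtain \<xi> where "g (x + h n *\<^sub>R b) - g (x + 0 *\<^sub>R b) = (h n - 0) * g' (x + \<xi> *\<^sub>R b)"
          using mean_value_between[of 0 "h n" "\<lambda>t. g (x + t *\<^sub>R b)" "\<lambda>t. g' (x + t *\<^sub>R b)"] D' by metis
        then have "?s n x = g' (x + \<xi> *\<^sub>R b)" using h(1)[of n] by simp
        then show ?thesis using B True by simp
      next
        case False
        have "norm x \<le> norm (x + h n *\<^sub>R b) + norm (h n *\<^sub>R b)"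
          using norm_triangle_ineq4[of "x + h n *\<^sub>R b" "h n *\<^sub>R b"] by simp
        moreover have "norm (h n *\<^sub>R b) \<le> norm b" using h[of n] mult_right_mono[of "h n" 1 "norm b"] by simp
        ultimately have "norm (x + h n *\<^sub>R b) > R" "norm x > R" using False norm_ge_zero[of b] by (simp_all, linarith+)
        then have "g x = 0" "g (x + h n *\<^sub>R b) = 0" using R(2) 0 by (meson not_le)+
        then show ?thesis using B by simp
      qed
    qed
  qed
  moreover have "(LINT x|lborel. ?s n x) = 0" for n
  proof -
    have "(LINT x|lborel. ?s n x) = (LINT x|lborel. g (x + h n *\<^sub>R b) - g x) / h n" by simp
    also have "(LINT x|lborel. g (x + h n *\<^sub>R b) - g x) = 0"
      using gs[of "h n *\<^sub>R b"] gi by (subst Bochner_Integration.integral_diff) auto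
    finally show ?thesis by simp
  qed
  ultimately have "(\<lambda>n :: nat. 0 :: real) \<longlonglongrightarrow> (LINT x|lborel. g' x)" by (simp only:)
  then show ?thesis using LIMSEQ_unique[OF _ tendsto_const] by blast
qed

lemma pdiffs_vanish:
  assumes "open \<Omega>" "closed K" "\<And>x. x \<in> \<Omega> - K \<Longrightarrow> \<phi> x = 0" "x \<in> \<Omega> - K"
  shows "pdiffs bs \<phi> x = 0"
  using pdiffs_cong[of "\<Omega> - K" x \<phi> "\<lambda>x. 0" bs] assms by (simp add: open_Diff)

text \<open>
  Only one of the two factors has compact support in \<open>\<Omega>\<close>, but then the product, extended by zero,
  is continuously differentiable on the whole space and its derivative has integral zero.
\<close>

lemma integration_by_parts:
  fixes f \<phi> :: "'a::euclidean_space \<Rightarrow> real"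
  assumes \<Omega>: "open \<Omega>" and f: "smooth_along Basis \<Omega> f" and \<phi>: "smooth_along Basis \<Omega> \<phi>"
    and K: "compact K" "K \<subseteq> \<Omega>" and 0: "\<And>x. x \<in> \<Omega> - K \<Longrightarrow> \<phi> x = 0" and b: "b \<in> Basis"
  shows "(LINT x:\<Omega>|lebesgue. pdiff b f x * \<phi> x) = - (LINT x:\<Omega>|lebesgue. f x * pdiff b \<phi> x)"
proof -
  have zero': "pdiff b \<phi> x = 0" if "x \<in> \<Omega> - K" for x
    using pdiffs_vanish[OF \<Omega> compact_imp_closed[OF K(1)] 0 that, where bs = "[b]"] by simp
  note cf = smooth_along_continuous[OF f] and c\<phi> = smooth_along_continuous[OF \<phi>]
  note cf' = smooth_along_continuous[OF smooth_along_pdiff[OF f b]]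
   and c\<phi>' = smooth_along_continuous[OF smooth_along_pdiff[OF \<phi> b]]
  have c1: "continuous_on \<Omega> (\<lambda>x. pdiff b f x * \<phi> x)" by (intro continuous_intros cf' c\<phi>)
  have c2: "continuous_on \<Omega> (\<lambda>x. f x * pdiff b \<phi> x)" by (intro continuous_intros cf c\<phi>')
  have c0: "continuous_on \<Omega> (\<lambda>x. f x * \<phi> x)" by (intro continuous_intros cf c\<phi>)
  have c3: "continuous_on \<Omega> (\<lambda>x. pdiff b f x * \<phi> x + f x * pdiff b \<phi> x)" by (intro continuous_intros c1 c2)
  note i1 = integral_compact_support[OF \<Omega> K c1]
  note i2 = integral_compact_support[OF \<Omega> K c2]
  have "(LINT x:\<Omega>|lebesgue. pdiff b f x * \<phi> x) + (LINT x:\<Omega>|lebesgue. f x * pdiff b \<phi> x)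
      = (LINT x:\<Omega>|lebesgue. pdiff b f x * \<phi> x + f x * pdiff b \<phi> x)"
    by (rule set_integral_add(2)[symmetric]) (use i1(1) i2(1) 0 zero' in auto)
  also have "\<dots> = (LINT x|lborel. (if x \<in> \<Omega> then pdiff b f x * \<phi> x + f x * pdiff b \<phi> x else 0))"
    by (rule integral_compact_support(2)[OF \<Omega> K c3]) (use 0 zero' in auto)
  also have "\<dots> = 0"
  proof (rule integral_directional_derivative[where g = "\<lambda>x. if x \<in> \<Omega> then f x * \<phi> x else 0" and K = K and b = b])
    show "continuous_on UNIV (\<lambda>x. if x \<in> \<Omega> then f x * \<phi> x else 0)"
      by (rule continuous_on_extend_zero[OF \<Omega> K c0]) (use 0 in auto)
    show "continuous_on UNIV (\<lambda>x. if x \<in> \<Omega> then pdiff b f x * \<phi> x + f x * pdiff b \<phi> x else 0)"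
      by (rule continuous_on_extend_zero[OF \<Omega> K c3]) (use 0 zero' in auto)
    fix x
    show "((\<lambda>t. if x + t *\<^sub>R b \<in> \<Omega> then f (x + t *\<^sub>R b) * \<phi> (x + t *\<^sub>R b) else 0) has_real_derivative
       (if x \<in> \<Omega> then pdiff b f x * \<phi> x + f x * pdiff b \<phi> x else 0)) (at 0)"
    proof (cases "x \<in> \<Omega>")
      case True
      have "((\<lambda>t. f (x + t *\<^sub>R b) * \<phi> (x + t *\<^sub>R b)) has_real_derivative
          pdiff b f (x + 0 *\<^sub>R b) * \<phi> (x + 0 *\<^sub>R b) + pdiff b \<phi> (x + 0 *\<^sub>R b) * f (x + 0 *\<^sub>R b)) (at 0)"
        by (intro DERIV_mult smooth_along_DERIV[OF f b] smooth_along_DERIV[OF \<phi> b]) (use True in auto)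
      then have "((\<lambda>t. f (x + t *\<^sub>R b) * \<phi> (x + t *\<^sub>R b)) has_real_derivative
          (if x \<in> \<Omega> then pdiff b f x * \<phi> x + f x * pdiff b \<phi> x else 0)) (at 0)"
        using True by (simp add: mult.commute)
      then show ?thesis
        by (rule DERIV_eventually_cong)
           (rule eventually_mono[OF eventually_line_in_open[OF \<Omega> True, of b]], simp)
    next
      case False
      then have "x \<in> - K" "open (- K)" using K compact_imp_closed by auto
      then have "\<forall>\<^sub>F t in nhds 0. x + t *\<^sub>R b \<in> - K" using eventually_line_in_open by blast
      then have "\<forall>\<^sub>F t in nhds 0. 0 = (if x + t *\<^sub>R b \<in> \<Omega> then f (x + t *\<^sub>R b) * \<phi> (x + t *\<^sub>R b) else 0)"
        by (rule eventually_mono) (use 0 in auto)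
      with DERIV_const have "((\<lambda>t. if x + t *\<^sub>R b \<in> \<Omega> then f (x + t *\<^sub>R b) * \<phi> (x + t *\<^sub>R b) else 0) has_real_derivative 0) (at 0)"
        by (rule DERIV_eventually_cong)
      then show ?thesis using False by simp
    qed
  qed (use K 0 zero' in auto)
  finally show ?thesis by simp
qed

text \<open>
  The derivatives arrive at \<open>\<phi>\<close> in reverse order.
\<close>

lemma integration_by_parts_iterated:
  fixes f \<phi> :: "'a::euclidean_space \<Rightarrow> real"
  assumes \<Omega>: "open \<Omega>" and f: "smooth_along Basis \<Omega> f" and \<phi>: "smooth_along Basis \<Omega> \<phi>"
    and K: "compact K" "K \<subseteq> \<Omega>" and 0: "\<And>x. x \<in> \<Omega> - K \<Longrightarrow> \<phi> x = 0" and bs: "bs \<in> lists Basis"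
  shows "(LINT x:\<Omega>|lebesgue. pdiffs bs f x * \<phi> x) = (-1) ^ length bs * (LINT x:\<Omega>|lebesgue. f x * pdiffs (rev bs) \<phi> x)"
  using bs \<phi> 0
proof (induction bs arbitrary: \<phi> rule: list.induct)
  case (Cons b bs)
  have b: "b \<in> Basis" and bs: "bs \<in> lists Basis" using Cons.prems by auto
  have zero': "pdiff b \<phi> x = 0" if "x \<in> \<Omega> - K" for x
    using pdiffs_vanish[OF \<Omega> compact_imp_closed[OF K(1)] Cons.prems(3) that, where bs = "[b]"] by simp
  have "(LINT x:\<Omega>|lebesgue. pdiffs (b # bs) f x * \<phi> x) = - (LINT x:\<Omega>|lebesgue. pdiffs bs f x * pdiff b \<phi> x)"
    using integration_by_parts[OF \<Omega> smooth_along_pdiffs[OF f bs] Cons.prems(2) K Cons.prems(3) b] by simp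
  also have "(LINT x:\<Omega>|lebesgue. pdiffs bs f x * pdiff b \<phi> x)
      = (-1) ^ length bs * (LINT x:\<Omega>|lebesgue. f x * pdiffs (rev bs) (pdiff b \<phi>) x)"
    by (rule Cons.IH[OF bs smooth_along_pdiff[OF Cons.prems(2) b] zero'])
  finally show ?case by simp
qed simp

lemma integrable_bounded_continuous:
  fixes h :: "'a::euclidean_space \<Rightarrow> real"
  assumes \<Omega>: "open \<Omega>" "bounded \<Omega>" and h: "continuous_on \<Omega> h" and B: "\<And>x. x \<in> \<Omega> \<Longrightarrow> \<bar>h x\<bar> \<le> B"
  shows "set_integrable lebesgue \<Omega> h"
  unfolding set_integrable_def
proof (rule integrableI_bounded_set[where A = \<Omega> and B = B])
  have l: "\<Omega> \<in> lmeasurable" using \<Omega> lmeasurable_open by blast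
  show "\<Omega> \<in> sets lebesgue" "emeasure lebesgue \<Omega> < \<infinity>" using l by (auto simp: fmeasurable_def)
  have "(\<lambda>x. indicator \<Omega> x *\<^sub>R h x) \<in> borel_measurable borel"
    by (rule borel_measurable_continuous_on_indicator) (use \<Omega> h in auto)
  then show "(\<lambda>x. indicator \<Omega> x *\<^sub>R h x) \<in> borel_measurable lebesgue"
    by (intro measurable_completion) simp
qed (use B in auto)

lemma set_integral_le_measure:
  fixes h :: "'a::euclidean_space \<Rightarrow> real"
  assumes \<Omega>: "open \<Omega>" "bounded \<Omega>" and h: "set_integrable lebesgue \<Omega> h" and B: "\<And>x. x \<in> \<Omega> \<Longrightarrow> h x \<le> B"
  shows "(LINT x:\<Omega>|lebesgue. h x) \<le> B * measure lebesgue \<Omega>"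
proof -
  have l: "\<Omega> \<in> lmeasurable" using \<Omega> lmeasurable_open by blast
  have "(LINT x:\<Omega>|lebesgue. h x) \<le> (LINT x:\<Omega>|lebesgue. B)"
    by (intro set_integral_mono h B integrable_bounded_continuous[OF \<Omega>]) auto
  also have "\<dots> = B * measure lebesgue \<Omega>"
    using l by (simp add: set_lebesgue_integral_def fmeasurable_def)
  finally show ?thesis .
qed

text \<open>
  The point is moved from \<open>x\<close> to \<open>y\<close> along one coordinate after the other.  The intermediate points
  stay in the ball because the norms of the coordinate increments add up to at most \<open>DIM('a)\<close> times
  the norm of \<open>y - x\<close>.
\<close>

lemma lipschitz_from_pdiff:
  fixes f :: "'a::euclidean_space \<Rightarrow> real"
  assumes f: "smooth_along Basis S f" and S: "cball x r \<subseteq> S"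
    and B: "\<And>w b. w \<in> cball x r \<Longrightarrow> b \<in> Basis \<Longrightarrow> \<bar>pdiff b f w\<bar> \<le> B" and r: "real DIM('a) * norm (y - x) \<le> r"
  shows "\<bar>f y - f x\<bar> \<le> real DIM('a) * (B * norm (y - x))"
proof -
  define c where "c b = (y - x) \<bullet> b" for b
  have c: "\<bar>c b\<bar> \<le> norm (y - x)" if "b \<in> Basis" for b using that by (simp add: c_def Basis_le_norm)
  have part: "norm (\<Sum>b\<in>A. c b *\<^sub>R b) \<le> real (card A) * norm (y - x)" if "A \<subseteq> Basis" for A
  proof -
    have "norm (\<Sum>b\<in>A. c b *\<^sub>R b) \<le> (\<Sum>b\<in>A. norm (y - x))"
      by (rule sum_norm_le) (use that c in auto)
    then show ?thesis by simp
  qed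
  have "\<bar>f (x + (\<Sum>b\<in>A. c b *\<^sub>R b)) - f x\<bar> \<le> real (card A) * (B * norm (y - x))" if "finite A" "A \<subseteq> Basis" for A
    using that
  proof (induction A rule: finite_induct)
    case (insert b A)
    let ?p = "x + (\<Sum>b\<in>A. c b *\<^sub>R b)"
    have b: "b \<in> Basis" and A: "A \<subseteq> Basis" using insert.prems by auto
    have inb: "?p + t *\<^sub>R b \<in> cball x r" if "\<bar>t - 0\<bar> \<le> \<bar>c b - 0\<bar>" for t
    proof -
      have "norm ((\<Sum>b\<in>A. c b *\<^sub>R b) + t *\<^sub>R b) \<le> norm (\<Sum>b\<in>A. c b *\<^sub>R b) + norm (t *\<^sub>R b)"
        by (rule norm_triangle_ineq)
      also have "\<dots> \<le> real (card A) * norm (y - x) + norm (y - x)"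
        using part[OF A] that c[OF b] b by (intro add_mono) auto
      also have "\<dots> = real (card (insert b A)) * norm (y - x)" using insert.hyps by (simp add: algebra_simps)
      also have "\<dots> \<le> real DIM('a) * norm (y - x)"
        using card_mono[OF finite_Basis insert.prems] by (intro mult_right_mono) auto
      finally have "norm ((\<Sum>b\<in>A. c b *\<^sub>R b) + t *\<^sub>R b) \<le> r" using r by simp
      then have "dist (x + ((\<Sum>b\<in>A. c b *\<^sub>R b) + t *\<^sub>R b)) x \<le> r" by (simp add: dist_norm)
      then show ?thesis by (simp add: dist_commute add.assoc)
    qed
    obtain \<xi> where \<xi>: "\<bar>\<xi> - 0\<bar> \<le> \<bar>c b - 0\<bar>" "f (?p + c b *\<^sub>R b) - f (?p + 0 *\<^sub>R b) = (c b - 0) * pdiff b f (?p + \<xi> *\<^sub>R b)"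
      by (rule mean_value_between[of 0 "c b" "\<lambda>t. f (?p + t *\<^sub>R b)" "\<lambda>t. pdiff b f (?p + t *\<^sub>R b)"])
         (use smooth_along_DERIV[OF f b] inb S in blast)+
    have "\<bar>f (?p + c b *\<^sub>R b) - f ?p\<bar> = \<bar>c b\<bar> * \<bar>pdiff b f (?p + \<xi> *\<^sub>R b)\<bar>" using \<xi>(2) by (simp add: abs_mult)
    also have "\<dots> \<le> norm (y - x) * B"
      by (intro mult_mono c[OF b] B[OF inb[OF \<xi>(1)] b]) auto
    finally have "\<bar>f (?p + c b *\<^sub>R b) - f ?p\<bar> \<le> B * norm (y - x)" by (simp add: mult.commute)
    moreover have "x + (\<Sum>b\<in>insert b A. c b *\<^sub>R b) = ?p + c b *\<^sub>R b" using insert.hyps by (simp add: algebra_simps)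
    ultimately show ?case using insert.IH[OF A] insert.hyps by (simp add: algebra_simps)
  qed simp
  from this[OF finite_Basis] have "\<bar>f (x + (y - x)) - f x\<bar> \<le> real DIM('a) * (B * norm (y - x))"
    by (simp only: c_def euclidean_representation)
  then show ?thesis by simp
qed

section \<open>Nets, their classes and their boundary values\<close>

lemma sup_bigo_lincomb:
  assumes "sup_bigo K f h" "sup_bigo K g h"
  shows "sup_bigo K (\<lambda>\<epsilon> x. c * f \<epsilon> x + d * g \<epsilon> x) h"
proof -
  obtain A B where A: "\<forall>\<^sub>F \<epsilon> in at_right 0. \<forall>x\<in>K. \<bar>f \<epsilon> x\<bar> \<le> A * h \<epsilon>"
    and B: "\<forall>\<^sub>F \<epsilon> in at_right 0. \<forall>x\<in>K. \<bar>g \<epsilon> x\<bar> \<le> B * h \<epsilon>"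
    using assms unfolding sup_bigo_def by blast
  have "\<forall>\<^sub>F \<epsilon> in at_right 0. \<forall>x\<in>K. \<bar>c * f \<epsilon> x + d * g \<epsilon> x\<bar> \<le> (\<bar>c\<bar> * A + \<bar>d\<bar> * B) * h \<epsilon>"
    using A B
  proof eventually_elim
    case (elim \<epsilon>)
    show ?case
    proof
      fix x assume x: "x \<in> K"
      have "\<bar>c * f \<epsilon> x + d * g \<epsilon> x\<bar> \<le> \<bar>c\<bar> * \<bar>f \<epsilon> x\<bar> + \<bar>d\<bar> * \<bar>g \<epsilon> x\<bar>"
        by (metis abs_mult abs_triangle_ineq)
      also have "\<dots> \<le> \<bar>c\<bar> * (A * h \<epsilon>) + \<bar>d\<bar> * (B * h \<epsilon>)"
        using elim x by (intro add_mono mult_left_mono) auto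
      finally show "\<bar>c * f \<epsilon> x + d * g \<epsilon> x\<bar> \<le> (\<bar>c\<bar> * A + \<bar>d\<bar> * B) * h \<epsilon>" by (simp add: algebra_simps)
    qed
  qed
  then show ?thesis unfolding sup_bigo_def by blast
qed

lemma sup_bigo_cong:
  assumes "\<And>\<epsilon> x. \<lbrakk>\<epsilon> \<in> {0<..1}; x \<in> K\<rbrakk> \<Longrightarrow> f \<epsilon> x = g \<epsilon> x"
  shows "sup_bigo K f h \<longleftrightarrow> sup_bigo K g h"
proof -
  have "sup_bigo K f h \<Longrightarrow> sup_bigo K g h" if eq: "\<And>\<epsilon> x. \<lbrakk>\<epsilon> \<in> {0<..1}; x \<in> K\<rbrakk> \<Longrightarrow> f \<epsilon> x = g \<epsilon> x" for f g :: "'a net"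
  proof -
    assume "sup_bigo K f h"
    then obtain C where "\<forall>\<^sub>F \<epsilon> in at_right 0. \<forall>x\<in>K. \<bar>f \<epsilon> x\<bar> \<le> C * h \<epsilon>" unfolding sup_bigo_def by blast
    then have "\<forall>\<^sub>F \<epsilon> in at_right 0. \<forall>x\<in>K. \<bar>g \<epsilon> x\<bar> \<le> C * h \<epsilon>"
      using eventually_at_right_0_less[of 1, simplified] by eventually_elim (use eq in auto)
    then show "sup_bigo K g h" unfolding sup_bigo_def by blast
  qed
  then show ?thesis using assms by metis
qed

lemma sup_bigo_mono:
  assumes "sup_bigo K f (\<lambda>\<epsilon>. 1 / \<epsilon> ^ m)" "m \<le> (n::nat)"
  shows "sup_bigo K f (\<lambda>\<epsilon>. 1 / \<epsilon> ^ n)"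
proof -
  obtain C where "\<forall>\<^sub>F \<epsilon> in at_right 0. \<forall>x\<in>K. \<bar>f \<epsilon> x\<bar> \<le> C * (1 / \<epsilon> ^ m)" using assms unfolding sup_bigo_def by blast
  then have "\<forall>\<^sub>F \<epsilon> in at_right 0. \<forall>x\<in>K. \<bar>f \<epsilon> x\<bar> \<le> \<bar>C\<bar> * (1 / \<epsilon> ^ n)"
    using eventually_at_right_0_less[of 1, simplified]
  proof eventually_elim
    case (elim \<epsilon>)
    have "C * (1 / \<epsilon> ^ m) \<le> \<bar>C\<bar> * (1 / \<epsilon> ^ n)"
      using elim assms(2) by (intro mult_mono inverse_power_mono) auto
    then show ?case using elim by (meson order_trans)
  qed
  then show ?thesis unfolding sup_bigo_def by blast
qed

lemma sup_bigo_imp_bound: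
  assumes "sup_bigo K f (\<lambda>\<epsilon>. 1 / \<epsilon> ^ N)"
  shows "\<forall>\<^sub>F \<epsilon> in at_right 0. \<forall>x\<in>K. \<bar>f \<epsilon> x\<bar> \<le> 1 / \<epsilon> ^ Suc N"
proof -
  obtain C where C: "\<forall>\<^sub>F \<epsilon> in at_right 0. \<forall>x\<in>K. \<bar>f \<epsilon> x\<bar> \<le> C * (1 / \<epsilon> ^ N)" using assms unfolding sup_bigo_def by blast
  from C eventually_const_times_le_1[of C] show ?thesis
  proof eventually_elim
    case (elim \<epsilon>)
    then have "C \<le> 1 / \<epsilon>" by (simp add: pos_le_divide_eq)
    then have "C * (1 / \<epsilon> ^ N) \<le> 1 / \<epsilon> * (1 / \<epsilon> ^ N)" using elim by (intro mult_right_mono) auto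
    then show ?case using elim by (auto intro: order_trans)
  qed
qed

text \<open>
  The condition on a single derivative in the definition of negligible nets, with the constant absorbed
  into an additional power of \<open>\<epsilon>\<close>.
\<close>

definition negligible_on :: "'a set \<Rightarrow> 'a net \<Rightarrow> bool" where
  "negligible_on K f \<longleftrightarrow> (\<forall>m::nat. \<forall>\<^sub>F \<epsilon> in at_right 0. \<forall>x\<in>K. \<bar>f \<epsilon> x\<bar> \<le> \<epsilon> ^ m)"

lemma negligible_on_iff: "negligible_on K f \<longleftrightarrow> (\<forall>m::nat. sup_bigo K f (\<lambda>\<epsilon>. \<epsilon> ^ m))"
proof
  assume "negligible_on K f"
  then show "\<forall>m::nat. sup_bigo K f (\<lambda>\<epsilon>. \<epsilon> ^ m)"
    unfolding negligible_on_def sup_bigo_def by (intro allI exI[of _ 1]) simp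
next
  assume *: "\<forall>m::nat. sup_bigo K f (\<lambda>\<epsilon>. \<epsilon> ^ m)"
  show "negligible_on K f" unfolding negligible_on_def
  proof
    fix m :: nat
    obtain C where C: "\<forall>\<^sub>F \<epsilon> in at_right 0. \<forall>x\<in>K. \<bar>f \<epsilon> x\<bar> \<le> C * \<epsilon> ^ Suc m" using * unfolding sup_bigo_def by blast
    from C eventually_const_times_le_1[of C] show "\<forall>\<^sub>F \<epsilon> in at_right 0. \<forall>x\<in>K. \<bar>f \<epsilon> x\<bar> \<le> \<epsilon> ^ m"
    proof eventually_elim
      case (elim \<epsilon>)
      then have "C * \<epsilon> \<le> 1" by simp
      then have "C * \<epsilon> ^ Suc m \<le> 1 * \<epsilon> ^ m"
        using elim mult_right_mono[of "C * \<epsilon>" 1 "\<epsilon> ^ m"] by (simp add: mult.assoc)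
      then show ?case using elim by (auto intro: order_trans)
    qed
  qed
qed

lemma moderateD:
  assumes "u \<in> moderate \<Omega> D"
  shows "\<epsilon> \<in> {0<..1} \<Longrightarrow> u \<epsilon> \<in> cinf \<Omega> D"
    and "\<lbrakk>compact K; K \<subseteq> D; bs \<in> lists Basis\<rbrakk> \<Longrightarrow>
      \<exists>N::nat. sup_bigo K (\<lambda>\<epsilon>. pdbar \<Omega> bs (u \<epsilon>)) (\<lambda>\<epsilon>. 1 / \<epsilon> ^ N)"
proof -
  note * = assms[unfolded moderate_def mem_Collect_eq]
  show "\<epsilon> \<in> {0<..1} \<Longrightarrow> u \<epsilon> \<in> cinf \<Omega> D" by (rule bspec[OF conjunct1[OF *]])
  show "\<lbrakk>compact K; K \<subseteq> D; bs \<in> lists Basis\<rbrakk> \<Longrightarrow>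
      \<exists>N::nat. sup_bigo K (\<lambda>\<epsilon>. pdbar \<Omega> bs (u \<epsilon>)) (\<lambda>\<epsilon>. 1 / \<epsilon> ^ N)"
    by (rule conjunct2[OF *, rule_format]) (rule conjI)
qed

lemma negligible_netsD:
  assumes "u \<in> negligible_nets \<Omega> D"
  shows "\<epsilon> \<in> {0<..1} \<Longrightarrow> u \<epsilon> \<in> cinf \<Omega> D"
    and "\<lbrakk>compact K; K \<subseteq> D; bs \<in> lists Basis\<rbrakk> \<Longrightarrow>
      sup_bigo K (\<lambda>\<epsilon>. pdbar \<Omega> bs (u \<epsilon>)) (\<lambda>\<epsilon>. \<epsilon> ^ m)"
proof -
  note * = assms[unfolded negligible_nets_def mem_Collect_eq]
  show "\<epsilon> \<in> {0<..1} \<Longrightarrow> u \<epsilon> \<in> cinf \<Omega> D" by (rule bspec[OF conjunct1[OF *]])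
  show "\<lbrakk>compact K; K \<subseteq> D; bs \<in> lists Basis\<rbrakk> \<Longrightarrow>
      sup_bigo K (\<lambda>\<epsilon>. pdbar \<Omega> bs (u \<epsilon>)) (\<lambda>\<epsilon>. \<epsilon> ^ m)"
    by (rule conjunct2[OF *, rule_format]) (rule conjI)
qed

lemma closure_nontrivial_limit:
  fixes \<Omega> :: "'a::euclidean_space set"
  assumes "open \<Omega>" "x \<in> closure \<Omega>"
  shows "at x within \<Omega> \<noteq> bot"
  using assms interior_limit_point[of x \<Omega>] by (cases "x \<in> \<Omega>") (auto simp: trivial_limit_within closure_def interior_open)

text \<open>
  On functions in \<open>C\<^sup>\<infinity>(D)\<close> the derivative \<open>pdbar\<close> is given on all of \<open>D\<close> by one formula, a limit from
  within \<open>\<Omega>\<close>.  Linearity of \<open>pdbar\<close> and estimates for it up to the boundary are consequences.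
\<close>

lemma pdbar_tendsto:
  fixes \<Omega> :: "'a::euclidean_space set"
  assumes \<Omega>: "open \<Omega>" and D: "\<Omega> \<subseteq> D" "D \<subseteq> closure \<Omega>" and f: "f \<in> cinf \<Omega> D"
    and bs: "bs \<in> lists Basis" and x: "x \<in> D"
  shows "(pdiffs bs f \<longlongrightarrow> pdbar \<Omega> bs f x) (at x within \<Omega>)"
proof -
  obtain g where g: "continuous_on D g" "\<And>x. x \<in> \<Omega> \<Longrightarrow> g x = pdiffs bs f x"
    using f bs unfolding cinf_def by blast
  have "(g \<longlongrightarrow> g x) (at x within D)" using g(1) x by (simp add: continuous_on_def)
  then have "(g \<longlongrightarrow> g x) (at x within \<Omega>)" using D(1) by (rule tendsto_within_subset)
  then have l: "(pdiffs bs f \<longlongrightarrow> g x) (at x within \<Omega>)"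
    by (rule Lim_transform_eventually) (auto simp: eventually_at_filter g(2))
  moreover have "pdbar \<Omega> bs f x = g x"
    using tendsto_Lim[OF closure_nontrivial_limit[OF \<Omega>] l] x D(2) g(2) by (auto simp: pdbar_def)
  ultimately show ?thesis by simp
qed

lemma cinf_lincomb:
  fixes \<Omega> :: "'a::euclidean_space set"
  assumes \<Omega>: "open \<Omega>" and f: "f \<in> cinf \<Omega> D" and g: "g \<in> cinf \<Omega> D"
  shows "(\<lambda>x. c * f x + d * g x) \<in> cinf \<Omega> D"
proof -
  have s: "smooth_along Basis \<Omega> f" "smooth_along Basis \<Omega> g" using f g by (auto simp: cinf_def)
  have "\<exists>h. continuous_on D h \<and> (\<forall>x\<in>\<Omega>. h x = pdiffs bs (\<lambda>x. c * f x + d * g x) x)"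
    if bs: "bs \<in> lists Basis" for bs
  proof -
    obtain f' where f': "continuous_on D f'" "\<And>x. x \<in> \<Omega> \<Longrightarrow> f' x = pdiffs bs f x"
      using f bs unfolding cinf_def by blast
    obtain g' where g': "continuous_on D g'" "\<And>x. x \<in> \<Omega> \<Longrightarrow> g' x = pdiffs bs g x"
      using g bs unfolding cinf_def by blast
    show ?thesis
    proof (intro exI conjI ballI)
      show "continuous_on D (\<lambda>x. c * f' x + d * g' x)" by (intro continuous_intros f' g')
      fix x assume "x \<in> \<Omega>"
      then show "c * f' x + d * g' x = pdiffs bs (\<lambda>x. c * f x + d * g x) x"
        using pdiffs_lincomb[OF \<Omega> s bs] f' g' by simp
    qed
  qed
  moreover have "continuous_on D (\<lambda>x. c * f x + d * g x)"
    using f g by (intro continuous_intros) (auto simp: cinf_def)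
  ultimately show ?thesis using smooth_along_lincomb[OF \<Omega> s] by (simp add: cinf_def)
qed

lemma pdbar_lincomb:
  fixes \<Omega> :: "'a::euclidean_space set"
  assumes \<Omega>: "open \<Omega>" and D: "\<Omega> \<subseteq> D" "D \<subseteq> closure \<Omega>" and f: "f \<in> cinf \<Omega> D" and g: "g \<in> cinf \<Omega> D"
    and bs: "bs \<in> lists Basis" and x: "x \<in> D"
  shows "pdbar \<Omega> bs (\<lambda>x. c * f x + d * g x) x = c * pdbar \<Omega> bs f x + d * pdbar \<Omega> bs g x"
proof (rule tendsto_unique)
  have s: "smooth_along Basis \<Omega> f" "smooth_along Basis \<Omega> g" using f g by (auto simp: cinf_def)
  show "at x within \<Omega> \<noteq> bot" using closure_nontrivial_limit[OF \<Omega>] x D by blast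
  show "(pdiffs bs (\<lambda>x. c * f x + d * g x) \<longlongrightarrow> pdbar \<Omega> bs (\<lambda>x. c * f x + d * g x) x) (at x within \<Omega>)"
    by (rule pdbar_tendsto[OF \<Omega> D cinf_lincomb[OF \<Omega> f g] bs x])
  have "((\<lambda>x. c * pdiffs bs f x + d * pdiffs bs g x) \<longlongrightarrow> c * pdbar \<Omega> bs f x + d * pdbar \<Omega> bs g x) (at x within \<Omega>)"
    by (intro tendsto_intros pdbar_tendsto[OF \<Omega> D _ bs x] f g)
  then show "(pdiffs bs (\<lambda>x. c * f x + d * g x) \<longlongrightarrow> c * pdbar \<Omega> bs f x + d * pdbar \<Omega> bs g x) (at x within \<Omega>)"
    by (rule Lim_transform_eventually) (auto simp: eventually_at_filter pdiffs_lincomb[OF \<Omega> s bs])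
qed

lemma moderate_lincomb:
  fixes \<Omega> :: "'a::euclidean_space set"
  assumes \<Omega>: "open \<Omega>" and D: "\<Omega> \<subseteq> D" "D \<subseteq> closure \<Omega>" and u: "u \<in> moderate \<Omega> D" and v: "v \<in> moderate \<Omega> D"
  shows "(\<lambda>\<epsilon> x. c * u \<epsilon> x + d * v \<epsilon> x) \<in> moderate \<Omega> D"
  unfolding moderate_def mem_Collect_eq
proof (intro conjI ballI allI impI)
  have uc: "u \<epsilon> \<in> cinf \<Omega> D" and vc: "v \<epsilon> \<in> cinf \<Omega> D" if "\<epsilon> \<in> {0<..1}" for \<epsilon>
    using u v that by (auto simp: moderate_def)
  show "(\<lambda>x. c * u \<epsilon> x + d * v \<epsilon> x) \<in> cinf \<Omega> D" if "\<epsilon> \<in> {0<..1}" for \<epsilon>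
    using cinf_lincomb[OF \<Omega> uc vc] that by blast
  fix K bs assume K: "compact K \<and> K \<subseteq> D" and bs: "bs \<in> lists (Basis :: 'a set)"
  obtain m n :: nat where "sup_bigo K (\<lambda>\<epsilon>. pdbar \<Omega> bs (u \<epsilon>)) (\<lambda>\<epsilon>. 1 / \<epsilon> ^ m)"
    "sup_bigo K (\<lambda>\<epsilon>. pdbar \<Omega> bs (v \<epsilon>)) (\<lambda>\<epsilon>. 1 / \<epsilon> ^ n)"
    using moderateD(2)[OF u _ _ bs] moderateD(2)[OF v _ _ bs] K by blast
  then have "sup_bigo K (\<lambda>\<epsilon> x. c * pdbar \<Omega> bs (u \<epsilon>) x + d * pdbar \<Omega> bs (v \<epsilon>) x) (\<lambda>\<epsilon>. 1 / \<epsilon> ^ (m + n))"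
    by (intro sup_bigo_lincomb) (auto elim: sup_bigo_mono)
  moreover have "sup_bigo K (\<lambda>\<epsilon> x. c * pdbar \<Omega> bs (u \<epsilon>) x + d * pdbar \<Omega> bs (v \<epsilon>) x) h
      \<longleftrightarrow> sup_bigo K (\<lambda>\<epsilon>. pdbar \<Omega> bs (\<lambda>x. c * u \<epsilon> x + d * v \<epsilon> x)) h" for h
    by (rule sup_bigo_cong, rule pdbar_lincomb[OF \<Omega> D uc vc bs, symmetric]) (use K in auto)
  ultimately show "\<exists>N. sup_bigo K (\<lambda>\<epsilon>. pdbar \<Omega> bs (\<lambda>x. c * u \<epsilon> x + d * v \<epsilon> x)) (\<lambda>\<epsilon>. 1 / \<epsilon> ^ N)"
    by blast
qed

lemma negligible_nets_lincomb:
  fixes \<Omega> :: "'a::euclidean_space set"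
  assumes \<Omega>: "open \<Omega>" and D: "\<Omega> \<subseteq> D" "D \<subseteq> closure \<Omega>"
    and u: "u \<in> negligible_nets \<Omega> D" and v: "v \<in> negligible_nets \<Omega> D"
  shows "(\<lambda>\<epsilon> x. c * u \<epsilon> x + d * v \<epsilon> x) \<in> negligible_nets \<Omega> D"
  unfolding negligible_nets_def mem_Collect_eq
proof (intro conjI ballI allI impI)
  have uc: "u \<epsilon> \<in> cinf \<Omega> D" and vc: "v \<epsilon> \<in> cinf \<Omega> D" if "\<epsilon> \<in> {0<..1}" for \<epsilon>
    using u v that by (auto simp: negligible_nets_def)
  show "(\<lambda>x. c * u \<epsilon> x + d * v \<epsilon> x) \<in> cinf \<Omega> D" if "\<epsilon> \<in> {0<..1}" for \<epsilon>
    using cinf_lincomb[OF \<Omega> uc vc] that by blast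
  fix K bs and m :: nat assume K: "compact K \<and> K \<subseteq> D" and bs: "bs \<in> lists (Basis :: 'a set)"
  have "sup_bigo K (\<lambda>\<epsilon>. pdbar \<Omega> bs (u \<epsilon>)) (\<lambda>\<epsilon>. \<epsilon> ^ m)"
    "sup_bigo K (\<lambda>\<epsilon>. pdbar \<Omega> bs (v \<epsilon>)) (\<lambda>\<epsilon>. \<epsilon> ^ m)"
    using negligible_netsD(2)[OF u _ _ bs] negligible_netsD(2)[OF v _ _ bs] K by blast+
  then have "sup_bigo K (\<lambda>\<epsilon> x. c * pdbar \<Omega> bs (u \<epsilon>) x + d * pdbar \<Omega> bs (v \<epsilon>) x) (\<lambda>\<epsilon>. \<epsilon> ^ m)"
    by (rule sup_bigo_lincomb)
  moreover have "sup_bigo K (\<lambda>\<epsilon> x. c * pdbar \<Omega> bs (u \<epsilon>) x + d * pdbar \<Omega> bs (v \<epsilon>) x) h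
      \<longleftrightarrow> sup_bigo K (\<lambda>\<epsilon>. pdbar \<Omega> bs (\<lambda>x. c * u \<epsilon> x + d * v \<epsilon> x)) h" for h
    by (rule sup_bigo_cong, rule pdbar_lincomb[OF \<Omega> D uc vc bs, symmetric]) (use K in auto)
  ultimately show "sup_bigo K (\<lambda>\<epsilon>. pdbar \<Omega> bs (\<lambda>x. c * u \<epsilon> x + d * v \<epsilon> x)) (\<lambda>\<epsilon>. \<epsilon> ^ m)"
    by blast
qed

lemma boundary_chart_along:
  assumes C: "boundary_chart \<Omega> U V \<Phi> \<Psi> e" and b: "b \<in> Basis - {e}" and y: "y \<in> {y \<in> V. y \<bullet> e = 0}"
  shows "\<forall>\<^sub>F t in nhds 0. y + t *\<^sub>R b \<in> {y \<in> V. y \<bullet> e = 0}"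
proof -
  have "open V" "e \<in> Basis" using C by (auto simp: boundary_chart_def)
  then have "\<forall>\<^sub>F t in nhds 0. y + t *\<^sub>R b \<in> V" "b \<bullet> e = 0"
    using y b eventually_line_in_open[of V y b] inner_not_same_Basis[of b e] by auto
  then show ?thesis using y by (auto simp: inner_add_left elim: eventually_mono)
qed

text \<open>
  In a chart, a function on the boundary is differentiated after composition with the inverse chart,
  whose values on the hyperplane lie on the boundary.  Thus the class of a function in
  \<open>\<G>(\<partial>\<Omega>)\<close> depends on its values on the boundary only, which is the content of
  \<open>bd_rel_class_cong\<close>.
\<close>

lemma boundary_chart_eq:
  assumes C: "boundary_chart \<Omega> U V \<Phi> \<Psi> e" and eq: "\<And>x. x \<in> frontier \<Omega> \<Longrightarrow> f x = g x"
    and y: "y \<in> {y \<in> V. y \<bullet> e = 0}"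
  shows "(f \<circ> \<Psi>) y = (g \<circ> \<Psi>) y"
proof -
  have "\<Phi> ` (U \<inter> frontier \<Omega>) = {y \<in> V. y \<bullet> e = 0}" using C by (simp add: boundary_chart_def)
  then have "y \<in> \<Phi> ` (U \<inter> frontier \<Omega>)" using y by simp
  then obtain x where x: "x \<in> U" "x \<in> frontier \<Omega>" "y = \<Phi> x" by blast
  then have "\<Psi> y = x" using C by (auto simp: boundary_chart_def homeomorphism_def)
  then show ?thesis using eq x by simp
qed

lemma bd_cinf_cong:
  assumes "\<And>x. x \<in> frontier \<Omega> \<Longrightarrow> f x = g x" "f \<in> bd_cinf \<Omega>"
  shows "g \<in> bd_cinf \<Omega>"
  unfolding bd_cinf_def mem_Collect_eq
proof (intro allI impI)
  fix U V \<Phi> \<Psi> e assume C: "boundary_chart \<Omega> U V \<Phi> \<Psi> e"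
  have "smooth_along (Basis - {e}) {y \<in> V. y \<bullet> e = 0} (f \<circ> \<Psi>)"
    using assms(2) C unfolding bd_cinf_def by blast
  then show "smooth_along (Basis - {e}) {y \<in> V. y \<bullet> e = 0} (g \<circ> \<Psi>)"
    by (rule smooth_along_cong_along[rotated 2])
       (rule boundary_chart_along[OF C] boundary_chart_eq[OF C] assms(1) | assumption)+
qed

lemma bd_sup_bigo_cong:
  assumes C: "boundary_chart \<Omega> U V \<Phi> \<Psi> e" and eq: "\<And>\<epsilon> x. \<lbrakk>\<epsilon> \<in> {0<..1}; x \<in> frontier \<Omega>\<rbrakk> \<Longrightarrow> f \<epsilon> x = g \<epsilon> x"
    and K: "K \<subseteq> {y \<in> V. y \<bullet> e = 0}" and bs: "bs \<in> lists (Basis - {e})"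
  shows "sup_bigo K (\<lambda>\<epsilon>. pdiffs bs (f \<epsilon> \<circ> \<Psi>)) h \<longleftrightarrow> sup_bigo K (\<lambda>\<epsilon>. pdiffs bs (g \<epsilon> \<circ> \<Psi>)) h"
proof (rule sup_bigo_cong)
  fix \<epsilon> :: real and y assume \<epsilon>: "\<epsilon> \<in> {0<..1}" and y: "y \<in> K"
  show "pdiffs bs (f \<epsilon> \<circ> \<Psi>) y = pdiffs bs (g \<epsilon> \<circ> \<Psi>) y"
    by (rule pdiffs_cong_along[OF boundary_chart_along[OF C] boundary_chart_eq[OF C eq[OF \<epsilon>]] bs])
       (use y K in auto)
qed

lemma bd_moderate_cong:
  assumes eq: "\<And>\<epsilon> x. \<lbrakk>\<epsilon> \<in> {0<..1}; x \<in> frontier \<Omega>\<rbrakk> \<Longrightarrow> f \<epsilon> x = g \<epsilon> x" and f: "f \<in> bd_moderate \<Omega>"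
  shows "g \<in> bd_moderate \<Omega>"
  unfolding bd_moderate_def mem_Collect_eq
proof (intro conjI ballI allI impI)
  show "g \<epsilon> \<in> bd_cinf \<Omega>" if "\<epsilon> \<in> {0<..1}" for \<epsilon>
    by (rule bd_cinf_cong[OF eq[OF that]]) (use f that in \<open>auto simp: bd_moderate_def\<close>)
  fix U V \<Phi> \<Psi> e K bs
  assume C: "boundary_chart \<Omega> U V \<Phi> \<Psi> e \<and> compact K \<and> K \<subseteq> {y \<in> V. y \<bullet> e = 0}"
    and bs: "bs \<in> lists (Basis - {e})"
  have iff: "sup_bigo K (\<lambda>\<epsilon>. pdiffs bs (f \<epsilon> \<circ> \<Psi>)) h \<longleftrightarrow> sup_bigo K (\<lambda>\<epsilon>. pdiffs bs (g \<epsilon> \<circ> \<Psi>)) h" for h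
    by (rule bd_sup_bigo_cong[of \<Omega> U V \<Phi> \<Psi> e f g]) (use C bs eq in auto)
  obtain N where "sup_bigo K (\<lambda>\<epsilon>. pdiffs bs (f \<epsilon> \<circ> \<Psi>)) (\<lambda>\<epsilon>. 1 / \<epsilon> ^ N)"
    using conjunct2[OF f[unfolded bd_moderate_def mem_Collect_eq], rule_format, OF C bs] by blast
  then show "\<exists>N. sup_bigo K (\<lambda>\<epsilon>. pdiffs bs (g \<epsilon> \<circ> \<Psi>)) (\<lambda>\<epsilon>. 1 / \<epsilon> ^ N)"
    using iff by blast
qed

lemma bd_negligible_cong:
  assumes eq: "\<And>\<epsilon> x. \<lbrakk>\<epsilon> \<in> {0<..1}; x \<in> frontier \<Omega>\<rbrakk> \<Longrightarrow> f \<epsilon> x = g \<epsilon> x" and f: "f \<in> bd_negligible \<Omega>"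
  shows "g \<in> bd_negligible \<Omega>"
  unfolding bd_negligible_def mem_Collect_eq
proof (intro conjI ballI allI impI)
  show "g \<epsilon> \<in> bd_cinf \<Omega>" if "\<epsilon> \<in> {0<..1}" for \<epsilon>
    by (rule bd_cinf_cong[OF eq[OF that]]) (use f that in \<open>auto simp: bd_negligible_def\<close>)
  fix U V \<Phi> \<Psi> e K bs and m :: nat
  assume C: "boundary_chart \<Omega> U V \<Phi> \<Psi> e \<and> compact K \<and> K \<subseteq> {y \<in> V. y \<bullet> e = 0}"
    and bs: "bs \<in> lists (Basis - {e})"
  have iff: "sup_bigo K (\<lambda>\<epsilon>. pdiffs bs (f \<epsilon> \<circ> \<Psi>)) h \<longleftrightarrow> sup_bigo K (\<lambda>\<epsilon>. pdiffs bs (g \<epsilon> \<circ> \<Psi>)) h" for h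
    by (rule bd_sup_bigo_cong[of \<Omega> U V \<Phi> \<Psi> e f g]) (use C bs eq in auto)
  have "sup_bigo K (\<lambda>\<epsilon>. pdiffs bs (f \<epsilon> \<circ> \<Psi>)) (\<lambda>\<epsilon>. \<epsilon> ^ m)"
    using conjunct2[OF f[unfolded bd_negligible_def mem_Collect_eq], rule_format, OF C bs] by blast
  then show "sup_bigo K (\<lambda>\<epsilon>. pdiffs bs (g \<epsilon> \<circ> \<Psi>)) (\<lambda>\<epsilon>. \<epsilon> ^ m)"
    using iff by blast
qed

lemma bd_rel_class_cong:
  assumes eq: "\<And>\<epsilon> x. \<lbrakk>\<epsilon> \<in> {0<..1}; x \<in> frontier \<Omega>\<rbrakk> \<Longrightarrow> f \<epsilon> x = g \<epsilon> x"
  shows "bd_rel \<Omega> `` {f} = bd_rel \<Omega> `` {g}"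
proof -
  have "bd_rel \<Omega> `` {f} \<subseteq> bd_rel \<Omega> `` {g}"
    if eq: "\<And>\<epsilon> x. \<lbrakk>\<epsilon> \<in> {0<..1}; x \<in> frontier \<Omega>\<rbrakk> \<Longrightarrow> f \<epsilon> x = g \<epsilon> x" for f g
  proof
    fix w assume "w \<in> bd_rel \<Omega> `` {f}"
    then have w: "f \<in> bd_moderate \<Omega>" "w \<in> bd_moderate \<Omega>" "(\<lambda>\<epsilon> x. f \<epsilon> x - w \<epsilon> x) \<in> bd_negligible \<Omega>"
      by (auto simp: bd_rel_def net_rel_def)
    have "g \<in> bd_moderate \<Omega>" by (rule bd_moderate_cong[OF eq w(1)])
    moreover have "(\<lambda>\<epsilon> x. g \<epsilon> x - w \<epsilon> x) \<in> bd_negligible \<Omega>"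
      by (rule bd_negligible_cong[OF _ w(3)]) (simp add: eq)
    ultimately show "w \<in> bd_rel \<Omega> `` {g}" using w by (auto simp: bd_rel_def net_rel_def)
  qed
  from this[of f g] this[of g f] eq show ?thesis by (simp add: subset_antisym)
qed

text \<open>
  The representatives of the perturbed class are the perturbations of the representatives, and
  corresponding representatives agree on the boundary.
\<close>

lemma bd_restrict_perturb:
  fixes \<Omega> :: "'a::euclidean_space set"
  assumes \<Omega>: "open \<Omega>" and v: "v \<in> moderate \<Omega> (closure \<Omega>)" and \<psi>: "\<psi> \<in> moderate \<Omega> (closure \<Omega>)"
    and 0: "\<And>\<epsilon> x. \<lbrakk>\<epsilon> \<in> {0<..1}; x \<in> frontier \<Omega>\<rbrakk> \<Longrightarrow> \<psi> \<epsilon> x = 0"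
  shows "bd_restrict \<Omega> (colombeau_rel \<Omega> (closure \<Omega>) `` {\<lambda>\<epsilon> x. v \<epsilon> x + \<psi> \<epsilon> x})
    = bd_restrict \<Omega> (colombeau_rel \<Omega> (closure \<Omega>) `` {v})"
proof -
  have "bd_restrict \<Omega> (colombeau_rel \<Omega> (closure \<Omega>) `` {v})
      \<subseteq> bd_restrict \<Omega> (colombeau_rel \<Omega> (closure \<Omega>) `` {\<lambda>\<epsilon> x. v \<epsilon> x + c * \<psi> \<epsilon> x})"
    if v: "v \<in> moderate \<Omega> (closure \<Omega>)" for v and c :: real
  proof
    fix z assume "z \<in> bd_restrict \<Omega> (colombeau_rel \<Omega> (closure \<Omega>) `` {v})"
    then obtain w where w: "w \<in> moderate \<Omega> (closure \<Omega>)"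
      "(\<lambda>\<epsilon> x. v \<epsilon> x - w \<epsilon> x) \<in> negligible_nets \<Omega> (closure \<Omega>)" "z \<in> bd_rel \<Omega> `` {w}"
      unfolding bd_restrict_def colombeau_rel_def net_rel_def by auto
    let ?w = "\<lambda>\<epsilon> x. w \<epsilon> x + c * \<psi> \<epsilon> x"
    have m: "(\<lambda>\<epsilon> x. u \<epsilon> x + c * \<psi> \<epsilon> x) \<in> moderate \<Omega> (closure \<Omega>)" if "u \<in> moderate \<Omega> (closure \<Omega>)" for u
      using moderate_lincomb[OF \<Omega> closure_subset order_refl that \<psi>, of 1 c] by simp
    have "(\<lambda>\<epsilon> x. (v \<epsilon> x + c * \<psi> \<epsilon> x) - ?w \<epsilon> x) \<in> negligible_nets \<Omega> (closure \<Omega>)"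
      using w(2) by simp
    then have "?w \<in> colombeau_rel \<Omega> (closure \<Omega>) `` {\<lambda>\<epsilon> x. v \<epsilon> x + c * \<psi> \<epsilon> x}"
      using m[OF v] m[OF w(1)] by (simp add: colombeau_rel_def net_rel_def)
    moreover have "bd_rel \<Omega> `` {?w} = bd_rel \<Omega> `` {w}"
      by (rule bd_rel_class_cong) (simp add: 0)
    ultimately show "z \<in> bd_restrict \<Omega> (colombeau_rel \<Omega> (closure \<Omega>) `` {\<lambda>\<epsilon> x. v \<epsilon> x + c * \<psi> \<epsilon> x})"
      using w(3) unfolding bd_restrict_def by blast
  qed
  note * = this
  have "(\<lambda>\<epsilon> x. v \<epsilon> x + \<psi> \<epsilon> x) \<in> moderate \<Omega> (closure \<Omega>)"
    using moderate_lincomb[OF \<Omega> closure_subset order_refl v \<psi>, of 1 1] by simp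
  from *[OF v, of 1] *[OF this, of "-1"] show ?thesis by (simp add: subset_antisym)
qed

text \<open>
  Derivatives of a function with compact support in \<open>\<Omega>\<close> extend by zero to the closure, and bounds on
  \<open>\<Omega>\<close> persist there because \<open>pdbar\<close> is a limit from within \<open>\<Omega>\<close>.
\<close>

lemma compact_support_moderate:
  fixes \<Omega> :: "'a::euclidean_space set"
  assumes \<Omega>: "open \<Omega>" and K: "compact K" "K \<subseteq> \<Omega>"
    and s: "\<And>\<epsilon>. \<epsilon> \<in> {0<..1} \<Longrightarrow> smooth_along Basis \<Omega> (\<psi> \<epsilon>)"
    and 0: "\<And>\<epsilon> x. \<lbrakk>\<epsilon> \<in> {0<..1}; x \<notin> K\<rbrakk> \<Longrightarrow> \<psi> \<epsilon> x = 0"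
    and B: "\<And>bs. bs \<in> lists Basis \<Longrightarrow> \<exists>N::nat. sup_bigo \<Omega> (\<lambda>\<epsilon>. pdiffs bs (\<psi> \<epsilon>)) (\<lambda>\<epsilon>. 1 / \<epsilon> ^ N)"
  shows "\<psi> \<in> moderate \<Omega> (closure \<Omega>)"
proof -
  have c: "\<psi> \<epsilon> \<in> cinf \<Omega> (closure \<Omega>)" if \<epsilon>: "\<epsilon> \<in> {0<..1}" for \<epsilon>
  proof -
    have ext: "continuous_on UNIV (\<lambda>x. if x \<in> \<Omega> then pdiffs bs (\<psi> \<epsilon>) x else 0)" if bs: "bs \<in> lists Basis" for bs
    proof (rule continuous_on_extend_zero[OF \<Omega> K smooth_along_continuous[OF smooth_along_pdiffs[OF s[OF \<epsilon>] bs]]])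
      fix x assume "x \<in> \<Omega> - K"
      then show "pdiffs bs (\<psi> \<epsilon>) x = 0"
        using pdiffs_vanish[OF \<Omega> compact_imp_closed[OF K(1)]] 0[OF \<epsilon>] by blast
    qed
    have "(\<lambda>x. if x \<in> \<Omega> then pdiffs [] (\<psi> \<epsilon>) x else 0) = \<psi> \<epsilon>"
      using 0[OF \<epsilon>] K by (auto simp: fun_eq_iff)
    then have "continuous_on UNIV (\<psi> \<epsilon>)" using ext[OF lists.Nil] by (simp only:)
    then have "continuous_on (closure \<Omega>) (\<psi> \<epsilon>)" using continuous_on_subset by blast
    moreover have "\<exists>g. continuous_on (closure \<Omega>) g \<and> (\<forall>x\<in>\<Omega>. g x = pdiffs bs (\<psi> \<epsilon>) x)" if "bs \<in> lists Basis" for bs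
      using continuous_on_subset[OF ext[OF that], of "closure \<Omega>"] by force
    ultimately show ?thesis using s[OF \<epsilon>] by (simp add: cinf_def)
  qed
  moreover have "\<exists>N::nat. sup_bigo K' (\<lambda>\<epsilon>. pdbar \<Omega> bs (\<psi> \<epsilon>)) (\<lambda>\<epsilon>. 1 / \<epsilon> ^ N)"
    if K': "K' \<subseteq> closure \<Omega>" and bs: "bs \<in> lists Basis" for K' bs
  proof -
    obtain N :: nat and C where "\<forall>\<^sub>F \<epsilon> in at_right 0. \<forall>x\<in>\<Omega>. \<bar>pdiffs bs (\<psi> \<epsilon>) x\<bar> \<le> C * (1 / \<epsilon> ^ N)"
      using B[OF bs] unfolding sup_bigo_def by blast
    then have "\<forall>\<^sub>F \<epsilon> in at_right 0. \<forall>x\<in>K'. \<bar>pdbar \<Omega> bs (\<psi> \<epsilon>) x\<bar> \<le> C * (1 / \<epsilon> ^ N)"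
      using eventually_at_right_0_less[of 1, simplified]
    proof eventually_elim
      case (elim \<epsilon>)
      show ?case
      proof
        fix x assume x: "x \<in> K'"
        then have xc: "x \<in> closure \<Omega>" using K' by blast
        have "((\<lambda>y. \<bar>pdiffs bs (\<psi> \<epsilon>) y\<bar>) \<longlongrightarrow> \<bar>pdbar \<Omega> bs (\<psi> \<epsilon>) x\<bar>) (at x within \<Omega>)"
          by (intro tendsto_rabs pdbar_tendsto[OF \<Omega> closure_subset order_refl c bs xc]) (use elim in auto)
        moreover have "\<forall>\<^sub>F y in at x within \<Omega>. \<bar>pdiffs bs (\<psi> \<epsilon>) y\<bar> \<le> C * (1 / \<epsilon> ^ N)"
          using elim by (auto simp: eventually_at_filter)
        ultimately show "\<bar>pdbar \<Omega> bs (\<psi> \<epsilon>) x\<bar> \<le> C * (1 / \<epsilon> ^ N)"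
          using tendsto_upperbound closure_nontrivial_limit[OF \<Omega> xc] by blast
      qed
    qed
    then show ?thesis unfolding sup_bigo_def by blast
  qed
  ultimately show ?thesis by (simp add: moderate_def)
qed

lemma cinf_self: "smooth_along Basis \<Omega> f \<Longrightarrow> f \<in> cinf \<Omega> \<Omega>"
  unfolding cinf_def using smooth_along_continuous smooth_along_pdiffs by blast

lemma negligible_class_eq_zero:
  fixes \<Omega> :: "'a::euclidean_space set"
  assumes \<Omega>: "open \<Omega>" and s: "\<And>\<epsilon>. \<epsilon> \<in> {0<..1} \<Longrightarrow> smooth_along Basis \<Omega> (e \<epsilon>)"
    and B: "\<And>bs. bs \<in> lists Basis \<Longrightarrow> \<exists>N::nat. sup_bigo \<Omega> (\<lambda>\<epsilon>. pdiffs bs (e \<epsilon>)) (\<lambda>\<epsilon>. 1 / \<epsilon> ^ N)"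
    and n: "\<And>K bs. \<lbrakk>compact K; K \<subseteq> \<Omega>; bs \<in> lists Basis\<rbrakk> \<Longrightarrow> negligible_on K (\<lambda>\<epsilon>. pdiffs bs (e \<epsilon>))"
  shows "colombeau_rel \<Omega> \<Omega> `` {e} = colombeau_zero \<Omega> \<Omega>"
proof -
  have pd: "sup_bigo K (\<lambda>\<epsilon>. pdbar \<Omega> bs (f \<epsilon>)) h \<longleftrightarrow> sup_bigo K (\<lambda>\<epsilon>. pdiffs bs (f \<epsilon>)) h" if "K \<subseteq> \<Omega>" for K bs f h
    by (rule sup_bigo_cong) (use that in \<open>auto simp: pdbar_def\<close>)
  have em: "e \<in> moderate \<Omega> \<Omega>"
    unfolding moderate_def mem_Collect_eq
  proof (intro conjI ballI allI impI)
    show "e \<epsilon> \<in> cinf \<Omega> \<Omega>" if "\<epsilon> \<in> {0<..1}" for \<epsilon> using cinf_self[OF s[OF that]] .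
    fix K bs assume K: "compact K \<and> K \<subseteq> \<Omega>" and bs: "bs \<in> lists (Basis :: 'a set)"
    obtain N :: nat where "sup_bigo \<Omega> (\<lambda>\<epsilon>. pdiffs bs (e \<epsilon>)) (\<lambda>\<epsilon>. 1 / \<epsilon> ^ N)" using B[OF bs] by blast
    then have "sup_bigo K (\<lambda>\<epsilon>. pdiffs bs (e \<epsilon>)) (\<lambda>\<epsilon>. 1 / \<epsilon> ^ N)"
      unfolding sup_bigo_def using K by (fast elim: eventually_mono)
    then show "\<exists>N. sup_bigo K (\<lambda>\<epsilon>. pdbar \<Omega> bs (e \<epsilon>)) (\<lambda>\<epsilon>. 1 / \<epsilon> ^ N)" using pd K by blast
  qed
  have en: "e \<in> negligible_nets \<Omega> \<Omega>"
    unfolding negligible_nets_def mem_Collect_eq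
    using cinf_self[OF s] n pd by (auto simp: negligible_on_iff)
  have 0: "(\<lambda>\<epsilon> x. 0) \<in> moderate \<Omega> \<Omega>" using moderate_lincomb[OF \<Omega> order_refl closure_subset em em, of 0 0] by simp
  have "(\<lambda>\<epsilon> x. e \<epsilon> x - w \<epsilon> x) \<in> negligible_nets \<Omega> \<Omega> \<longleftrightarrow> (\<lambda>\<epsilon> x. 0 - w \<epsilon> x) \<in> negligible_nets \<Omega> \<Omega>" for w
  proof
    assume "(\<lambda>\<epsilon> x. e \<epsilon> x - w \<epsilon> x) \<in> negligible_nets \<Omega> \<Omega>"
    from negligible_nets_lincomb[OF \<Omega> order_refl closure_subset this en, of 1 "-1"]
    show "(\<lambda>\<epsilon> x. 0 - w \<epsilon> x) \<in> negligible_nets \<Omega> \<Omega>" by simp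
  next
    assume "(\<lambda>\<epsilon> x. 0 - w \<epsilon> x) \<in> negligible_nets \<Omega> \<Omega>"
    from negligible_nets_lincomb[OF \<Omega> order_refl closure_subset this en, of 1 1]
    show "(\<lambda>\<epsilon> x. e \<epsilon> x - w \<epsilon> x) \<in> negligible_nets \<Omega> \<Omega>" by (simp add: algebra_simps)
  qed
  then show ?thesis using em 0 by (auto simp: colombeau_zero_def colombeau_rel_def net_rel_def)
qed

section \<open>Negligibility from small integrals\<close>

lemma negligible_on_subset: "negligible_on S f \<Longrightarrow> T \<subseteq> S \<Longrightarrow> negligible_on T f"
  unfolding negligible_on_def by (fast elim: eventually_mono)

lemma negligible_on_lincomb:
  "negligible_on S f \<Longrightarrow> negligible_on S g \<Longrightarrow> negligible_on S (\<lambda>\<epsilon> x. c * f \<epsilon> x + d * g \<epsilon> x)"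
  unfolding negligible_on_iff using sup_bigo_lincomb by blast

lemma negligible_on_compact:
  fixes K :: "'a::metric_space set"
  assumes K: "compact K" and n: "\<And>x. x \<in> K \<Longrightarrow> \<exists>r>0. negligible_on (cball x r) f"
  shows "negligible_on K f"
proof -
  obtain r where r: "\<And>x. x \<in> K \<Longrightarrow> r x > 0 \<and> negligible_on (cball x (r x)) f" using n by metis
  have "K \<subseteq> (\<Union>x\<in>K. ball x (r x))" using r by force
  then obtain X where X: "X \<subseteq> K" "finite X" "K \<subseteq> (\<Union>x\<in>X. ball x (r x))"
    by (rule compactE_image[OF K, rotated]) auto
  show ?thesis
    unfolding negligible_on_def
  proof
    fix m :: nat
    have "\<forall>\<^sub>F \<epsilon> in at_right 0. \<forall>x\<in>X. \<forall>y\<in>cball x (r x). \<bar>f \<epsilon> y\<bar> \<le> \<epsilon> ^ m"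
      using r X(1) by (intro eventually_ball_finite[OF X(2)]) (auto simp: negligible_on_def)
    then show "\<forall>\<^sub>F \<epsilon> in at_right 0. \<forall>x\<in>K. \<bar>f \<epsilon> x\<bar> \<le> \<epsilon> ^ m"
      by (rule eventually_mono) (use X(3) in fastforce)
  qed
qed

text \<open>
  If \<open>f'\<close> were not small at a point, then \<open>f\<close> would vary too much along a segment of length \<open>h = \<epsilon>\<^sup>k\<close>,
  as the bound on \<open>f''\<close> prevents \<open>f'\<close> from changing on it.  Halving the radius makes room for the segment.
\<close>

lemma negligible_on_pdiff:
  fixes \<Omega> :: "'a::euclidean_space set"
  assumes r: "r > 0" "cball x0 r \<subseteq> \<Omega>" and b: "b \<in> Basis"
    and s: "\<And>\<epsilon>. \<epsilon> \<in> {0<..1} \<Longrightarrow> smooth_along Basis \<Omega> (f \<epsilon>)"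
    and B: "\<forall>\<^sub>F \<epsilon> in at_right 0. \<forall>x\<in>\<Omega>. \<bar>pdiff b (pdiff b (f \<epsilon>)) x\<bar> \<le> 1 / \<epsilon> ^ N"
    and n: "negligible_on (cball x0 r) f"
  shows "negligible_on (cball x0 (r / 2)) (\<lambda>\<epsilon>. pdiff b (f \<epsilon>))"
  unfolding negligible_on_def
proof
  fix m :: nat
  \<comment> \<open>with \<open>h = \<epsilon>\<^sup>k\<close> the change \<open>h * \<epsilon>\<^bsup>-N\<^esup>\<close> of the derivative is \<open>\<epsilon>\<^bsup>m + 1\<^esup>\<close>, and \<open>k + m + 2\<close> powers of \<open>\<epsilon>\<close> survive division by \<open>h\<close>\<close>
  define k where "k = Suc m + N"
  have "\<forall>\<^sub>F \<epsilon> in at_right 0. \<forall>x\<in>cball x0 r. \<bar>f \<epsilon> x\<bar> \<le> \<epsilon> ^ (k + Suc (Suc m))"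
    using n unfolding negligible_on_def by blast
  moreover have "\<forall>\<^sub>F \<epsilon> in at_right 0. 0 < \<epsilon> \<and> \<epsilon> < min (1/3) (r/2)"
    using r by (intro eventually_at_right_0_less) auto
  ultimately show "\<forall>\<^sub>F \<epsilon> in at_right 0. \<forall>x\<in>cball x0 (r / 2). \<bar>pdiff b (f \<epsilon>) x\<bar> \<le> \<epsilon> ^ m"
    using B
  proof eventually_elim
    case (elim \<epsilon>)
    define h where "h = \<epsilon> ^ k"
    have \<epsilon>: "0 < \<epsilon>" "\<epsilon> < 1/3" "\<epsilon> < r/2" "\<epsilon> \<in> {0<..1}" using elim by auto
    have "\<epsilon> ^ k \<le> \<epsilon> ^ 1" using \<epsilon> by (intro power_decreasing) (auto simp: k_def)
    then have h: "0 < h" "h \<le> r / 2" using \<epsilon> by (auto simp: h_def)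
    show ?case
    proof
      fix x assume x: "x \<in> cball x0 (r / 2)"
      have inb: "x + t *\<^sub>R b \<in> cball x0 r" if "\<bar>t\<bar> \<le> h" for t
      proof -
        have "dist x0 (x + t *\<^sub>R b) \<le> dist x0 x + dist x (x + t *\<^sub>R b)" by (rule dist_triangle)
        also have "dist x (x + t *\<^sub>R b) = \<bar>t\<bar>" using b by (simp add: dist_norm)
        finally show ?thesis using x that h by simp
      qed
      then have in\<Omega>: "x + t *\<^sub>R b \<in> \<Omega>" if "\<bar>t\<bar> \<le> h" for t using that r by blast
      obtain \<xi> where \<xi>: "\<bar>\<xi>\<bar> \<le> h" "f \<epsilon> (x + h *\<^sub>R b) - f \<epsilon> x = h * pdiff b (f \<epsilon>) (x + \<xi> *\<^sub>R b)"
        using mean_value_between[of 0 h "\<lambda>t. f \<epsilon> (x + t *\<^sub>R b)" "\<lambda>t. pdiff b (f \<epsilon>) (x + t *\<^sub>R b)"]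
          smooth_along_DERIV[OF s[OF \<epsilon>(4)] b in\<Omega>] h by auto
      obtain \<eta> where \<eta>: "\<bar>\<eta>\<bar> \<le> \<bar>\<xi>\<bar>"
        "pdiff b (f \<epsilon>) (x + \<xi> *\<^sub>R b) - pdiff b (f \<epsilon>) x = \<xi> * pdiff b (pdiff b (f \<epsilon>)) (x + \<eta> *\<^sub>R b)"
        using mean_value_between[of 0 \<xi> "\<lambda>t. pdiff b (f \<epsilon>) (x + t *\<^sub>R b)" "\<lambda>t. pdiff b (pdiff b (f \<epsilon>)) (x + t *\<^sub>R b)"]
          smooth_along_DERIV[OF smooth_along_pdiff[OF s[OF \<epsilon>(4)] b] b in\<Omega>] \<xi>(1) by auto
      have "\<bar>h * pdiff b (f \<epsilon>) (x + \<xi> *\<^sub>R b)\<bar> \<le> \<bar>f \<epsilon> (x + h *\<^sub>R b)\<bar> + \<bar>f \<epsilon> (x + 0 *\<^sub>R b)\<bar>"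
        using \<xi>(2) by simp
      also have "\<dots> \<le> \<epsilon> ^ (k + Suc (Suc m)) + \<epsilon> ^ (k + Suc (Suc m))"
        using elim(1) inb[of h] inb[of 0] h by (intro add_mono) auto
      also have "\<dots> = h * (2 * \<epsilon> * \<epsilon> ^ Suc m)" by (simp add: h_def power_add)
      finally have "h * \<bar>pdiff b (f \<epsilon>) (x + \<xi> *\<^sub>R b)\<bar> \<le> h * (2 * \<epsilon> * \<epsilon> ^ Suc m)" using h by (simp add: abs_mult)
      then have 1: "\<bar>pdiff b (f \<epsilon>) (x + \<xi> *\<^sub>R b)\<bar> \<le> 2 * \<epsilon> * \<epsilon> ^ Suc m" using h by simp
      have "\<bar>\<xi> * pdiff b (pdiff b (f \<epsilon>)) (x + \<eta> *\<^sub>R b)\<bar> \<le> h * (1 / \<epsilon> ^ N)"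
        unfolding abs_mult using \<xi>(1) \<eta>(1) elim(3) in\<Omega> by (intro mult_mono) auto
      also have "\<dots> = \<epsilon> ^ Suc m" using \<epsilon> by (simp add: h_def k_def power_add)
      finally have "\<bar>pdiff b (f \<epsilon>) x\<bar> \<le> 2 * \<epsilon> * \<epsilon> ^ Suc m + \<epsilon> ^ Suc m" using 1 \<eta>(2) by linarith
      also have "\<dots> = (2 * \<epsilon> + 1) * \<epsilon> * \<epsilon> ^ m" by (simp add: algebra_simps)
      also have "\<dots> \<le> 1 * \<epsilon> ^ m"
      proof (rule mult_right_mono)
        have "(2 * \<epsilon> + 1) * \<epsilon> \<le> (2 * 1 + 1) * (1/3)" using \<epsilon> by (intro mult_mono) auto
        then show "(2 * \<epsilon> + 1) * \<epsilon> \<le> 1" by simp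
      qed (use \<epsilon> in simp)
      finally show "\<bar>pdiff b (f \<epsilon>) x\<bar> \<le> \<epsilon> ^ m" by simp
    qed
  qed
qed

text \<open>
  If \<open>|f|\<close> exceeds \<open>\<epsilon>\<^sup>m\<close> at some point, then it exceeds \<open>\<epsilon>\<^sup>m / 2\<close> on a ball of radius \<open>\<rho> = \<epsilon>\<^bsup>m + 1 + N\<^esup>\<close>,
  because the gradient is bounded by a multiple of \<open>\<epsilon>\<^bsup>-N\<^esup>\<close>.  The integral of \<open>\<theta> f\<^sup>2\<close> over this ball is at
  least a constant times \<open>\<epsilon>\<^bsup>2 m\<^esup> \<rho>\<^bsup>d\<^esup>\<close> with \<open>d\<close> the dimension, which contradicts a bound by one more power of \<open>\<epsilon>\<close>.
\<close>

lemma negligible_from_integral: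
  fixes \<Omega> :: "'a::euclidean_space set"
  assumes r: "r > 0" "cball x0 r \<subseteq> \<Omega>" and \<Omega>: "open \<Omega>"
    and s: "\<And>\<epsilon>. \<epsilon> \<in> {0<..1} \<Longrightarrow> smooth_along Basis \<Omega> (f \<epsilon>)"
    and B: "\<forall>\<^sub>F \<epsilon> in at_right 0. \<forall>b\<in>Basis. \<forall>x\<in>\<Omega>. \<bar>pdiff b (f \<epsilon>) x\<bar> \<le> 1 / \<epsilon> ^ N"
    and \<theta>: "\<And>x. 0 \<le> \<theta> x" "c > 0" "\<And>x. x \<in> cball x0 r \<Longrightarrow> c \<le> \<theta> x"
    and int: "\<And>\<epsilon>. \<epsilon> \<in> {0<..1} \<Longrightarrow> set_integrable lebesgue \<Omega> (\<lambda>x. \<theta> x * (f \<epsilon> x)\<^sup>2)"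
    and small: "\<And>m::nat. \<forall>\<^sub>F \<epsilon> in at_right 0. (LINT x:\<Omega>|lebesgue. \<theta> x * (f \<epsilon> x)\<^sup>2) \<le> \<epsilon> ^ m"
  shows "negligible_on (cball x0 (r / 2)) f"
  unfolding negligible_on_def
proof
  fix m :: nat
  let ?d = "DIM('a)"
  define k where "k = Suc m + N"
  define V where "V = measure lborel (ball (0::'a) 1)"
  have V: "V > 0" unfolding V_def by (rule content_ball_pos) simp
  define C where "C = 4 / (c * V)"
  have C: "C > 0" using V \<theta>(2) by (simp add: C_def)
  have "\<forall>\<^sub>F \<epsilon> in at_right 0. 0 < \<epsilon> \<and> \<epsilon> < min (1 / (2 * real ?d * real ?d)) (min (r / (2 * real ?d)) 1)"
    using r by (intro eventually_at_right_0_less) auto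
  with small[of "2 * m + k * ?d + 1"] B eventually_const_times_le_1[of "2 * C"]
  show "\<forall>\<^sub>F \<epsilon> in at_right 0. \<forall>x\<in>cball x0 (r / 2). \<bar>f \<epsilon> x\<bar> \<le> \<epsilon> ^ m"
  proof eventually_elim
    case (elim \<epsilon>)
    have \<epsilon>: "0 < \<epsilon>" "\<epsilon> \<le> 1" "\<epsilon> \<in> {0<..1}" and \<epsilon>r: "real ?d * \<epsilon> \<le> r / 2" and \<epsilon>d: "real ?d * (real ?d * \<epsilon>) \<le> 1/2"
      using elim by (auto simp: field_simps)
    define \<rho> where "\<rho> = \<epsilon> ^ k"
    have "\<epsilon> ^ k \<le> \<epsilon> ^ 1" using \<epsilon> by (intro power_decreasing) (auto simp: k_def)
    then have \<rho>: "0 < \<rho>" "\<rho> \<le> \<epsilon>" using \<epsilon> by (auto simp: \<rho>_def)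
    have "real ?d * \<rho> \<le> real ?d * \<epsilon>" using \<rho> by (intro mult_left_mono) auto
    then have \<rho>r: "real ?d * \<rho> \<le> r / 2" using \<epsilon>r by linarith
    have "1 * \<rho> \<le> real ?d * \<rho>"
      using \<rho> DIM_positive[where 'a='a] by (intro mult_right_mono) (auto simp: Suc_le_eq)
    then have \<rho>r': "\<rho> \<le> r / 2" using \<rho>r by linarith
    show ?case
    proof (rule ballI, rule ccontr)
      fix x assume x: "x \<in> cball x0 (r / 2)" and "\<not> \<bar>f \<epsilon> x\<bar> \<le> \<epsilon> ^ m"
      then have big: "\<bar>f \<epsilon> x\<bar> > \<epsilon> ^ m" by simp
      have sub: "cball x (r / 2) \<subseteq> cball x0 r"
      proof
        fix y assume "y \<in> cball x (r / 2)"
        then show "y \<in> cball x0 r" using x dist_triangle[of x0 y x] by simp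
      qed
      have lower: "c * (\<epsilon> ^ m / 2)\<^sup>2 \<le> \<theta> y * (f \<epsilon> y)\<^sup>2" if y: "y \<in> ball x \<rho>" for y
      proof -
        have n: "norm (y - x) \<le> \<rho>" using y by (simp add: dist_norm norm_minus_commute)
        have "real ?d * norm (y - x) \<le> real ?d * \<rho>" using n by (intro mult_left_mono) auto
        then have nr: "real ?d * norm (y - x) \<le> r / 2" using \<rho>r by linarith
        have "\<bar>f \<epsilon> y - f \<epsilon> x\<bar> \<le> real ?d * (1 / \<epsilon> ^ N * norm (y - x))"
          by (rule lipschitz_from_pdiff[OF s[OF \<epsilon>(3)] _ _ nr]) (use sub r elim(2) in blast)+
        also have "\<dots> \<le> real ?d * (1 / \<epsilon> ^ N * \<rho>)" using n \<epsilon> by (intro mult_left_mono) auto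
        also have "1 / \<epsilon> ^ N * \<rho> = \<epsilon> * \<epsilon> ^ m" using \<epsilon> by (simp add: \<rho>_def k_def power_add)
        also have "real ?d * (\<epsilon> * \<epsilon> ^ m) \<le> 1/2 * \<epsilon> ^ m"
        proof -
          have "1 * (real ?d * \<epsilon>) \<le> real ?d * (real ?d * \<epsilon>)"
            using \<epsilon> DIM_positive[where 'a='a] by (intro mult_right_mono) (auto simp: Suc_le_eq)
          then have "real ?d * \<epsilon> \<le> 1/2" using \<epsilon>d by linarith
          then have "(real ?d * \<epsilon>) * \<epsilon> ^ m \<le> 1/2 * \<epsilon> ^ m" using \<epsilon> by (intro mult_right_mono) auto
          then show ?thesis by (simp add: mult.assoc)
        qed
        finally have "\<epsilon> ^ m / 2 \<le> \<bar>f \<epsilon> y\<bar>" using big by linarith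
        then have "(\<epsilon> ^ m / 2)\<^sup>2 \<le> (f \<epsilon> y)\<^sup>2" using \<epsilon> by (intro abs_le_square_iff[THEN iffD1]) auto
        moreover have "c \<le> \<theta> y"
        proof (rule \<theta>(3))
          have "y \<in> cball x (r / 2)"
            using y \<rho>r' by simp
          then show "y \<in> cball x0 r" using sub by blast
        qed
        ultimately show ?thesis using \<theta>(2) by (intro mult_mono) auto
      qed
      have "ball x \<rho> \<subseteq> cball x (r / 2)" using \<rho>r' by auto
      then have ball\<Omega>: "ball x \<rho> \<subseteq> \<Omega>" using sub r by blast
      have "measure lebesgue (ball x \<rho>) * (c * (\<epsilon> ^ m / 2)\<^sup>2) = (LINT y:ball x \<rho>|lebesgue. c * (\<epsilon> ^ m / 2)\<^sup>2)"
        by (simp add: set_lebesgue_integral_def)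
      also have "\<dots> \<le> (LINT y:ball x \<rho>|lebesgue. \<theta> y * (f \<epsilon> y)\<^sup>2)"
      proof (rule set_integral_mono)
        show "set_integrable lebesgue (ball x \<rho>) (\<lambda>y. c * (\<epsilon> ^ m / 2)\<^sup>2)"
          by (rule integrable_bounded_continuous) auto
        show "set_integrable lebesgue (ball x \<rho>) (\<lambda>y. \<theta> y * (f \<epsilon> y)\<^sup>2)"
          by (rule set_integrable_subset[OF int[OF \<epsilon>(3)] _ ball\<Omega>]) simp
      qed (rule lower)
      also have "\<dots> \<le> (LINT y:\<Omega>|lebesgue. \<theta> y * (f \<epsilon> y)\<^sup>2)"
        unfolding set_lebesgue_integral_def
      proof (rule integral_mono)
        show "integrable lebesgue (\<lambda>y. indicat_real (ball x \<rho>) y *\<^sub>R (\<theta> y * (f \<epsilon> y)\<^sup>2))"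
          using set_integrable_subset[OF int[OF \<epsilon>(3)] _ ball\<Omega>] by (simp add: set_integrable_def)
        show "integrable lebesgue (\<lambda>y. indicat_real \<Omega> y *\<^sub>R (\<theta> y * (f \<epsilon> y)\<^sup>2))"
          using int[OF \<epsilon>(3)] by (simp add: set_integrable_def)
        show "indicat_real (ball x \<rho>) y *\<^sub>R (\<theta> y * (f \<epsilon> y)\<^sup>2) \<le> indicat_real \<Omega> y *\<^sub>R (\<theta> y * (f \<epsilon> y)\<^sup>2)" for y
          using ball\<Omega> \<theta>(1) by (auto simp: indicator_def)
      qed
      also have "\<dots> \<le> \<epsilon> ^ (2 * m + k * ?d + 1)" using elim(1) .
      also have "measure lebesgue (ball x \<rho>) = \<rho> ^ ?d * V"
        unfolding V_def using \<rho> by (simp add: measure_completion content_ball_conv_unit_ball[of \<rho> x])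
      finally have le: "\<rho> ^ ?d * V * (c * (\<epsilon> ^ m / 2)\<^sup>2) \<le> \<epsilon> ^ (2 * m + k * ?d + 1)" .
      have e1: "\<rho> ^ ?d * V * (c * (\<epsilon> ^ m / 2)\<^sup>2) = (\<epsilon> ^ (2 * m) * \<epsilon> ^ (k * ?d)) * (c * V / 4)"
        by (simp add: \<rho>_def power_mult power_divide power_even_eq[symmetric] field_simps power2_eq_square)
      have e2: "\<epsilon> ^ (2 * m + k * ?d + 1) = (\<epsilon> ^ (2 * m) * \<epsilon> ^ (k * ?d)) * \<epsilon>" by (simp add: power_add)
      have "c * V / 4 \<le> \<epsilon>"
        using le unfolding e1 e2 using \<epsilon> by (subst (asm) mult_le_cancel_left_pos) auto
      then have "C * (c * V / 4) \<le> C * \<epsilon>" using C by (intro mult_left_mono) auto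
      then have "1 \<le> C * \<epsilon>" using V \<theta>(2) by (simp add: C_def)
      moreover have "2 * C * \<epsilon> \<le> 1" using elim(3) by simp
      ultimately show False by simp
    qed
  qed
qed

section \<open>Jets of nets and expansions in the jet variables\<close>

abbreviation moderate_on :: "'a set \<Rightarrow> 'a net \<Rightarrow> bool" where
  "moderate_on S f \<equiv> \<exists>N::nat. \<forall>\<^sub>F \<epsilon> in at_right 0. \<forall>x\<in>S. \<bar>f \<epsilon> x\<bar> \<le> 1 / \<epsilon> ^ N"

text \<open>
  Bounds on \<open>\<Omega>\<close>, not just on its compact subsets, are available because the minimizer is a generalized
  function on the closure of \<open>\<Omega>\<close>, which is compact; the action, an integral over all of \<open>\<Omega>\<close>, needs them.
\<close>

definition jets_moderate :: "(real ^ 'p::finite) set \<Rightarrow> ('q \<Rightarrow> (real ^ 'p) net) \<Rightarrow> bool" where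
  "jets_moderate \<Omega> v \<longleftrightarrow> (\<forall>r. \<exists>N::nat. \<forall>\<^sub>F \<epsilon> in at_right 0. \<forall>x\<in>\<Omega>. \<forall>a. size (snd a) \<le> r \<longrightarrow>
     \<bar>jet_along \<Omega> (\<lambda>\<beta>. v \<beta> \<epsilon>) x a\<bar> \<le> 1 / \<epsilon> ^ N)"

definition jets_negligible :: "(real ^ 'p::finite) set \<Rightarrow> ('q \<Rightarrow> (real ^ 'p) net) \<Rightarrow> bool" where
  "jets_negligible \<Omega> v \<longleftrightarrow> (\<forall>r. \<forall>m::nat. \<forall>\<^sub>F \<epsilon> in at_right 0. \<forall>x\<in>\<Omega>. \<forall>a. size (snd a) \<le> r \<longrightarrow>
     \<bar>jet_along \<Omega> (\<lambda>\<beta>. v \<beta> \<epsilon>) x a\<bar> \<le> \<epsilon> ^ m)"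

text \<open>
  Exponents chosen for the members of a finite set can be replaced by their sum.
\<close>

lemma eventually_uniform_bound:
  fixes P :: "'a \<Rightarrow> nat \<Rightarrow> real \<Rightarrow> bool"
  assumes A: "finite A" and P: "\<And>a. a \<in> A \<Longrightarrow> \<exists>N. \<forall>\<^sub>F \<epsilon> in at_right 0. P a N \<epsilon>"
    and mono: "\<And>a m n \<epsilon>. \<lbrakk>P a m \<epsilon>; m \<le> n; 0 < \<epsilon>; \<epsilon> < 1\<rbrakk> \<Longrightarrow> P a n \<epsilon>"
  shows "\<exists>N. \<forall>\<^sub>F \<epsilon> in at_right 0. \<forall>a\<in>A. P a N \<epsilon>"
proof -
  obtain N where N: "\<And>a. a \<in> A \<Longrightarrow> \<forall>\<^sub>F \<epsilon> in at_right 0. P a (N a) \<epsilon>" using P by metis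
  have "\<forall>\<^sub>F \<epsilon> in at_right 0. P a (sum N A) \<epsilon>" if a: "a \<in> A" for a
    using N[OF a] eventually_at_right_0_less[of 1, simplified]
  proof eventually_elim
    case (elim \<epsilon>)
    have "N a \<le> sum N A" by (rule member_le_sum[OF a _ A]) auto
    then show ?case using mono[OF elim(1)] elim(2) by blast
  qed
  then show ?thesis by (intro exI[of _ "sum N A"] eventually_ball_finite[OF A]) simp
qed

lemma jets_moderateI:
  fixes v :: "'q::finite \<Rightarrow> (real ^ 'p::finite) net"
  assumes "\<And>a. moderate_on \<Omega> (\<lambda>\<epsilon> x. jet_along \<Omega> (\<lambda>\<beta>. v \<beta> \<epsilon>) x a)"
  shows "jets_moderate \<Omega> v"
  unfolding jets_moderate_def
proof
  fix r
  have "\<exists>N. \<forall>\<^sub>F \<epsilon> in at_right 0. \<forall>a\<in>{a. size (snd a) \<le> r}. \<forall>x\<in>\<Omega>. \<bar>jet_along \<Omega> (\<lambda>\<beta>. v \<beta> \<epsilon>) x a\<bar> \<le> 1 / \<epsilon> ^ N"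
  proof (rule eventually_uniform_bound[OF finite_jet_coords assms])
    fix a m n and \<epsilon> :: real assume *: "\<forall>x\<in>\<Omega>. \<bar>jet_along \<Omega> (\<lambda>\<beta>. v \<beta> \<epsilon>) x a\<bar> \<le> 1 / \<epsilon> ^ m" "m \<le> n" "0 < \<epsilon>" "\<epsilon> < 1"
    have "1 / \<epsilon> ^ m \<le> 1 / \<epsilon> ^ n" using * by (intro inverse_power_mono) auto
    then show "\<forall>x\<in>\<Omega>. \<bar>jet_along \<Omega> (\<lambda>\<beta>. v \<beta> \<epsilon>) x a\<bar> \<le> 1 / \<epsilon> ^ n" using *(1) by force
  qed
  then obtain N where "\<forall>\<^sub>F \<epsilon> in at_right 0. \<forall>a\<in>{a. size (snd a) \<le> r}. \<forall>x\<in>\<Omega>. \<bar>jet_along \<Omega> (\<lambda>\<beta>. v \<beta> \<epsilon>) x a\<bar> \<le> 1 / \<epsilon> ^ N"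
    by blast
  then have "\<forall>\<^sub>F \<epsilon> in at_right 0. \<forall>x\<in>\<Omega>. \<forall>a. size (snd a) \<le> r \<longrightarrow> \<bar>jet_along \<Omega> (\<lambda>\<beta>. v \<beta> \<epsilon>) x a\<bar> \<le> 1 / \<epsilon> ^ N"
    by (rule eventually_mono) simp
  then show "\<exists>N. \<forall>\<^sub>F \<epsilon> in at_right 0. \<forall>x\<in>\<Omega>. \<forall>a. size (snd a) \<le> r \<longrightarrow> \<bar>jet_along \<Omega> (\<lambda>\<beta>. v \<beta> \<epsilon>) x a\<bar> \<le> 1 / \<epsilon> ^ N" ..
qed

lemma jets_negligibleI:
  fixes v :: "'q::finite \<Rightarrow> (real ^ 'p::finite) net"
  assumes "\<And>a. negligible_on \<Omega> (\<lambda>\<epsilon> x. jet_along \<Omega> (\<lambda>\<beta>. v \<beta> \<epsilon>) x a)"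
  shows "jets_negligible \<Omega> v"
  unfolding jets_negligible_def
proof (intro allI)
  fix r and m :: nat
  have "\<forall>\<^sub>F \<epsilon> in at_right 0. \<forall>a\<in>{a. size (snd a) \<le> r}. \<forall>x\<in>\<Omega>. \<bar>jet_along \<Omega> (\<lambda>\<beta>. v \<beta> \<epsilon>) x a\<bar> \<le> \<epsilon> ^ m"
    by (rule eventually_ball_finite[OF finite_jet_coords]) (use assms in \<open>auto simp: negligible_on_def\<close>)
  then show "\<forall>\<^sub>F \<epsilon> in at_right 0. \<forall>x\<in>\<Omega>. \<forall>a. size (snd a) \<le> r \<longrightarrow> \<bar>jet_along \<Omega> (\<lambda>\<beta>. v \<beta> \<epsilon>) x a\<bar> \<le> \<epsilon> ^ m"
    by (rule eventually_mono) simp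
qed

lemma jet_along_pdbar: "jet_along \<Omega> v x a = pdbar \<Omega> (axes (idx_list (snd a))) (v (fst a)) x"
  by (simp add: inf_jet_of_def case_prod_unfold)

lemma jets_moderate_of_moderate:
  fixes v :: "'q::finite \<Rightarrow> (real ^ 'p::finite) net"
  assumes \<Omega>: "bounded \<Omega>" and v: "\<And>\<beta>. v \<beta> \<in> moderate \<Omega> (closure \<Omega>)"
  shows "jets_moderate \<Omega> v"
proof (rule jets_moderateI)
  fix a :: "'q \<times> 'p multiset"
  obtain N :: nat where "sup_bigo (closure \<Omega>) (\<lambda>\<epsilon>. pdbar \<Omega> (axes (idx_list (snd a))) (v (fst a) \<epsilon>)) (\<lambda>\<epsilon>. 1 / \<epsilon> ^ N)"
    using moderateD(2)[OF v _ order_refl axes_in_Basis] \<Omega> by (metis compact_closure)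
  then have "\<forall>\<^sub>F \<epsilon> in at_right 0. \<forall>x\<in>\<Omega>. \<bar>jet_along \<Omega> (\<lambda>\<beta>. v \<beta> \<epsilon>) x a\<bar> \<le> 1 / \<epsilon> ^ Suc N"
    by (rule eventually_mono[OF sup_bigo_imp_bound]) (use closure_subset in \<open>auto simp: jet_along_pdbar\<close>)
  then show "moderate_on \<Omega> (\<lambda>\<epsilon> x. jet_along \<Omega> (\<lambda>\<beta>. v \<beta> \<epsilon>) x a)" by blast
qed

lemma jets_negligible_of_negligible:
  fixes v :: "'q::finite \<Rightarrow> (real ^ 'p::finite) net"
  assumes \<Omega>: "bounded \<Omega>" and v: "\<And>\<beta>. v \<beta> \<in> negligible_nets \<Omega> (closure \<Omega>)"
  shows "jets_negligible \<Omega> v"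
proof (rule jets_negligibleI)
  fix a :: "'q \<times> 'p multiset"
  have "compact (closure \<Omega>)" using \<Omega> by (simp add: compact_closure)
  then have "negligible_on (closure \<Omega>) (\<lambda>\<epsilon>. pdbar \<Omega> (axes (idx_list (snd a))) (v (fst a) \<epsilon>))"
    using negligible_netsD(2)[OF v _ order_refl axes_in_Basis] unfolding negligible_on_iff by blast
  then show "negligible_on \<Omega> (\<lambda>\<epsilon> x. jet_along \<Omega> (\<lambda>\<beta>. v \<beta> \<epsilon>) x a)"
    unfolding jet_along_pdbar by (rule negligible_on_subset) (rule closure_subset)
qed

lemma along_bound:
  assumes F: "jet_regular \<Omega> r F" and v: "jets_moderate \<Omega> v"
  shows "moderate_on \<Omega> (\<lambda>\<epsilon> x. F \<epsilon> (inf_jet_of \<Omega> (\<lambda>\<beta>. v \<beta> \<epsilon>) x))"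
proof -
  obtain N :: nat where N: "\<forall>\<^sub>F \<epsilon> in at_right 0. \<forall>x\<in>\<Omega>. \<forall>a. size (snd a) \<le> r \<longrightarrow>
     \<bar>jet_along \<Omega> (\<lambda>\<beta>. v \<beta> \<epsilon>) x a\<bar> \<le> 1 / \<epsilon> ^ N" using v unfolding jets_moderate_def by blast
  obtain N' where "jet_growth \<Omega> r N F N'"
    using jet_regular_growth[OF F] .
  with N have "\<forall>\<^sub>F \<epsilon> in at_right 0. \<forall>x\<in>\<Omega>. \<bar>F \<epsilon> (inf_jet_of \<Omega> (\<lambda>\<beta>. v \<beta> \<epsilon>) x)\<bar> \<le> 1 / \<epsilon> ^ N'"
  proof eventually_elim
    case (elim \<epsilon>)
    show ?case by (rule ballI, subst inf_jet_of_eq) (use elim in blast)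
  qed
  then show ?thesis ..
qed

lemma along_pdiffs_bound:
  fixes F :: "real \<Rightarrow> ('p::finite, 'q::finite) inf_jet \<Rightarrow> real"
  assumes \<Omega>: "open \<Omega>" and F: "jet_smooth \<Omega> r F" and v: "jets_moderate \<Omega> v"
    and s: "\<And>\<epsilon> \<beta>. \<epsilon> \<in> {0<..1} \<Longrightarrow> smooth_along Basis \<Omega> (v \<beta> \<epsilon>)" and bs: "bs \<in> lists Basis"
  shows "moderate_on \<Omega> (\<lambda>\<epsilon> x. pdiffs bs (\<lambda>x. F \<epsilon> (inf_jet_of \<Omega> (\<lambda>\<beta>. v \<beta> \<epsilon>) x)) x)"
proof -
  obtain js where js: "bs = axes js" using Basis_list_eq_axes[OF bs] .
  have "jet_tame \<Omega> (r + length js) 0 (\<lambda>\<epsilon>. foldr total_deriv js (F \<epsilon>))"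
    using jet_smooth_total_derivs[OF \<Omega> F] unfolding jet_smooth_def by blast
  then have "jet_regular \<Omega> (r + length js) (\<lambda>\<epsilon>. foldr total_deriv js (F \<epsilon>))"
    by (rule jet_tame_regular)
  then obtain N :: nat where "\<forall>\<^sub>F \<epsilon> in at_right 0. \<forall>x\<in>\<Omega>.
      \<bar>foldr total_deriv js (F \<epsilon>) (inf_jet_of \<Omega> (\<lambda>\<beta>. v \<beta> \<epsilon>) x)\<bar> \<le> 1 / \<epsilon> ^ N"
    using along_bound[OF _ v] by blast
  then have "\<forall>\<^sub>F \<epsilon> in at_right 0. \<forall>x\<in>\<Omega>. \<bar>pdiffs bs (\<lambda>x. F \<epsilon> (inf_jet_of \<Omega> (\<lambda>\<beta>. v \<beta> \<epsilon>) x)) x\<bar> \<le> 1 / \<epsilon> ^ N"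
    using eventually_at_right_0_less[of 1, simplified]
  proof eventually_elim
    case (elim \<epsilon>)
    then have \<epsilon>: "\<epsilon> \<in> {0<..1}" by simp
    show ?case unfolding js using elim(1) pdiffs_along[OF \<Omega> F \<epsilon> s[OF \<epsilon>]] by simp
  qed
  then show ?thesis ..
qed

lemma DERIV_fibre:
  fixes F :: "real \<Rightarrow> ('p::finite, 'q::finite) inf_jet \<Rightarrow> real"
  assumes \<Omega>: "open \<Omega>" and F: "jet_tame \<Omega> r (Suc 0) F" and \<epsilon>: "\<epsilon> \<in> {0<..1}" and x: "x \<in> \<Omega>"
  shows "((\<lambda>\<tau>. F \<epsilon> (x, \<lambda>a. U a + \<tau> * W a)) has_real_derivative
    (\<Sum>a | size (snd a) \<le> r. W a * jet_pd (Inr a) (F \<epsilon>) (x, \<lambda>a. U a + \<tau> * W a))) (at \<tau>)"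
proof -
  have "((\<lambda>t. F \<epsilon> (x + (0 * t) *\<^sub>R axis i 1, \<lambda>a. U a + (t + \<tau>) * W a)) has_real_derivative
     0 * jet_pd (Inl i) (F \<epsilon>) (x, \<lambda>a. U a + (0 + \<tau>) * W a) +
     (\<Sum>a | size (snd a) \<le> r. W a * jet_pd (Inr a) (F \<epsilon>) (x, \<lambda>a. U a + (0 + \<tau>) * W a))) (at 0)" for i
    by (rule jet_chain_rule[OF \<Omega> F \<epsilon> x, where U = "\<lambda>t a. U a + (t + \<tau>) * W a"])
       (auto intro!: derivative_eq_intros)
  then show ?thesis
    using DERIV_shift[of "\<lambda>\<tau>. F \<epsilon> (x, \<lambda>a. U a + \<tau> * W a)" _ 0 \<tau>] by simp
qed

lemma fibre_growth:
  fixes G :: "'i \<Rightarrow> real \<Rightarrow> ('p::finite, 'q) inf_jet \<Rightarrow> real"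
  assumes A: "finite A" and G: "\<And>i. i \<in> A \<Longrightarrow> jet_regular \<Omega> r (G i)"
  shows "\<exists>N'::nat. \<forall>\<^sub>F \<epsilon> in at_right 0. \<forall>i\<in>A. \<forall>x\<in>\<Omega>. \<forall>U W \<tau>. \<bar>\<tau>\<bar> \<le> 1 \<and>
     (\<forall>a. size (snd a) \<le> r \<longrightarrow> \<bar>U a\<bar> \<le> 1 / \<epsilon> ^ N \<and> \<bar>W a\<bar> \<le> 1 / \<epsilon> ^ N) \<longrightarrow>
     \<bar>G i \<epsilon> (x, \<lambda>a. U a + \<tau> * W a)\<bar> \<le> 1 / \<epsilon> ^ N'"
proof (rule eventually_uniform_bound[OF A])
  fix i assume i: "i \<in> A"
  obtain N' where N': "jet_growth \<Omega> r (Suc (N + N)) (G i) N'"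
    using jet_regular_growth[OF G[OF i]] .
  then have "\<forall>\<^sub>F \<epsilon> in at_right 0. \<forall>x\<in>\<Omega>. \<forall>U W \<tau>. \<bar>\<tau>\<bar> \<le> 1 \<and>
     (\<forall>a. size (snd a) \<le> r \<longrightarrow> \<bar>U a\<bar> \<le> 1 / \<epsilon> ^ N \<and> \<bar>W a\<bar> \<le> 1 / \<epsilon> ^ N) \<longrightarrow>
     \<bar>G i \<epsilon> (x, \<lambda>a. U a + \<tau> * W a)\<bar> \<le> 1 / \<epsilon> ^ N'"
    using eventually_at_right_0_less[of "1/2", simplified]
  proof eventually_elim
    case (elim \<epsilon>)
    show ?case
    proof (intro ballI allI impI, elim conjE)
      fix x and U W :: "'q \<times> 'p multiset \<Rightarrow> real" and \<tau> :: real
      assume x: "x \<in> \<Omega>" and \<tau>: "\<bar>\<tau>\<bar> \<le> 1"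
        and UW: "\<forall>a. size (snd a) \<le> r \<longrightarrow> \<bar>U a\<bar> \<le> 1 / \<epsilon> ^ N \<and> \<bar>W a\<bar> \<le> 1 / \<epsilon> ^ N"
      have "\<bar>U a + \<tau> * W a\<bar> \<le> 1 / \<epsilon> ^ Suc (N + N)" if a: "size (snd a) \<le> r" for a
      proof -
        have U: "\<bar>U a\<bar> \<le> 1 / \<epsilon> ^ N" and W: "\<bar>W a\<bar> \<le> 1 / \<epsilon> ^ N" using UW a by blast+
        have "\<bar>\<tau> * W a\<bar> \<le> 1 * (1 / \<epsilon> ^ N)"
          unfolding abs_mult using \<tau> W by (intro mult_mono) auto
        then have "\<bar>U a\<bar> + \<bar>\<tau> * W a\<bar> \<le> 1 / \<epsilon> ^ Suc (N + N)"
          using U elim(2) by (intro add_le_inverse_powers) auto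
        then show ?thesis by linarith
      qed
      then show "\<bar>G i \<epsilon> (x, \<lambda>a. U a + \<tau> * W a)\<bar> \<le> 1 / \<epsilon> ^ N'"
        by (rule elim(1)[rule_format, OF x])
    qed
  qed
  then show "\<exists>N'::nat. \<forall>\<^sub>F \<epsilon> in at_right 0. \<forall>x\<in>\<Omega>. \<forall>U W \<tau>. \<bar>\<tau>\<bar> \<le> 1 \<and>
     (\<forall>a. size (snd a) \<le> r \<longrightarrow> \<bar>U a\<bar> \<le> 1 / \<epsilon> ^ N \<and> \<bar>W a\<bar> \<le> 1 / \<epsilon> ^ N) \<longrightarrow>
     \<bar>G i \<epsilon> (x, \<lambda>a. U a + \<tau> * W a)\<bar> \<le> 1 / \<epsilon> ^ N'"
    by (rule exI[where x = N'])
next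
  fix i m n and \<epsilon> :: real
  assume *: "\<forall>x\<in>\<Omega>. \<forall>U W \<tau>. \<bar>\<tau>\<bar> \<le> 1 \<and>
     (\<forall>a. size (snd a) \<le> r \<longrightarrow> \<bar>U a\<bar> \<le> 1 / \<epsilon> ^ N \<and> \<bar>W a\<bar> \<le> 1 / \<epsilon> ^ N) \<longrightarrow>
     \<bar>G i \<epsilon> (x, \<lambda>a. U a + \<tau> * W a)\<bar> \<le> 1 / \<epsilon> ^ m" and le: "m \<le> n" "0 < \<epsilon>" "\<epsilon> < 1"
  have "1 / \<epsilon> ^ m \<le> 1 / \<epsilon> ^ n" using le by (intro inverse_power_mono) auto
  then show "\<forall>x\<in>\<Omega>. \<forall>U W \<tau>. \<bar>\<tau>\<bar> \<le> 1 \<and>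
     (\<forall>a. size (snd a) \<le> r \<longrightarrow> \<bar>U a\<bar> \<le> 1 / \<epsilon> ^ N \<and> \<bar>W a\<bar> \<le> 1 / \<epsilon> ^ N) \<longrightarrow>
     \<bar>G i \<epsilon> (x, \<lambda>a. U a + \<tau> * W a)\<bar> \<le> 1 / \<epsilon> ^ n" using * by (meson order_trans)
qed

text \<open>
  The mean value theorem in the jet variables.  At a fixed base point the fibre is a vector space, so
  segments between jets stay in the domain.
\<close>

lemma fibre_increment:
  fixes F :: "real \<Rightarrow> ('p::finite, 'q::finite) inf_jet \<Rightarrow> real"
  assumes \<Omega>: "open \<Omega>" and F: "jet_smooth \<Omega> r F"
  shows "\<exists>N'::nat. \<forall>\<^sub>F \<epsilon> in at_right 0. \<forall>x\<in>\<Omega>. \<forall>U W \<delta>.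
     (\<forall>a. size (snd a) \<le> r \<longrightarrow> \<bar>U a\<bar> \<le> 1 / \<epsilon> ^ N \<and> \<bar>W a\<bar> \<le> 1 / \<epsilon> ^ N \<and> \<bar>W a\<bar> \<le> \<delta>) \<longrightarrow>
     \<bar>F \<epsilon> (x, \<lambda>a. U a + W a) - F \<epsilon> (x, U)\<bar> \<le> \<delta> * (1 / \<epsilon> ^ N')"
proof -
  let ?A = "{a :: 'q \<times> 'p multiset. size (snd a) \<le> r}"
  have R: "jet_regular \<Omega> r (\<lambda>\<epsilon>. jet_pd d (F \<epsilon>))" for d
    using F unfolding jet_smooth_def by (metis jet_tame.simps)
  have t: "jet_tame \<Omega> r (Suc 0) F" using F unfolding jet_smooth_def by blast
  obtain N1 :: nat where N1: "\<forall>\<^sub>F \<epsilon> in at_right 0. \<forall>a\<in>?A. \<forall>x\<in>\<Omega>. \<forall>U W \<tau>. \<bar>\<tau>\<bar> \<le> 1 \<and>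
     (\<forall>a. size (snd a) \<le> r \<longrightarrow> \<bar>U a\<bar> \<le> 1 / \<epsilon> ^ N \<and> \<bar>W a\<bar> \<le> 1 / \<epsilon> ^ N) \<longrightarrow>
     \<bar>jet_pd (Inr a) (F \<epsilon>) (x, \<lambda>a. U a + \<tau> * W a)\<bar> \<le> 1 / \<epsilon> ^ N1"
    using fibre_growth[OF finite_jet_coords R, where N = N] by blast
  have "\<forall>\<^sub>F \<epsilon> in at_right 0. \<forall>x\<in>\<Omega>. \<forall>U W \<delta>.
     (\<forall>a. size (snd a) \<le> r \<longrightarrow> \<bar>U a\<bar> \<le> 1 / \<epsilon> ^ N \<and> \<bar>W a\<bar> \<le> 1 / \<epsilon> ^ N \<and> \<bar>W a\<bar> \<le> \<delta>) \<longrightarrow>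
     \<bar>F \<epsilon> (x, \<lambda>a. U a + W a) - F \<epsilon> (x, U)\<bar> \<le> \<delta> * (1 / \<epsilon> ^ Suc N1)"
    using N1 eventually_const_times_le_1[of "real (card ?A)"] eventually_at_right_0_less[of 1, simplified]
  proof eventually_elim
    case (elim \<epsilon>)
    then have \<epsilon>: "\<epsilon> \<in> {0<..1}" "0 < \<epsilon>" and card: "real (card ?A) \<le> 1 / \<epsilon>" by (auto simp: pos_le_divide_eq)
    show ?case
    proof (intro ballI allI impI)
      fix x and U W :: "'q \<times> 'p multiset \<Rightarrow> real" and \<delta>
      assume x: "x \<in> \<Omega>" and UW: "\<forall>a. size (snd a) \<le> r \<longrightarrow> \<bar>U a\<bar> \<le> 1 / \<epsilon> ^ N \<and> \<bar>W a\<bar> \<le> 1 / \<epsilon> ^ N \<and> \<bar>W a\<bar> \<le> \<delta>"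
      \<comment> \<open>some coordinate of order zero exists, so the bound \<open>\<delta>\<close> is nonnegative\<close>
      have "\<bar>W (undefined, {#})\<bar> \<le> \<delta>" using UW by simp
      then have \<delta>: "\<delta> \<ge> 0" by linarith
      let ?D = "\<lambda>\<tau> a. jet_pd (Inr a) (F \<epsilon>) (x, \<lambda>a. U a + \<tau> * W a)"
      obtain \<xi> where \<xi>: "\<bar>\<xi> - 0\<bar> \<le> \<bar>1 - 0\<bar>"
        "F \<epsilon> (x, \<lambda>a. U a + 1 * W a) - F \<epsilon> (x, \<lambda>a. U a + 0 * W a) = (1 - 0) * (\<Sum>a\<in>?A. W a * ?D \<xi> a)"
        by (rule mean_value_between[of 0 1 "\<lambda>\<tau>. F \<epsilon> (x, \<lambda>a. U a + \<tau> * W a)", OF DERIV_fibre[OF \<Omega> t \<epsilon>(1) x]])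
      have "\<bar>\<Sum>a\<in>?A. W a * ?D \<xi> a\<bar> \<le> (\<Sum>a\<in>?A. \<bar>W a * ?D \<xi> a\<bar>)" by (rule sum_abs)
      also have "\<dots> \<le> (\<Sum>a\<in>?A. \<delta> * (1 / \<epsilon> ^ N1))"
        unfolding abs_mult using UW \<xi>(1) x elim(1) \<delta> by (intro sum_mono mult_mono) auto
      also have "\<dots> = real (card ?A) * (\<delta> * (1 / \<epsilon> ^ N1))" by simp
      also have "\<dots> \<le> (1 / \<epsilon>) * (\<delta> * (1 / \<epsilon> ^ N1))" using card \<delta> \<epsilon> by (intro mult_right_mono) auto
      also have "\<dots> = \<delta> * (1 / \<epsilon> ^ Suc N1)" by simp
      finally show "\<bar>F \<epsilon> (x, \<lambda>a. U a + W a) - F \<epsilon> (x, U)\<bar> \<le> \<delta> * (1 / \<epsilon> ^ Suc N1)"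
        using \<xi>(2) by simp
    qed
  qed
  then show ?thesis by (rule exI[where x = "Suc N1"])
qed

text \<open>
  Taylor expansion of first order in the jet variables.  The exponent \<open>N'\<close> depends on the bounds for
  \<open>U\<close> and \<open>W\<close> but not on \<open>s\<close>; in the main estimate \<open>s\<close> is a power of \<open>\<epsilon>\<close> that is chosen after \<open>N'\<close>.
\<close>

lemma fibre_taylor:
  fixes F :: "real \<Rightarrow> ('p::finite, 'q::finite) inf_jet \<Rightarrow> real"
  assumes \<Omega>: "open \<Omega>" and F: "jet_smooth \<Omega> r F"
  shows "\<exists>N'::nat. \<forall>\<^sub>F \<epsilon> in at_right 0. \<forall>x\<in>\<Omega>. \<forall>U W s. \<bar>s\<bar> \<le> 1 \<and>
     (\<forall>a. size (snd a) \<le> r \<longrightarrow> \<bar>U a\<bar> \<le> 1 / \<epsilon> ^ N \<and> \<bar>W a\<bar> \<le> 1 / \<epsilon> ^ N) \<longrightarrow>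
     \<bar>F \<epsilon> (x, \<lambda>a. U a + s * W a) - F \<epsilon> (x, U) - s * (\<Sum>a | size (snd a) \<le> r. W a * jet_pd (Inr a) (F \<epsilon>) (x, U))\<bar>
       \<le> s\<^sup>2 * (1 / \<epsilon> ^ N')"
proof -
  let ?A = "{a :: 'q \<times> 'p multiset. size (snd a) \<le> r}"
  have R: "jet_regular \<Omega> r (\<lambda>\<epsilon>. jet_pd d (jet_pd d' (F \<epsilon>)))" for d d'
    using F unfolding jet_smooth_def by (metis jet_tame.simps)
  have t: "jet_tame \<Omega> r (Suc 0) F" using F unfolding jet_smooth_def by blast
  have t': "jet_tame \<Omega> r (Suc 0) (\<lambda>\<epsilon>. jet_pd d (F \<epsilon>))" for d
    using F unfolding jet_smooth_def by (metis jet_tame.simps(2))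
  let ?E = "\<lambda>\<epsilon> x U W a b \<tau>. jet_pd (Inr b) (jet_pd (Inr a) (F \<epsilon>)) (x, \<lambda>a. U a + \<tau> * W a)"
  obtain N2 :: nat where N2: "\<forall>\<^sub>F \<epsilon> in at_right 0. \<forall>i\<in>?A \<times> ?A. \<forall>x\<in>\<Omega>. \<forall>U W \<tau>. \<bar>\<tau>\<bar> \<le> 1 \<and>
     (\<forall>a. size (snd a) \<le> r \<longrightarrow> \<bar>U a\<bar> \<le> 1 / \<epsilon> ^ N \<and> \<bar>W a\<bar> \<le> 1 / \<epsilon> ^ N) \<longrightarrow>
     \<bar>?E \<epsilon> x U W (fst i) (snd i) \<tau>\<bar> \<le> 1 / \<epsilon> ^ N2"
    using fibre_growth[OF finite_cartesian_product[OF finite_jet_coords finite_jet_coords],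
        of r r \<Omega> r "\<lambda>i \<epsilon>. jet_pd (Inr (snd i)) (jet_pd (Inr (fst i)) (F \<epsilon>))" N] R by blast
  have "\<forall>\<^sub>F \<epsilon> in at_right 0. \<forall>x\<in>\<Omega>. \<forall>U W s. \<bar>s\<bar> \<le> 1 \<and>
     (\<forall>a. size (snd a) \<le> r \<longrightarrow> \<bar>U a\<bar> \<le> 1 / \<epsilon> ^ N \<and> \<bar>W a\<bar> \<le> 1 / \<epsilon> ^ N) \<longrightarrow>
     \<bar>F \<epsilon> (x, \<lambda>a. U a + s * W a) - F \<epsilon> (x, U) - s * (\<Sum>a | size (snd a) \<le> r. W a * jet_pd (Inr a) (F \<epsilon>) (x, U))\<bar>
       \<le> s\<^sup>2 * (1 / \<epsilon> ^ Suc (N + (N + N2)))"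
    using N2 eventually_const_times_le_1[of "real (card ?A) * real (card ?A)"] eventually_at_right_0_less[of 1, simplified]
  proof eventually_elim
    case (elim \<epsilon>)
    then have \<epsilon>: "\<epsilon> \<in> {0<..1}" "0 < \<epsilon>" and card: "real (card ?A) * real (card ?A) \<le> 1 / \<epsilon>"
      by (auto simp: pos_le_divide_eq)
    show ?case
    proof (intro ballI allI impI, elim conjE)
      fix x and U W :: "'q \<times> 'p multiset \<Rightarrow> real" and s :: real
      assume x: "x \<in> \<Omega>" and s: "\<bar>s\<bar> \<le> 1"
        and UW: "\<forall>a. size (snd a) \<le> r \<longrightarrow> \<bar>U a\<bar> \<le> 1 / \<epsilon> ^ N \<and> \<bar>W a\<bar> \<le> 1 / \<epsilon> ^ N"
      let ?D = "\<lambda>a \<tau>. jet_pd (Inr a) (F \<epsilon>) (x, \<lambda>a. U a + \<tau> * W a)"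
      let ?S = "\<lambda>\<tau>. \<Sum>a\<in>?A. W a * ?D a \<tau>"
      let ?T = "\<lambda>\<tau>. \<Sum>a\<in>?A. W a * (\<Sum>b\<in>?A. W b * ?E \<epsilon> x U W a b \<tau>)"
      obtain \<xi> where \<xi>: "\<bar>\<xi> - 0\<bar> \<le> \<bar>s - 0\<bar>"
        "F \<epsilon> (x, \<lambda>a. U a + s * W a) - F \<epsilon> (x, \<lambda>a. U a + 0 * W a) = (s - 0) * ?S \<xi>"
        by (rule mean_value_between[of 0 s "\<lambda>\<tau>. F \<epsilon> (x, \<lambda>a. U a + \<tau> * W a)", OF DERIV_fibre[OF \<Omega> t \<epsilon>(1) x]])
      have DS: "(?S has_real_derivative ?T \<tau>) (at \<tau>)" for \<tau>
        by (intro DERIV_sum DERIV_cmult DERIV_fibre[OF \<Omega> t' \<epsilon>(1) x])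
      obtain \<eta> where \<eta>: "\<bar>\<eta> - 0\<bar> \<le> \<bar>\<xi> - 0\<bar>" "?S \<xi> - ?S 0 = (\<xi> - 0) * ?T \<eta>"
        by (rule mean_value_between[of 0 \<xi> ?S ?T, OF DS])
      have \<eta>1: "\<bar>\<eta>\<bar> \<le> 1" using \<xi>(1) \<eta>(1) s by simp
      have "\<bar>?T \<eta>\<bar> \<le> (\<Sum>a\<in>?A. \<bar>W a * (\<Sum>b\<in>?A. W b * ?E \<epsilon> x U W a b \<eta>)\<bar>)" by (rule sum_abs)
      also have "\<dots> \<le> (\<Sum>a\<in>?A. 1 / \<epsilon> ^ N * (real (card ?A) * (1 / \<epsilon> ^ N * (1 / \<epsilon> ^ N2))))"
      proof (rule sum_mono)
        fix a assume a: "a \<in> ?A"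
        have "\<bar>\<Sum>b\<in>?A. W b * ?E \<epsilon> x U W a b \<eta>\<bar> \<le> (\<Sum>b\<in>?A. \<bar>W b * ?E \<epsilon> x U W a b \<eta>\<bar>)" by (rule sum_abs)
        also have "\<dots> \<le> (\<Sum>b\<in>?A. 1 / \<epsilon> ^ N * (1 / \<epsilon> ^ N2))"
        proof (rule sum_mono)
          fix b assume b: "b \<in> ?A"
          have "\<bar>?E \<epsilon> x U W a b \<eta>\<bar> \<le> 1 / \<epsilon> ^ N2"
            using elim(1) a b x UW \<eta>1 by (metis (no_types, lifting) SigmaI fst_conv snd_conv)
          moreover have "\<bar>W b\<bar> \<le> 1 / \<epsilon> ^ N" using UW b by blast
          ultimately show "\<bar>W b * ?E \<epsilon> x U W a b \<eta>\<bar> \<le> 1 / \<epsilon> ^ N * (1 / \<epsilon> ^ N2)"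
            unfolding abs_mult using \<epsilon> by (intro mult_mono) auto
        qed
        also have "\<dots> = real (card ?A) * (1 / \<epsilon> ^ N * (1 / \<epsilon> ^ N2))" by simp
        finally have "\<bar>\<Sum>b\<in>?A. W b * ?E \<epsilon> x U W a b \<eta>\<bar> \<le> real (card ?A) * (1 / \<epsilon> ^ N * (1 / \<epsilon> ^ N2))" .
        moreover have "\<bar>W a\<bar> \<le> 1 / \<epsilon> ^ N" using UW a by blast
        ultimately show "\<bar>W a * (\<Sum>b\<in>?A. W b * ?E \<epsilon> x U W a b \<eta>)\<bar> \<le> 1 / \<epsilon> ^ N * (real (card ?A) * (1 / \<epsilon> ^ N * (1 / \<epsilon> ^ N2)))"
          unfolding abs_mult using \<epsilon> by (intro mult_mono) auto
      qed
      also have "\<dots> = (real (card ?A) * real (card ?A)) * (1 / \<epsilon> ^ N * (1 / \<epsilon> ^ N * (1 / \<epsilon> ^ N2)))" by simp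
      also have "\<dots> \<le> (1 / \<epsilon>) * (1 / \<epsilon> ^ N * (1 / \<epsilon> ^ N * (1 / \<epsilon> ^ N2)))"
        using card \<epsilon> by (intro mult_right_mono) auto
      also have "\<dots> = 1 / \<epsilon> ^ Suc (N + (N + N2))" by (simp add: power_add)
      finally have T: "\<bar>?T \<eta>\<bar> \<le> 1 / \<epsilon> ^ Suc (N + (N + N2))" .
      have "F \<epsilon> (x, \<lambda>a. U a + s * W a) - F \<epsilon> (x, U) - s * ?S 0 = s * (\<xi> * ?T \<eta>)"
        using \<xi>(2) \<eta>(2) by (simp add: algebra_simps)
      moreover have "\<bar>s * (\<xi> * ?T \<eta>)\<bar> \<le> \<bar>s\<bar> * (\<bar>s\<bar> * (1 / \<epsilon> ^ Suc (N + (N + N2))))"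
        unfolding abs_mult using \<xi>(1) T by (intro mult_left_mono mult_mono) auto
      ultimately show "\<bar>F \<epsilon> (x, \<lambda>a. U a + s * W a) - F \<epsilon> (x, U) - s * (\<Sum>a\<in>?A. W a * jet_pd (Inr a) (F \<epsilon>) (x, U))\<bar>
          \<le> s\<^sup>2 * (1 / \<epsilon> ^ Suc (N + (N + N2)))" by (simp add: power2_eq_square)
    qed
  qed
  then show ?thesis by (rule exI[where x = "Suc (N + (N + N2))"])
qed

section \<open>The first variation\<close>

lemma sum_multi_indices:
  fixes g :: "'q::finite \<times> 'p::finite multiset \<Rightarrow> real"
  assumes "\<And>\<beta> J. \<beta> \<noteq> \<alpha> \<Longrightarrow> g (\<beta>, J) = 0"
  shows "(\<Sum>a | size (snd a) \<le> r. g a) = (\<Sum>J | size J \<le> r. g (\<alpha>, J))"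
proof -
  have "(\<Sum>J | size J \<le> r. g (\<alpha>, J)) = (\<Sum>a\<in>Pair \<alpha> ` {J. size J \<le> r}. g a)"
    by (subst sum.reindex) (auto simp: inj_on_def)
  also have "\<dots> = (\<Sum>a | size (snd a) \<le> r. g a)"
  proof (rule sum.mono_neutral_left)
    show "\<forall>a\<in>{a :: 'q \<times> 'p multiset. size (snd a) \<le> r} - Pair \<alpha> ` {J. size J \<le> r}. g a = 0"
    proof
      fix a :: "'q \<times> 'p multiset" assume a: "a \<in> {a. size (snd a) \<le> r} - Pair \<alpha> ` {J. size J \<le> r}"
      obtain \<beta> J where "a = (\<beta>, J)" by (cases a)
      with a show "g a = 0" using assms[of \<beta> J] by auto
    qed
  qed (auto intro: finite_jet_coords)
  finally show ?thesis by simp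
qed

text \<open>
  The Euler operator for functions on the infinite jet space that depend on jets of order at most \<open>r\<close>.
\<close>

definition euler_expr :: "nat \<Rightarrow> 'q \<Rightarrow> (('p::finite, 'q::finite) inf_jet \<Rightarrow> real) \<Rightarrow> ('p, 'q) inf_jet \<Rightarrow> real" where
  "euler_expr r \<alpha> F z = (\<Sum>J | size J \<le> r. neg_total_deriv J (jet_pd (Inr (\<alpha>, J)) F) z)"

lemma euler_op_eq: "euler_op \<alpha> (L :: ('p::finite, 'q::finite, 'n) jet \<Rightarrow> real) = euler_expr CARD('n) \<alpha> (L \<circ> jet_proj)"
  by (simp add: fun_eq_iff euler_op_def euler_expr_def d_u_eq)

lemma jet_smooth_jet_pd: "jet_smooth \<Omega> r F \<Longrightarrow> jet_smooth \<Omega> r (\<lambda>\<epsilon>. jet_pd d (F \<epsilon>))"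
  unfolding jet_smooth_def by (metis jet_tame.simps(2))

lemma jet_smooth_euler_expr:
  fixes F :: "real \<Rightarrow> ('p::finite, 'q::finite) inf_jet \<Rightarrow> real"
  assumes \<Omega>: "open \<Omega>" and F: "jet_smooth \<Omega> r F"
  shows "jet_smooth \<Omega> (r + r) (\<lambda>\<epsilon>. euler_expr r \<alpha> (F \<epsilon>))"
  unfolding jet_smooth_def euler_expr_def
proof (intro allI jet_tame_sum[OF \<Omega> finite_multisets_size_le])
  fix k J assume J: "J \<in> {J :: 'p multiset. size J \<le> r}"
  have "length (idx_list J) = size J" by (metis mset_idx_list size_mset)
  then have "jet_tame \<Omega> (r + size J) k (\<lambda>\<epsilon>. foldr total_deriv (idx_list J) (jet_pd (Inr (\<alpha>, J)) (F \<epsilon>)))"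
    using jet_smooth_total_derivs[OF \<Omega> jet_smooth_jet_pd[OF F], of "idx_list J"] unfolding jet_smooth_def by metis
  then have "jet_tame \<Omega> (r + r) k (\<lambda>\<epsilon>. foldr total_deriv (idx_list J) (jet_pd (Inr (\<alpha>, J)) (F \<epsilon>)))"
    by (rule jet_tame_mono) (use J in simp)
  then show "jet_tame \<Omega> (r + r) k (\<lambda>\<epsilon> z. neg_total_deriv J (jet_pd (Inr (\<alpha>, J)) (F \<epsilon>)) z)"
    unfolding neg_total_deriv_def by (intro jet_tame_mult[OF \<Omega>] jet_tame_const)
qed

lemma set_integral_finite_sum:
  fixes h :: "'i \<Rightarrow> 'a::euclidean_space \<Rightarrow> real"
  assumes "finite A" "\<And>i. i \<in> A \<Longrightarrow> set_integrable lebesgue \<Omega> (h i)"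
  shows "(LINT x:\<Omega>|lebesgue. \<Sum>i\<in>A. h i x) = (\<Sum>i\<in>A. LINT x:\<Omega>|lebesgue. h i x)"
  using assms unfolding set_lebesgue_integral_def set_integrable_def
  by (simp only: scaleR_sum_right Bochner_Integration.integral_sum)

text \<open>
  Along \<open>v\<close> the total derivatives become partial derivatives, and integration by parts moves them to
  \<open>\<phi>\<close>.  The right-hand side is the first variation in the direction \<open>\<phi>\<close> of the component \<open>\<alpha>\<close>.
\<close>

lemma euler_expr_by_parts:
  fixes F :: "real \<Rightarrow> ('p::finite, 'q::finite) inf_jet \<Rightarrow> real"
  assumes \<Omega>: "open \<Omega>" and F: "jet_smooth \<Omega> r F" and \<epsilon>: "\<epsilon> \<in> {0<..1}"
    and v: "\<And>\<beta>. smooth_along Basis \<Omega> (v \<beta>)" and \<phi>: "smooth_along Basis \<Omega> \<phi>"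
    and K: "compact K" "K \<subseteq> \<Omega>" and 0: "\<And>x. x \<in> \<Omega> - K \<Longrightarrow> \<phi> x = 0"
  shows "(LINT x:\<Omega>|lebesgue. euler_expr r \<alpha> (F \<epsilon>) (inf_jet_of \<Omega> v x) * \<phi> x)
    = (LINT x:\<Omega>|lebesgue. \<Sum>a | size (snd a) \<le> r.
         jet_along \<Omega> (\<lambda>\<beta>. if \<beta> = \<alpha> then \<phi> else (\<lambda>x. 0)) x a * jet_pd (Inr a) (F \<epsilon>) (inf_jet_of \<Omega> v x))"
proof -
  let ?I = "{J :: 'p multiset. size J \<le> r}"
  let ?G = "\<lambda>J x. jet_pd (Inr (\<alpha>, J)) (F \<epsilon>) (inf_jet_of \<Omega> v x)"
  let ?js = "\<lambda>J. axes (idx_list J)"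
  have G: "smooth_along Basis \<Omega> (?G J)" for J
    by (rule smooth_along_along[OF \<Omega> jet_smooth_jet_pd[OF F] \<epsilon> v])
  have len: "length (idx_list J) = size J" for J :: "'p multiset" by (metis mset_idx_list size_mset)
  have \<phi>0: "pdiffs bs \<phi> x = 0" if "x \<in> \<Omega> - K" for bs x
    by (rule pdiffs_vanish[OF \<Omega> compact_imp_closed[OF K(1)] 0 that])
  have c: "continuous_on \<Omega> (pdiffs bs f)" if "smooth_along Basis \<Omega> f" "bs \<in> lists Basis" for bs and f :: "real ^ 'p \<Rightarrow> real"
    by (rule smooth_along_continuous[OF smooth_along_pdiffs[OF that]])
  have cG: "continuous_on \<Omega> (?G J)" for J using smooth_along_continuous[OF G] .
  have i1: "set_integrable lebesgue \<Omega> (\<lambda>x. (-1) ^ size J * (pdiffs (?js J) (?G J) x * \<phi> x))" for J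
    by (rule integral_compact_support(1)[OF \<Omega> K])
       (use 0 in \<open>auto intro!: continuous_intros c[OF G axes_in_Basis] smooth_along_continuous[OF \<phi>]\<close>)
  have i2: "set_integrable lebesgue \<Omega> (\<lambda>x. pdiffs (?js J) \<phi> x * ?G J x)" for J
    by (rule integral_compact_support(1)[OF \<Omega> K])
       (use \<phi>0 in \<open>auto intro!: continuous_intros c[OF \<phi> axes_in_Basis] cG\<close>)
  have "(LINT x:\<Omega>|lebesgue. euler_expr r \<alpha> (F \<epsilon>) (inf_jet_of \<Omega> v x) * \<phi> x)
      = (LINT x:\<Omega>|lebesgue. \<Sum>J\<in>?I. (-1) ^ size J * (pdiffs (?js J) (?G J) x * \<phi> x))"
  proof (rule set_lebesgue_integral_cong)
    show "\<forall>x. x \<in> \<Omega> \<longrightarrow> euler_expr r \<alpha> (F \<epsilon>) (inf_jet_of \<Omega> v x) * \<phi> x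
        = (\<Sum>J\<in>?I. (-1) ^ size J * (pdiffs (?js J) (?G J) x * \<phi> x))"
    proof (intro allI impI)
      fix x assume x: "x \<in> \<Omega>"
      have "neg_total_deriv J (jet_pd (Inr (\<alpha>, J)) (F \<epsilon>)) (inf_jet_of \<Omega> v x) = (-1) ^ size J * pdiffs (?js J) (?G J) x" for J
        unfolding neg_total_deriv_def
        by (simp only: pdiffs_along[OF \<Omega> jet_smooth_jet_pd[OF F] \<epsilon> v x])
      then show "euler_expr r \<alpha> (F \<epsilon>) (inf_jet_of \<Omega> v x) * \<phi> x
        = (\<Sum>J\<in>?I. (-1) ^ size J * (pdiffs (?js J) (?G J) x * \<phi> x))"
        by (simp add: euler_expr_def sum_distrib_right mult.assoc)
    qed
  qed (use \<Omega> in simp)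
  also have "\<dots> = (\<Sum>J\<in>?I. LINT x:\<Omega>|lebesgue. (-1) ^ size J * (pdiffs (?js J) (?G J) x * \<phi> x))"
    by (rule set_integral_finite_sum[OF finite_multisets_size_le i1])
  also have "\<dots> = (\<Sum>J\<in>?I. LINT x:\<Omega>|lebesgue. pdiffs (?js J) \<phi> x * ?G J x)"
  proof (rule sum.cong[OF refl])
    fix J
    have "(LINT x:\<Omega>|lebesgue. (-1) ^ size J * (pdiffs (?js J) (?G J) x * \<phi> x))
        = (-1) ^ size J * (LINT x:\<Omega>|lebesgue. pdiffs (?js J) (?G J) x * \<phi> x)" by simp
    also have "\<dots> = (LINT x:\<Omega>|lebesgue. ?G J x * pdiffs (rev (?js J)) \<phi> x)"
      by (subst integration_by_parts_iterated[OF \<Omega> G \<phi> K 0 axes_in_Basis])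
         (simp_all add: len flip: power_mult_distrib mult.assoc)
    also have "\<dots> = (LINT x:\<Omega>|lebesgue. pdiffs (?js J) \<phi> x * ?G J x)"
    proof (rule set_lebesgue_integral_cong)
      show "\<forall>x. x \<in> \<Omega> \<longrightarrow> ?G J x * pdiffs (rev (?js J)) \<phi> x = pdiffs (?js J) \<phi> x * ?G J x"
        using pdiffs_permute[OF \<phi> \<Omega> axes_in_Basis, of "idx_list J" "rev (?js J)"] by simp
    qed (use \<Omega> in simp)
    finally show "(LINT x:\<Omega>|lebesgue. (-1) ^ size J * (pdiffs (?js J) (?G J) x * \<phi> x))
        = (LINT x:\<Omega>|lebesgue. pdiffs (?js J) \<phi> x * ?G J x)" .
  qed
  also have "\<dots> = (LINT x:\<Omega>|lebesgue. \<Sum>J\<in>?I. pdiffs (?js J) \<phi> x * ?G J x)"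
    by (rule set_integral_finite_sum[OF finite_multisets_size_le i2, symmetric])
  also have "\<dots> = (LINT x:\<Omega>|lebesgue. \<Sum>a | size (snd a) \<le> r.
         jet_along \<Omega> (\<lambda>\<beta>. if \<beta> = \<alpha> then \<phi> else (\<lambda>x. 0)) x a * jet_pd (Inr a) (F \<epsilon>) (inf_jet_of \<Omega> v x))"
  proof (rule set_lebesgue_integral_cong)
    show "\<forall>x. x \<in> \<Omega> \<longrightarrow> (\<Sum>J\<in>?I. pdiffs (?js J) \<phi> x * ?G J x) = (\<Sum>a | size (snd a) \<le> r.
         jet_along \<Omega> (\<lambda>\<beta>. if \<beta> = \<alpha> then \<phi> else (\<lambda>x. 0)) x a * jet_pd (Inr a) (F \<epsilon>) (inf_jet_of \<Omega> v x))"
      by (intro allI impI, subst sum_multi_indices[where \<alpha> = \<alpha>]) (simp_all add: jet_along_in)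
  qed (use \<Omega> in simp)
  finally show ?thesis .
qed

lemma negligible_on_pdiffs:
  fixes \<Omega> :: "'a::euclidean_space set"
  assumes s: "\<And>\<epsilon>. \<epsilon> \<in> {0<..1} \<Longrightarrow> smooth_along Basis \<Omega> (e \<epsilon>)"
    and B: "\<And>bs. bs \<in> lists Basis \<Longrightarrow> moderate_on \<Omega> (\<lambda>\<epsilon> x. pdiffs bs (e \<epsilon>) x)"
    and n: "\<And>x. x \<in> \<Omega> \<Longrightarrow> \<exists>r>0. cball x r \<subseteq> \<Omega> \<and> negligible_on (cball x r) e"
    and bs: "bs \<in> lists Basis" and x: "x \<in> \<Omega>"
  shows "\<exists>r>0. cball x r \<subseteq> \<Omega> \<and> negligible_on (cball x r) (\<lambda>\<epsilon>. pdiffs bs (e \<epsilon>))"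
  using bs
proof (induction bs rule: list.induct)
  case Nil
  then show ?case using n[OF x] by simp
next
  case (Cons b bs)
  then have b: "b \<in> Basis" and bs: "bs \<in> lists Basis" by auto
  obtain r where r: "r > 0" "cball x r \<subseteq> \<Omega>" "negligible_on (cball x r) (\<lambda>\<epsilon>. pdiffs bs (e \<epsilon>))"
    using Cons.IH[OF bs] by blast
  \<comment> \<open>the bound on the second derivative required by \<open>negligible_on_pdiff\<close>\<close>
  have "b # b # bs \<in> lists Basis" using b bs by simp
  then obtain N :: nat where "\<forall>\<^sub>F \<epsilon> in at_right 0. \<forall>x\<in>\<Omega>. \<bar>pdiff b (pdiff b (pdiffs bs (e \<epsilon>))) x\<bar> \<le> 1 / \<epsilon> ^ N"
    using B by fastforce
  from negligible_on_pdiff[OF r(1,2) b smooth_along_pdiffs[OF s bs] this r(3)]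
  have "negligible_on (cball x (r / 2)) (\<lambda>\<epsilon>. pdiffs (b # bs) (e \<epsilon>))" by simp
  moreover have "cball x (r / 2) \<subseteq> \<Omega>" using r(1,2) by (auto intro!: subsetD[OF r(2)])
  ultimately show ?case using r(1) by (intro exI[of _ "r / 2"]) simp
qed

lemma jet_along_lincomb:
  fixes c d :: real
  assumes \<Omega>: "open \<Omega>" and u: "\<And>\<beta>. smooth_along Basis \<Omega> (u \<beta>)" and v: "\<And>\<beta>. smooth_along Basis \<Omega> (v \<beta>)"
    and x: "x \<in> \<Omega>"
  shows "jet_along \<Omega> (\<lambda>\<beta> x. c * u \<beta> x + d * v \<beta> x) x a = c * jet_along \<Omega> u x a + d * jet_along \<Omega> v x a"
  using x by (simp add: jet_along_in pdiffs_lincomb[OF \<Omega> u v axes_in_Basis])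

text \<open>
  The main estimate.  The assumption \<open>min\<close> is minimality in terms of representatives: no perturbation
  vanishing on the boundary lowers the action by more than a negligible amount.  It is applied to the
  perturbation \<open>- \<epsilon>\<^sup>k \<theta> E\<close> of the component \<open>\<alpha>\<close>, for which the first-order term of the action has the sign
  of \<open>- \<integral> \<theta> E\<^sup>2\<close>.
\<close>

lemma euler_expr_negligible:
  fixes F :: "real \<Rightarrow> ('p::finite, 'q::finite) inf_jet \<Rightarrow> real" and v :: "'q \<Rightarrow> (real ^ 'p) net"
  assumes \<Omega>: "open \<Omega>" "bounded \<Omega>" and F: "jet_smooth \<Omega> r F"
    and v: "jets_moderate \<Omega> v" and sv: "\<And>\<epsilon> \<beta>. \<epsilon> \<in> {0<..1} \<Longrightarrow> smooth_along Basis \<Omega> (v \<beta> \<epsilon>)"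
    and min: "\<And>w (m::nat). \<lbrakk>\<And>\<beta>. w \<beta> \<in> moderate \<Omega> (closure \<Omega>);
        \<forall>\<beta>. \<forall>\<epsilon>\<in>{0<..1}. \<forall>x\<in>frontier \<Omega>. w \<beta> \<epsilon> x = 0\<rbrakk> \<Longrightarrow>
      \<forall>\<^sub>F \<epsilon> in at_right 0.
        set_integrable lebesgue \<Omega> (\<lambda>x. F \<epsilon> (inf_jet_of \<Omega> (\<lambda>\<beta> x. v \<beta> \<epsilon> x + w \<beta> \<epsilon> x) x)) \<and>
        set_integrable lebesgue \<Omega> (\<lambda>x. F \<epsilon> (inf_jet_of \<Omega> (\<lambda>\<beta>. v \<beta> \<epsilon>) x)) \<and>
        - (\<epsilon> ^ m) \<le> (LINT x:\<Omega>|lebesgue. F \<epsilon> (inf_jet_of \<Omega> (\<lambda>\<beta> x. v \<beta> \<epsilon> x + w \<beta> \<epsilon> x) x))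
          - (LINT x:\<Omega>|lebesgue. F \<epsilon> (inf_jet_of \<Omega> (\<lambda>\<beta>. v \<beta> \<epsilon>) x))"
    and R: "R > 0" "cball x0 R \<subseteq> \<Omega>"
  shows "negligible_on (cball x0 (R / 4)) (\<lambda>\<epsilon> x. euler_expr r \<alpha> (F \<epsilon>) (inf_jet_of \<Omega> (\<lambda>\<beta>. v \<beta> \<epsilon>) x))"
proof -
  let ?j = "\<lambda>\<epsilon>. inf_jet_of \<Omega> (\<lambda>\<beta>. v \<beta> \<epsilon>)"
  define E where "E \<epsilon> x = euler_expr r \<alpha> (F \<epsilon>) (?j \<epsilon> x)" for \<epsilon> x
  obtain \<theta> c where \<theta>: "smooth_along Basis UNIV \<theta>" "\<And>x. 0 \<le> \<theta> x" "\<And>x. x \<notin> ball x0 R \<Longrightarrow> \<theta> x = 0" "c > 0"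
    "\<And>x. x \<in> cball x0 (R / 2) \<Longrightarrow> c \<le> \<theta> x"
    using bump_exists[OF R(1), of x0] by blast
  let ?K = "cball x0 R"
  have K: "compact ?K" "?K \<subseteq> \<Omega>" using R by auto
  note eF = jet_smooth_euler_expr[OF \<Omega>(1) F, of \<alpha>]
  have sE: "smooth_along Basis \<Omega> (E \<epsilon>)" if "\<epsilon> \<in> {0<..1}" for \<epsilon>
    unfolding E_def by (rule smooth_along_along[OF \<Omega>(1) eF that sv[OF that]])
  have bE: "moderate_on \<Omega> (\<lambda>\<epsilon> x. pdiffs bs (E \<epsilon>) x)" if "bs \<in> lists Basis" for bs
    unfolding E_def by (rule along_pdiffs_bound[OF \<Omega>(1) eF v sv that])
  define \<phi> where "\<phi> \<epsilon> x = (if x \<in> \<Omega> then \<theta> x * E \<epsilon> x else 0)" for \<epsilon> x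
  have \<phi>0: "\<phi> \<epsilon> x = 0" if "x \<notin> ?K" for \<epsilon> x using that \<theta>(3)[of x] by (auto simp: \<phi>_def)
  have \<theta>s: "smooth_along Basis \<Omega> \<theta>" using \<theta>(1) unfolding smooth_along_def by (meson UNIV_I continuous_on_subset subset_UNIV)
  have "jet_smooth \<Omega> (r + r) (\<lambda>\<epsilon> z :: ('p, 'q) inf_jet. \<theta> (fst z))"
  proof (rule jet_smooth_base_function[OF \<theta>s])
    fix bs :: "(real ^ 'p) list" assume bs: "bs \<in> lists Basis"
    have "compact (pdiffs bs \<theta> ` closure \<Omega>)"
      using \<Omega>(2) by (intro compact_continuous_image continuous_on_subset[OF smooth_along_continuous[OF smooth_along_pdiffs[OF \<theta>(1) bs]]])
        (auto simp: compact_closure)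
    then obtain C where "\<forall>y\<in>pdiffs bs \<theta> ` closure \<Omega>. norm y \<le> C" using compact_imp_bounded bounded_iff by blast
    then show "\<exists>C. \<forall>x\<in>\<Omega>. \<bar>pdiffs bs \<theta> x\<bar> \<le> C" using closure_subset[of \<Omega>] by (intro exI[of _ C]) auto
  qed
  then have P: "jet_smooth \<Omega> (r + r) (\<lambda>\<epsilon> z. \<theta> (fst z) * euler_expr r \<alpha> (F \<epsilon>) z)"
    using eF jet_tame_mult[OF \<Omega>(1)] unfolding jet_smooth_def by blast
  let ?P = "\<lambda>\<epsilon> x. \<theta> (fst (?j \<epsilon> x)) * euler_expr r \<alpha> (F \<epsilon>) (?j \<epsilon> x)"
  have \<phi>P: "?P \<epsilon> x = \<phi> \<epsilon> x" if "x \<in> \<Omega>" for \<epsilon> x using that by (simp add: \<phi>_def E_def)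
  have s\<phi>: "smooth_along Basis \<Omega> (\<phi> \<epsilon>)" if "\<epsilon> \<in> {0<..1}" for \<epsilon>
    by (rule smooth_along_cong[OF \<Omega>(1) \<phi>P smooth_along_along[OF \<Omega>(1) P that sv[OF that]]])
  have b\<phi>: "moderate_on \<Omega> (\<lambda>\<epsilon> x. pdiffs bs (\<phi> \<epsilon>) x)" if bs: "bs \<in> lists Basis" for bs
  proof -
    have "pdiffs bs (?P \<epsilon>) x = pdiffs bs (\<phi> \<epsilon>) x" if "x \<in> \<Omega>" for \<epsilon> x
      by (rule pdiffs_cong[OF \<Omega>(1) that]) (rule \<phi>P)
    then show ?thesis using along_pdiffs_bound[OF \<Omega>(1) P v sv bs] by simp
  qed
  \<comment> \<open>the direction of the variation; the test function \<open>\<phi>\<close> is the value along \<open>v\<close> of a net on the jet space, hence moderate\<close>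
  define w where "w \<beta> \<epsilon> = (if \<beta> = \<alpha> then \<phi> \<epsilon> else (\<lambda>x. 0))" for \<beta> \<epsilon>
  have sw: "smooth_along Basis \<Omega> (w \<beta> \<epsilon>)" if "\<epsilon> \<in> {0<..1}" for \<beta> \<epsilon>
    using s\<phi>[OF that] by (simp add: w_def)
  have bw: "moderate_on \<Omega> (\<lambda>\<epsilon> x. pdiffs bs (w \<beta> \<epsilon>) x)" if "bs \<in> lists Basis" for \<beta> bs
  proof (cases "\<beta> = \<alpha>")
    case True
    then show ?thesis using b\<phi>[OF that] by (simp add: w_def)
  next
    case False
    have "\<forall>\<^sub>F \<epsilon> in at_right 0. \<forall>x\<in>\<Omega>. \<bar>pdiffs bs (w \<beta> \<epsilon>) x\<bar> \<le> 1 / \<epsilon> ^ 0"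
      using False by (simp add: w_def)
    then show ?thesis by blast
  qed
  have mw: "jets_moderate \<Omega> w"
    by (rule jets_moderateI) (use bw[OF axes_in_Basis] in \<open>simp add: jet_along_in cong: ball_cong\<close>)
  have w0: "w \<beta> \<epsilon> x = 0" if "x \<notin> ?K" for \<beta> \<epsilon> x using \<phi>0[OF that] by (simp add: w_def)
  define I where "I \<epsilon> = (LINT x:\<Omega>|lebesgue. \<theta> x * (E \<epsilon> x)\<^sup>2)" for \<epsilon>
  define S where "S \<epsilon> x = (\<Sum>a | size (snd a) \<le> r. jet_along \<Omega> (\<lambda>\<beta>. w \<beta> \<epsilon>) x a * jet_pd (Inr a) (F \<epsilon>) (?j \<epsilon> x))" for \<epsilon> x
  have I_eq: "(LINT x:\<Omega>|lebesgue. S \<epsilon> x) = I \<epsilon>" if \<epsilon>: "\<epsilon> \<in> {0<..1}" for \<epsilon>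
  proof -
    have "(LINT x:\<Omega>|lebesgue. S \<epsilon> x) = (LINT x:\<Omega>|lebesgue. E \<epsilon> x * \<phi> \<epsilon> x)"
      unfolding S_def E_def w_def
      by (rule euler_expr_by_parts[OF \<Omega>(1) F \<epsilon> sv[OF \<epsilon>] s\<phi>[OF \<epsilon>] K, symmetric]) (use \<phi>0 in auto)
    also have "\<dots> = I \<epsilon>" unfolding I_def
      by (rule set_lebesgue_integral_cong) (use \<Omega>(1) in \<open>auto simp: \<phi>_def power2_eq_square\<close>)
    finally show ?thesis .
  qed
  have S_int: "set_integrable lebesgue \<Omega> (S \<epsilon>)" if \<epsilon>: "\<epsilon> \<in> {0<..1}" for \<epsilon>
  proof (rule integral_compact_support(1)[OF \<Omega>(1) K])
    have "continuous_on \<Omega> (\<lambda>x. jet_along \<Omega> (\<lambda>\<beta>. w \<beta> \<epsilon>) x a)" for a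
      using smooth_along_continuous[OF smooth_along_pdiffs[OF sw[OF \<epsilon>] axes_in_Basis]]
      by (simp add: jet_along_in cong: continuous_on_cong)
    moreover have "continuous_on \<Omega> (\<lambda>x. jet_pd d (F \<epsilon>) (?j \<epsilon> x))" for d
      by (rule smooth_along_continuous[OF smooth_along_along[OF \<Omega>(1) jet_smooth_jet_pd[OF F] \<epsilon> sv[OF \<epsilon>]]])
    ultimately show "continuous_on \<Omega> (S \<epsilon>)" unfolding S_def by (intro continuous_intros)
    fix x assume x: "x \<in> \<Omega> - ?K"
    then have "jet_along \<Omega> (\<lambda>\<beta>. w \<beta> \<epsilon>) x a = 0" for a
      using pdiffs_vanish[OF \<Omega>(1) closed_cball _ x, of "w (fst a) \<epsilon>"] w0 by (simp add: jet_along_in)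
    then show "S \<epsilon> x = 0" by (simp add: S_def)
  qed
  obtain Nv :: nat where Nv: "\<forall>\<^sub>F \<epsilon> in at_right 0. \<forall>x\<in>\<Omega>. \<forall>a. size (snd a) \<le> r \<longrightarrow>
     \<bar>jet_along \<Omega> (\<lambda>\<beta>. v \<beta> \<epsilon>) x a\<bar> \<le> 1 / \<epsilon> ^ Nv" using v unfolding jets_moderate_def by blast
  obtain Nw :: nat where Nw: "\<forall>\<^sub>F \<epsilon> in at_right 0. \<forall>x\<in>\<Omega>. \<forall>a. size (snd a) \<le> r \<longrightarrow>
     \<bar>jet_along \<Omega> (\<lambda>\<beta>. w \<beta> \<epsilon>) x a\<bar> \<le> 1 / \<epsilon> ^ Nw" using mw unfolding jets_moderate_def by blast
  obtain N :: nat where N: "\<forall>\<^sub>F \<epsilon> in at_right 0. \<forall>x\<in>\<Omega>. \<forall>U W s. \<bar>s\<bar> \<le> 1 \<and>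
     (\<forall>a. size (snd a) \<le> r \<longrightarrow> \<bar>U a\<bar> \<le> 1 / \<epsilon> ^ (Nv + Nw) \<and> \<bar>W a\<bar> \<le> 1 / \<epsilon> ^ (Nv + Nw)) \<longrightarrow>
     \<bar>F \<epsilon> (x, \<lambda>a. U a + s * W a) - F \<epsilon> (x, U) - s * (\<Sum>a | size (snd a) \<le> r. W a * jet_pd (Inr a) (F \<epsilon>) (x, U))\<bar>
       \<le> s\<^sup>2 * (1 / \<epsilon> ^ N)"
    using fibre_taylor[OF \<Omega>(1) F] by blast
  have taylor: "\<forall>\<^sub>F \<epsilon> in at_right 0. \<forall>s. \<bar>s\<bar> \<le> 1 \<longrightarrow> (\<forall>x\<in>\<Omega>.
      F \<epsilon> (inf_jet_of \<Omega> (\<lambda>\<beta> x. v \<beta> \<epsilon> x + s * w \<beta> \<epsilon> x) x) - F \<epsilon> (?j \<epsilon> x) - s * S \<epsilon> x \<le> s\<^sup>2 * (1 / \<epsilon> ^ N))"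
    using Nv Nw N eventually_at_right_0_less[of 1, simplified]
  proof eventually_elim
    case (elim \<epsilon>)
    then have \<epsilon>: "\<epsilon> \<in> {0<..1}" by simp
    show ?case
    proof (intro allI impI ballI)
      fix s :: real and x assume s: "\<bar>s\<bar> \<le> 1" and x: "x \<in> \<Omega>"
      let ?U = "jet_along \<Omega> (\<lambda>\<beta>. v \<beta> \<epsilon>) x" and ?W = "jet_along \<Omega> (\<lambda>\<beta>. w \<beta> \<epsilon>) x"
      have j: "jet_along \<Omega> (\<lambda>\<beta> x. v \<beta> \<epsilon> x + s * w \<beta> \<epsilon> x) x = (\<lambda>a. ?U a + s * ?W a)"
        proof
        fix a
        show "jet_along \<Omega> (\<lambda>\<beta> x. v \<beta> \<epsilon> x + s * w \<beta> \<epsilon> x) x a = ?U a + s * ?W a"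
          using jet_along_lincomb[OF \<Omega>(1), where u = "\<lambda>\<beta>. v \<beta> \<epsilon>" and v = "\<lambda>\<beta>. w \<beta> \<epsilon>" and c = 1 and d = s,
              OF sv[OF \<epsilon>] sw[OF \<epsilon>] x] by simp
      qed
      have e1: "inf_jet_of \<Omega> (\<lambda>\<beta> x. v \<beta> \<epsilon> x + s * w \<beta> \<epsilon> x) x = (x, \<lambda>a. ?U a + s * ?W a)"
        by (subst inf_jet_of_eq) (simp only: j)
      have e2: "?j \<epsilon> x = (x, ?U)" by (rule inf_jet_of_eq)
      have e: "1 / \<epsilon> ^ Nv \<le> 1 / \<epsilon> ^ (Nv + Nw)" "1 / \<epsilon> ^ Nw \<le> 1 / \<epsilon> ^ (Nv + Nw)"
        using \<epsilon> by (auto intro!: inverse_power_mono)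
      have UW: "\<bar>?U a\<bar> \<le> 1 / \<epsilon> ^ (Nv + Nw) \<and> \<bar>?W a\<bar> \<le> 1 / \<epsilon> ^ (Nv + Nw)" if "size (snd a) \<le> r" for a
        using elim(1)[rule_format, OF x that] elim(2)[rule_format, OF x that] e by linarith
      have "\<bar>F \<epsilon> (x, \<lambda>a. ?U a + s * ?W a) - F \<epsilon> (x, ?U) - s * (\<Sum>a | size (snd a) \<le> r. ?W a * jet_pd (Inr a) (F \<epsilon>) (x, ?U))\<bar>
         \<le> s\<^sup>2 * (1 / \<epsilon> ^ N)"
        by (rule elim(3)[rule_format, OF x]) (use s UW in blast)
      then show "F \<epsilon> (inf_jet_of \<Omega> (\<lambda>\<beta> x. v \<beta> \<epsilon> x + s * w \<beta> \<epsilon> x) x) - F \<epsilon> (?j \<epsilon> x) - s * S \<epsilon> x \<le> s\<^sup>2 * (1 / \<epsilon> ^ N)"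
        unfolding S_def e1[symmetric] e2[symmetric]
        by linarith
    qed
  qed
  have small: "\<forall>\<^sub>F \<epsilon> in at_right 0. I \<epsilon> \<le> \<epsilon> ^ m" for m
  proof -
    \<comment> \<open>the remainder \<open>\<epsilon>\<^bsup>2 k - N\<^esup>\<close> is then \<open>\<epsilon>\<^sup>k\<close> times \<open>\<epsilon>\<^bsup>m + 1\<^esup>\<close>, and the last factor \<open>\<epsilon>\<close> absorbs the volume of \<open>\<Omega>\<close>\<close>
    define k where "k = N + Suc m"
    define wk where "wk \<beta> \<epsilon> = (\<lambda>x. (- (\<epsilon> ^ k)) * w \<beta> \<epsilon> x)" for \<beta> \<epsilon>
    have wk: "wk \<beta> \<in> moderate \<Omega> (closure \<Omega>)" for \<beta>
    proof (rule compact_support_moderate[OF \<Omega>(1) K])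
      show "smooth_along Basis \<Omega> (wk \<beta> \<epsilon>)" if "\<epsilon> \<in> {0<..1}" for \<epsilon>
        using smooth_along_lincomb[OF \<Omega>(1) sw[OF that] smooth_along_zero, of "- (\<epsilon> ^ k)" \<beta> 0] by (simp add: wk_def)
      show "wk \<beta> \<epsilon> x = 0" if "x \<notin> ?K" for \<epsilon> x using w0[OF that] by (simp add: wk_def)
      fix bs :: "(real ^ 'p) list" assume bs: "bs \<in> lists Basis"
      obtain n :: nat where "\<forall>\<^sub>F \<epsilon> in at_right 0. \<forall>x\<in>\<Omega>. \<bar>pdiffs bs (w \<beta> \<epsilon>) x\<bar> \<le> 1 / \<epsilon> ^ n" using bw[OF bs] by blast
      then have "\<forall>\<^sub>F \<epsilon> in at_right 0. \<forall>x\<in>\<Omega>. \<bar>pdiffs bs (wk \<beta> \<epsilon>) x\<bar> \<le> 1 * (1 / \<epsilon> ^ n)"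
        using eventually_at_right_0_less[of 1, simplified]
      proof eventually_elim
        case (elim \<epsilon>)
        then have \<epsilon>: "\<epsilon> \<in> {0<..1}" by simp
        show ?case
        proof
          fix x assume x: "x \<in> \<Omega>"
          have "pdiffs bs (wk \<beta> \<epsilon>) x = - (\<epsilon> ^ k) * pdiffs bs (w \<beta> \<epsilon>) x"
            using pdiffs_lincomb[OF \<Omega>(1) sw[OF \<epsilon>] smooth_along_zero bs x, of "- (\<epsilon> ^ k)" \<beta> 0] by (simp add: wk_def)
          moreover have "\<bar>- (\<epsilon> ^ k)\<bar> \<le> 1" using \<epsilon> by (simp add: power_le_one)
          ultimately show "\<bar>pdiffs bs (wk \<beta> \<epsilon>) x\<bar> \<le> 1 * (1 / \<epsilon> ^ n)"
            unfolding \<open>pdiffs bs (wk \<beta> \<epsilon>) x = _\<close> abs_mult using elim x by (intro mult_mono) auto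
        qed
      qed
      then show "\<exists>n. sup_bigo \<Omega> (\<lambda>\<epsilon>. pdiffs bs (wk \<beta> \<epsilon>)) (\<lambda>\<epsilon>. 1 / \<epsilon> ^ n)" unfolding sup_bigo_def by blast
    qed
    have wkf: "\<forall>\<beta>. \<forall>\<epsilon>\<in>{0<..1}. \<forall>x\<in>frontier \<Omega>. wk \<beta> \<epsilon> x = 0"
    proof (intro allI ballI)
      fix \<beta> \<epsilon> x assume "x \<in> frontier \<Omega>"
      then have "x \<notin> \<Omega>" using \<Omega>(1) by (simp add: frontier_def interior_open)
      then have "x \<notin> ?K" using K by blast
      then show "wk \<beta> \<epsilon> x = 0" using w0 by (simp add: wk_def)
    qed
    define V where "V = measure lebesgue \<Omega>"
    have V: "V \<ge> 0" by (simp add: V_def)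
    show ?thesis
      using min[where w = wk and m = "2 * k", OF wk wkf] taylor eventually_const_times_le_1[of "1 + V"] eventually_at_right_0_less[of 1, simplified]
    proof eventually_elim
      case (elim \<epsilon>)
      then have \<epsilon>: "\<epsilon> \<in> {0<..1}" "0 < \<epsilon>" "\<epsilon> \<le> 1" by auto
      let ?s = "- (\<epsilon> ^ k)"
      have s1: "\<bar>?s\<bar> \<le> 1" using \<epsilon> by (simp add: power_le_one)
      have s2: "?s\<^sup>2 * (1 / \<epsilon> ^ N) = \<epsilon> ^ k * \<epsilon> ^ Suc m"
        using \<epsilon> by (simp add: k_def power_add power2_eq_square)
      let ?f = "\<lambda>x. F \<epsilon> (inf_jet_of \<Omega> (\<lambda>\<beta> x. v \<beta> \<epsilon> x + wk \<beta> \<epsilon> x) x)" and ?g = "\<lambda>x. F \<epsilon> (?j \<epsilon> x)"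
      have fi: "set_integrable lebesgue \<Omega> ?f" and gi: "set_integrable lebesgue \<Omega> ?g"
        and le: "- (\<epsilon> ^ (2 * k)) \<le> (LINT x:\<Omega>|lebesgue. ?f x) - (LINT x:\<Omega>|lebesgue. ?g x)" using elim(1) by auto
      have si: "set_integrable lebesgue \<Omega> (\<lambda>x. ?s * S \<epsilon> x)" 
        by (intro set_integrable_mult_right S_int[OF \<epsilon>(1)])
      have "(LINT x:\<Omega>|lebesgue. ?f x) - (LINT x:\<Omega>|lebesgue. ?g x) - ?s * I \<epsilon>
          = (LINT x:\<Omega>|lebesgue. ?f x - ?g x - ?s * S \<epsilon> x)"
        unfolding set_integral_diff(2)[OF set_integral_diff(1)[OF fi gi] si] set_integral_diff(2)[OF fi gi]
          set_integral_mult_right I_eq[OF \<epsilon>(1)] ..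
      also have "\<dots> \<le> (\<epsilon> ^ k * \<epsilon> ^ Suc m) * V"
        unfolding V_def
      proof (rule set_integral_le_measure[OF \<Omega>])
        show "set_integrable lebesgue \<Omega> (\<lambda>x. ?f x - ?g x - ?s * S \<epsilon> x)"
          by (intro set_integral_diff(1) fi gi si)
        show "?f x - ?g x - ?s * S \<epsilon> x \<le> \<epsilon> ^ k * \<epsilon> ^ Suc m" if "x \<in> \<Omega>" for x
          using elim(2)[rule_format, OF s1 that] unfolding s2 wk_def .
      qed
      finally have "\<epsilon> ^ k * I \<epsilon> \<le> \<epsilon> ^ (2 * k) + (\<epsilon> ^ k * \<epsilon> ^ Suc m) * V" using le by simp
      also have "\<epsilon> ^ (2 * k) \<le> \<epsilon> ^ k * \<epsilon> ^ Suc m"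
      proof -
        have "\<epsilon> ^ (2 * k) \<le> \<epsilon> ^ (k + Suc m)" using \<epsilon> by (intro power_decreasing) (auto simp: k_def)
        then show ?thesis by (simp only: power_add)
      qed
      finally have "\<epsilon> ^ k * I \<epsilon> \<le> \<epsilon> ^ k * ((1 + V) * \<epsilon> * \<epsilon> ^ m)" by (simp add: algebra_simps)
      then have "I \<epsilon> \<le> (1 + V) * \<epsilon> * \<epsilon> ^ m" using \<epsilon> by simp
      also have "\<dots> \<le> 1 * \<epsilon> ^ m" using elim(3) \<epsilon> by (intro mult_right_mono) auto
      finally show "I \<epsilon> \<le> \<epsilon> ^ m" by simp
    qed
  qed
  have "\<exists>N::nat. \<forall>\<^sub>F \<epsilon> in at_right 0. \<forall>b\<in>Basis. \<forall>x\<in>\<Omega>. \<bar>pdiff b (E \<epsilon>) x\<bar> \<le> 1 / \<epsilon> ^ N"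
  proof (rule eventually_uniform_bound[OF finite_Basis])
    fix b :: "real ^ 'p" assume "b \<in> Basis"
    then show "moderate_on \<Omega> (\<lambda>\<epsilon> x. pdiff b (E \<epsilon>) x)" using bE[of "[b]"] by simp
  next
    fix b and m n :: nat and \<epsilon> :: real
    assume *: "\<forall>x\<in>\<Omega>. \<bar>pdiff b (E \<epsilon>) x\<bar> \<le> 1 / \<epsilon> ^ m" "m \<le> n" "0 < \<epsilon>" "\<epsilon> < 1"
    have "1 / \<epsilon> ^ m \<le> 1 / \<epsilon> ^ n" using * by (intro inverse_power_mono) auto
    then show "\<forall>x\<in>\<Omega>. \<bar>pdiff b (E \<epsilon>) x\<bar> \<le> 1 / \<epsilon> ^ n" using *(1) by force
  qed
  then obtain N' :: nat where N': "\<forall>\<^sub>F \<epsilon> in at_right 0. \<forall>b\<in>Basis. \<forall>x\<in>\<Omega>. \<bar>pdiff b (E \<epsilon>) x\<bar> \<le> 1 / \<epsilon> ^ N'" by blast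
  have "negligible_on (cball x0 (R / 2 / 2)) E"
  proof (rule negligible_from_integral[OF _ _ \<Omega>(1) sE N' \<theta>(2) \<theta>(4) \<theta>(5)])
    show "cball x0 (R / 2) \<subseteq> \<Omega>" using R by (auto intro!: subsetD[OF R(2)])
    show "set_integrable lebesgue \<Omega> (\<lambda>x. \<theta> x * (E \<epsilon> x)\<^sup>2)" if "\<epsilon> \<in> {0<..1}" for \<epsilon>
    proof (rule integral_compact_support(1)[OF \<Omega>(1) K])
      show "continuous_on \<Omega> (\<lambda>x. \<theta> x * (E \<epsilon> x)\<^sup>2)"
        by (intro continuous_intros smooth_along_continuous[OF \<theta>s] smooth_along_continuous[OF sE[OF that]])
      show "\<theta> x * (E \<epsilon> x)\<^sup>2 = 0" if "x \<in> \<Omega> - ?K" for x using that \<theta>(3)[of x] by auto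
    qed
  qed (use R small in \<open>auto simp: I_def\<close>)
  then show ?thesis unfolding E_def by simp
qed

section \<open>Representatives of the action\<close>

lemma real_negligible_bound:
  assumes "x \<in> real_negligible"
  shows "\<forall>\<^sub>F \<epsilon> in at_right 0. \<bar>x \<epsilon>\<bar> \<le> \<epsilon> ^ m"
proof -
  have "x \<in> O[at_right 0](\<lambda>\<epsilon>. \<epsilon> ^ Suc m)" using assms unfolding real_negligible_def by blast
  then obtain c where c: "\<forall>\<^sub>F \<epsilon> in at_right 0. norm (x \<epsilon>) \<le> c * norm (\<epsilon> ^ Suc m)"
    by (rule landau_o.bigE)
  from c eventually_const_times_le_1[of c] show ?thesis
  proof eventually_elim
    case (elim \<epsilon>)
    then have "c * norm (\<epsilon> ^ Suc m) = (c * \<epsilon>) * \<epsilon> ^ m" by (simp add: abs_mult power_abs)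
    also have "\<dots> \<le> 1 * \<epsilon> ^ m" using elim by (intro mult_right_mono) auto
    finally have "c * norm (\<epsilon> ^ Suc m) \<le> \<epsilon> ^ m" by (simp only: mult_1)
    with elim(1) show ?case by (simp only: real_norm_def)
  qed
qed

text \<open>
  The order on generalized numbers provides some representatives that are ordered up to negligible
  errors.
\<close>

lemma greal_leE:
  assumes "greal_le X Y"
  obtains x y where "x \<in> X" "y \<in> Y" "\<And>m::nat. \<forall>\<^sub>F \<epsilon> in at_right 0. - (\<epsilon> ^ m) \<le> y \<epsilon> - x \<epsilon>"
proof -
  obtain z where z: "z \<in> greal_diff Y X" "\<forall>\<epsilon>\<in>{0<..1}. 0 \<le> z \<epsilon>"
    using assms unfolding greal_le_def greal_nonneg_def by blast
  then obtain x y where xy: "x \<in> X" "y \<in> Y" "(\<lambda>\<epsilon>. y \<epsilon> - x \<epsilon> - z \<epsilon>) \<in> real_negligible"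
    unfolding greal_diff_def greal_rel_def by auto
  have "\<forall>\<^sub>F \<epsilon> in at_right 0. - (\<epsilon> ^ m) \<le> y \<epsilon> - x \<epsilon>" for m
    using real_negligible_bound[OF xy(3), of m] eventually_at_right_0_less[of 1, simplified]
  proof eventually_elim
    case (elim \<epsilon>)
    then have "0 \<le> z \<epsilon>" using z(2) by simp
    then show ?case using elim(1) by linarith
  qed
  then show thesis using that xy by blast
qed

text \<open>
  Every representative of the action is, up to a negligible error, the integral of a function in
  \<open>C\<^sup>\<infinity>\<close> of the closure that differs negligibly from a Lagrangian density along some representative of \<open>u\<close>.
\<close>

lemma functionalE:
  fixes L :: "('p::finite, 'q::finite, 'n) jet net set"
  assumes "x \<in> functional \<Omega> L u"
  obtains M v f where "M \<in> L" "v \<in> Pi UNIV u" "\<And>\<epsilon>. \<epsilon> \<in> {0<..1} \<Longrightarrow> f \<epsilon> \<in> cinf \<Omega> (closure \<Omega>)"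
    "(\<lambda>\<epsilon> x. M \<epsilon> (jet_of \<Omega> (\<lambda>\<alpha>. v \<alpha> \<epsilon>) x) - f \<epsilon> x) \<in> negligible_nets \<Omega> (closure \<Omega>)"
    "\<And>m::nat. \<forall>\<^sub>F \<epsilon> in at_right 0. \<bar>(LINT x:\<Omega>|lebesgue. f \<epsilon> x) - x \<epsilon>\<bar> \<le> \<epsilon> ^ m"
proof -
  obtain f where f: "f \<in> tau_compose \<Omega> L u" "(\<lambda>\<epsilon>. (LINT x:\<Omega>|lebesgue. f \<epsilon> x) - x \<epsilon>) \<in> real_negligible"
    using assms unfolding functional_def greal_rel_def by auto
  then obtain M v where "M \<in> L" "v \<in> Pi UNIV u" "f \<in> moderate \<Omega> (closure \<Omega>)"
    "(\<lambda>\<epsilon> x. M \<epsilon> (jet_of \<Omega> (\<lambda>\<alpha>. v \<alpha> \<epsilon>) x) - f \<epsilon> x) \<in> negligible_nets \<Omega> (closure \<Omega>)"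
    unfolding tau_compose_def colombeau_rel_def net_rel_def by auto
  then show thesis using that moderateD(1) real_negligible_bound[OF f(2)] by blast
qed

lemma negligible_nets_on:
  assumes "bounded \<Omega>" "u \<in> negligible_nets \<Omega> (closure \<Omega>)"
  shows "negligible_on \<Omega> u"
proof -
  have "compact (closure \<Omega>)" using assms(1) by (simp add: compact_closure)
  then have "negligible_on (closure \<Omega>) (\<lambda>\<epsilon>. pdbar \<Omega> [] (u \<epsilon>))"
    unfolding negligible_on_iff using negligible_netsD(2)[OF assms(2) _ order_refl, of "[]"] by simp
  then have "negligible_on \<Omega> (\<lambda>\<epsilon>. pdbar \<Omega> [] (u \<epsilon>))" by (rule negligible_on_subset) (rule closure_subset)
  then show ?thesis by (simp add: negligible_on_def pdbar_def cong: ball_cong)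
qed

text \<open>
  A function in \<open>C\<^sup>\<infinity>\<close> of the closure is bounded, hence integrable over the bounded set \<open>\<Omega>\<close>, and this
  property passes to continuous functions at a bounded distance.
\<close>

lemma integral_of_negligible_difference:
  fixes \<Omega> :: "'a::euclidean_space set"
  assumes \<Omega>: "open \<Omega>" "bounded \<Omega>"
    and f: "\<And>\<epsilon>. \<epsilon> \<in> {0<..1} \<Longrightarrow> f \<epsilon> \<in> cinf \<Omega> (closure \<Omega>)"
    and G: "\<And>\<epsilon>. \<epsilon> \<in> {0<..1} \<Longrightarrow> continuous_on \<Omega> (G \<epsilon>)"
    and n: "negligible_on \<Omega> (\<lambda>\<epsilon> x. G \<epsilon> x - f \<epsilon> x)"
  shows "\<forall>\<^sub>F \<epsilon> in at_right 0. set_integrable lebesgue \<Omega> (G \<epsilon>) \<and>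
    \<bar>(LINT x:\<Omega>|lebesgue. G \<epsilon> x) - (LINT x:\<Omega>|lebesgue. f \<epsilon> x)\<bar> \<le> \<epsilon> ^ m"
proof -
  define V where "V = measure lebesgue \<Omega>"
  have "\<forall>\<^sub>F \<epsilon> in at_right 0. \<forall>x\<in>\<Omega>. \<bar>G \<epsilon> x - f \<epsilon> x\<bar> \<le> \<epsilon> ^ Suc m" using n unfolding negligible_on_def by blast
  then show ?thesis
    using eventually_const_times_le_1[of V] eventually_at_right_0_less[of 1, simplified]
  proof eventually_elim
    case (elim \<epsilon>)
    then have \<epsilon>: "\<epsilon> \<in> {0<..1}" by simp
    have cf: "continuous_on (closure \<Omega>) (f \<epsilon>)" using f[OF \<epsilon>] by (simp add: cinf_def)
    then have "compact (f \<epsilon> ` closure \<Omega>)" using \<Omega>(2) by (intro compact_continuous_image) (auto simp: compact_closure)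
    then obtain C where C: "\<forall>y\<in>f \<epsilon> ` closure \<Omega>. norm y \<le> C" using compact_imp_bounded bounded_iff by blast
    have fi: "set_integrable lebesgue \<Omega> (f \<epsilon>)"
      by (rule integrable_bounded_continuous[OF \<Omega> continuous_on_subset[OF cf closure_subset], of C])
         (use C closure_subset[of \<Omega>] in auto)
    have di: "set_integrable lebesgue \<Omega> (\<lambda>x. G \<epsilon> x - f \<epsilon> x)"
      by (rule integrable_bounded_continuous[OF \<Omega>, of _ "\<epsilon> ^ Suc m"])
         (use elim(1) in \<open>auto intro!: continuous_intros G[OF \<epsilon>] continuous_on_subset[OF cf closure_subset]\<close>)
    have Gi: "set_integrable lebesgue \<Omega> (G \<epsilon>)" using set_integral_add(1)[OF di fi] by simp
    have mi: "set_integrable lebesgue \<Omega> (\<lambda>x. f \<epsilon> x - G \<epsilon> x)" by (rule set_integral_diff(1)[OF fi Gi])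
    have "(LINT x:\<Omega>|lebesgue. G \<epsilon> x - f \<epsilon> x) \<le> \<epsilon> ^ Suc m * V" "(LINT x:\<Omega>|lebesgue. f \<epsilon> x - G \<epsilon> x) \<le> \<epsilon> ^ Suc m * V"
      unfolding V_def by (rule set_integral_le_measure[OF \<Omega> di] set_integral_le_measure[OF \<Omega> mi]; use elim(1) in force)+
    moreover have "\<epsilon> ^ Suc m * V \<le> \<epsilon> ^ m"
      using elim(2) mult_right_mono[of "V * \<epsilon>" 1 "\<epsilon> ^ m"] by (simp add: algebra_simps)
    ultimately have "\<bar>(LINT x:\<Omega>|lebesgue. G \<epsilon> x) - (LINT x:\<Omega>|lebesgue. f \<epsilon> x)\<bar> \<le> \<epsilon> ^ m"
      using set_integral_diff(2)[OF fi Gi] set_integral_diff(2)[OF Gi fi] by linarith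
    then show ?case using Gi by simp
  qed
qed

text \<open>
  Passes from the representatives hidden in the class to a preferred density \<open>G\<close>, given that \<open>G\<close>
  differs negligibly from all densities that define the class.
\<close>

lemma functional_representative:
  fixes L :: "('p::finite, 'q::finite, 'n) jet net set"
  assumes \<Omega>: "open \<Omega>" "bounded \<Omega>" and x: "x \<in> functional \<Omega> L u"
    and G: "\<And>\<epsilon>. \<epsilon> \<in> {0<..1} \<Longrightarrow> continuous_on \<Omega> (G \<epsilon>)"
    and n: "\<And>M v. \<lbrakk>M \<in> L; v \<in> Pi UNIV u\<rbrakk> \<Longrightarrow> negligible_on \<Omega> (\<lambda>\<epsilon> x. G \<epsilon> x - M \<epsilon> (jet_of \<Omega> (\<lambda>\<alpha>. v \<alpha> \<epsilon>) x))"
  shows "\<forall>\<^sub>F \<epsilon> in at_right 0. set_integrable lebesgue \<Omega> (G \<epsilon>) \<and> \<bar>(LINT x:\<Omega>|lebesgue. G \<epsilon> x) - x \<epsilon>\<bar> \<le> \<epsilon> ^ m"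
proof -
  obtain M v f where *: "M \<in> L" "v \<in> Pi UNIV u" "\<And>\<epsilon>. \<epsilon> \<in> {0<..1} \<Longrightarrow> f \<epsilon> \<in> cinf \<Omega> (closure \<Omega>)"
    "(\<lambda>\<epsilon> x. M \<epsilon> (jet_of \<Omega> (\<lambda>\<alpha>. v \<alpha> \<epsilon>) x) - f \<epsilon> x) \<in> negligible_nets \<Omega> (closure \<Omega>)"
    "\<And>m::nat. \<forall>\<^sub>F \<epsilon> in at_right 0. \<bar>(LINT x:\<Omega>|lebesgue. f \<epsilon> x) - x \<epsilon>\<bar> \<le> \<epsilon> ^ m"
    using functionalE[OF x] by blast
  have "negligible_on \<Omega> (\<lambda>\<epsilon> x. G \<epsilon> x - f \<epsilon> x)"
    using negligible_on_lincomb[OF n[OF *(1,2)] negligible_nets_on[OF \<Omega>(2) *(4)], of 1 1] by simp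
  then have "\<forall>\<^sub>F \<epsilon> in at_right 0. set_integrable lebesgue \<Omega> (G \<epsilon>) \<and>
      \<bar>(LINT x:\<Omega>|lebesgue. G \<epsilon> x) - (LINT x:\<Omega>|lebesgue. f \<epsilon> x)\<bar> \<le> \<epsilon> ^ Suc m"
    by (intro integral_of_negligible_difference[OF \<Omega> *(3) G])
  from this *(5)[of "Suc m"]
    eventually_const_times_le_1[of 2]
  show ?thesis
  proof eventually_elim
    case (elim \<epsilon>)
    have "2 * \<epsilon> * \<epsilon> ^ m \<le> 1 * \<epsilon> ^ m" using elim by (intro mult_right_mono) auto
    then have "\<epsilon> ^ Suc m + \<epsilon> ^ Suc m \<le> \<epsilon> ^ m" by simp
    then show ?case using elim by linarith
  qed
qed

lemma tau_negligible_growth: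
  fixes D :: "('p::finite, 'q::finite, 'n::finite) jet net"
  assumes \<Omega>: "bounded \<Omega>" and D: "D \<in> tau_negligible \<Omega>"
  shows "\<forall>\<^sub>F \<epsilon> in at_right 0. \<forall>x\<in>\<Omega>. \<forall>U. jet_le CARD('n) U (1 / \<epsilon> ^ N) \<longrightarrow>
     \<bar>D \<epsilon> (jet_proj (x, U))\<bar> \<le> \<epsilon> ^ (m::nat)"
proof -
  have "[] \<in> lists (Basis :: ('p, 'q, 'n) jet set)" by simp
  then obtain l :: nat where "\<forall>m::nat. sup_bigo (closure \<Omega> \<times> UNIV)
      (\<lambda>\<epsilon> z. pdbar (\<Omega> \<times> UNIV) [] (D \<epsilon>) z / (1 + norm z) ^ l) (\<lambda>\<epsilon>. \<epsilon> ^ m)"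
    using D unfolding tau_negligible_def by fast
  then have "negligible_on (closure \<Omega> \<times> UNIV) (\<lambda>\<epsilon> z. pdbar (\<Omega> \<times> UNIV) [] (D \<epsilon>) z / (1 + norm z) ^ l)"
    unfolding negligible_on_iff .
  \<comment> \<open>along such jets the weight \<open>(1 + |z|)\<^sup>l\<close> costs at most \<open>Suc N * l\<close> powers of \<open>\<epsilon>\<close>\<close>
  then have "\<forall>\<^sub>F \<epsilon> in at_right 0. \<forall>z\<in>closure \<Omega> \<times> UNIV.
      \<bar>pdbar (\<Omega> \<times> UNIV) [] (D \<epsilon>) z / (1 + norm z) ^ l\<bar> \<le> \<epsilon> ^ (m + Suc N * l)"
    unfolding negligible_on_def by blast
  then show ?thesis
    using jet_proj_growth[OF \<Omega>, where 'q='q and 'n='n, of N] eventually_at_right_0_less[of 1, simplified]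
  proof eventually_elim
    case (elim \<epsilon>)
    show ?case
    proof (intro ballI allI impI)
      fix x U assume x: "x \<in> \<Omega>" and U: "\<forall>a :: 'q \<times> 'p multiset. size (snd a) \<le> CARD('n) \<longrightarrow> \<bar>U a\<bar> \<le> 1 / \<epsilon> ^ N"
      define z :: "('p, 'q, 'n) jet" where "z = jet_proj (x, U)"
      have n: "1 + norm z \<le> 1 / \<epsilon> ^ Suc N" using elim(2) x U unfolding z_def by blast
      have z: "z \<in> \<Omega> \<times> UNIV" using x by (simp add: z_def mem_Times_iff)
      then have "\<bar>D \<epsilon> z / (1 + norm z) ^ l\<bar> \<le> \<epsilon> ^ (m + Suc N * l)"
        using elim(1) closure_subset[of \<Omega>] by (force simp: pdbar_def)
      then have "\<bar>D \<epsilon> z\<bar> \<le> \<epsilon> ^ (m + Suc N * l) * (1 + norm z) ^ l"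
        by (simp add: abs_divide divide_le_eq add_pos_nonneg)
      also have "\<dots> \<le> \<epsilon> ^ (m + Suc N * l) * (1 / \<epsilon> ^ Suc N) ^ l"
        using elim n by (intro mult_left_mono power_mono) auto
      also have "(1 / \<epsilon> ^ Suc N) ^ l = 1 / \<epsilon> ^ (Suc N * l)"
        by (simp only: power_divide power_one power_mult)
      also have "\<epsilon> ^ (m + Suc N * l) * (1 / \<epsilon> ^ (Suc N * l)) = \<epsilon> ^ m"
        using elim(3) by (simp add: power_add)
      finally show "\<bar>D \<epsilon> (jet_proj (x, U))\<bar> \<le> \<epsilon> ^ m" by (simp only: z_def)
    qed
  qed
qed

text \<open>
  Changing \<open>M\<close> costs a negligible amount by the definition of the tempered algebra; changing the
  argument of \<open>M'\<close> costs at most a moderate derivative times a negligible difference of jets.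
\<close>

lemma compose_well_defined:
  fixes L :: "('p::finite, 'q::finite, 'n::finite) jet net set" and v v' :: "'q \<Rightarrow> (real ^ 'p) net"
  assumes \<Omega>: "open \<Omega>" "bounded \<Omega>" and L: "L \<in> tau_colombeau \<Omega>" and M: "M \<in> L" "M' \<in> L"
    and v: "jets_moderate \<Omega> v" and d: "jets_negligible \<Omega> (\<lambda>\<beta> \<epsilon> x. v' \<beta> \<epsilon> x - v \<beta> \<epsilon> x)"
    and s: "\<And>\<beta> \<epsilon>. \<epsilon> \<in> {0<..1} \<Longrightarrow> smooth_along Basis \<Omega> (v \<beta> \<epsilon>)" "\<And>\<beta> \<epsilon>. \<epsilon> \<in> {0<..1} \<Longrightarrow> smooth_along Basis \<Omega> (v' \<beta> \<epsilon>)"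
  shows "negligible_on \<Omega> (\<lambda>\<epsilon> x. M \<epsilon> (jet_of \<Omega> (\<lambda>\<beta>. v \<beta> \<epsilon>) x) - M' \<epsilon> (jet_of \<Omega> (\<lambda>\<beta>. v' \<beta> \<epsilon>) x))"
  unfolding negligible_on_def
proof
  fix m :: nat
  let ?n = "CARD('n)"
  obtain M0 where M0: "L = net_rel (tau_moderate \<Omega>) (tau_negligible \<Omega>) `` {M0}"
    using L unfolding tau_colombeau_def by (rule quotientE)
  have D: "(\<lambda>\<epsilon> x. M0 \<epsilon> x - M \<epsilon> x) \<in> tau_negligible \<Omega>" "(\<lambda>\<epsilon> x. M0 \<epsilon> x - M' \<epsilon> x) \<in> tau_negligible \<Omega>"
    and M'm: "M' \<in> tau_moderate \<Omega>" using M M0 by (auto simp: net_rel_def)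
  obtain N :: nat where N: "\<forall>\<^sub>F \<epsilon> in at_right 0. \<forall>x\<in>\<Omega>. \<forall>a. size (snd a) \<le> ?n \<longrightarrow>
     \<bar>jet_along \<Omega> (\<lambda>\<beta>. v \<beta> \<epsilon>) x a\<bar> \<le> 1 / \<epsilon> ^ N" using v unfolding jets_moderate_def by blast
  obtain N' :: nat where N': "\<forall>\<^sub>F \<epsilon> in at_right 0. \<forall>x\<in>\<Omega>. \<forall>U W \<delta>.
     (\<forall>a. size (snd a) \<le> ?n \<longrightarrow> \<bar>U a\<bar> \<le> 1 / \<epsilon> ^ N \<and> \<bar>W a\<bar> \<le> 1 / \<epsilon> ^ N \<and> \<bar>W a\<bar> \<le> \<delta>) \<longrightarrow>
     \<bar>(M' \<epsilon> \<circ> jet_proj) (x, \<lambda>a. U a + W a) - (M' \<epsilon> \<circ> jet_proj) (x, U)\<bar> \<le> \<delta> * (1 / \<epsilon> ^ N')"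
    using fibre_increment[OF \<Omega>(1) jet_smooth_tau_moderate[OF \<Omega>(2) M'm]] by blast
  have W: "\<forall>\<^sub>F \<epsilon> in at_right 0. \<forall>x\<in>\<Omega>. \<forall>a. size (snd a) \<le> ?n \<longrightarrow>
     \<bar>jet_along \<Omega> (\<lambda>\<beta> x. v' \<beta> \<epsilon> x - v \<beta> \<epsilon> x) x a\<bar> \<le> \<epsilon> ^ (Suc m + N')" using d unfolding jets_negligible_def by blast
  show "\<forall>\<^sub>F \<epsilon> in at_right 0. \<forall>x\<in>\<Omega>. \<bar>M \<epsilon> (jet_of \<Omega> (\<lambda>\<beta>. v \<beta> \<epsilon>) x) - M' \<epsilon> (jet_of \<Omega> (\<lambda>\<beta>. v' \<beta> \<epsilon>) x)\<bar> \<le> \<epsilon> ^ m"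
    using tau_negligible_growth[OF \<Omega>(2) D(1), of N "Suc m"] tau_negligible_growth[OF \<Omega>(2) D(2), of N "Suc m"]
      N N' W eventually_at_right_0_less[of "1/3", simplified]
  proof eventually_elim
    case (elim \<epsilon>)
    then have \<epsilon>: "\<epsilon> \<in> {0<..1}" "0 < \<epsilon>" "\<epsilon> \<le> 1" "3 * \<epsilon> \<le> 1" by auto
    show ?case
    proof
      fix x assume x: "x \<in> \<Omega>"
      let ?U = "jet_along \<Omega> (\<lambda>\<beta>. v \<beta> \<epsilon>) x" and ?W = "jet_along \<Omega> (\<lambda>\<beta> x. v' \<beta> \<epsilon> x - v \<beta> \<epsilon> x) x"
      have U': "jet_along \<Omega> (\<lambda>\<beta>. v' \<beta> \<epsilon>) x = (\<lambda>a. ?U a + ?W a)"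
      proof
        fix a
        show "jet_along \<Omega> (\<lambda>\<beta>. v' \<beta> \<epsilon>) x a = ?U a + ?W a"
          using jet_along_lincomb[OF \<Omega>(1), where u = "\<lambda>\<beta>. v' \<beta> \<epsilon>" and v = "\<lambda>\<beta>. v \<beta> \<epsilon>" and c = 1 and d = "-1",
              OF s(2)[OF \<epsilon>(1)] s(1)[OF \<epsilon>(1)] x, of a] by simp
      qed
      have j: "jet_of \<Omega> (\<lambda>\<beta>. v \<beta> \<epsilon>) x = (jet_proj (x, ?U) :: ('p, 'q, 'n) jet)"
        "jet_of \<Omega> (\<lambda>\<beta>. v' \<beta> \<epsilon>) x = (jet_proj (x, \<lambda>a. ?U a + ?W a) :: ('p, 'q, 'n) jet)"
        unfolding jet_of_def U'[symmetric] by (subst inf_jet_of_eq, rule refl)+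
      have Ub: "\<bar>?U a\<bar> \<le> 1 / \<epsilon> ^ N" if "size (snd a) \<le> ?n" for a using elim(3) x that by blast
      have Wb: "\<bar>?W a\<bar> \<le> \<epsilon> ^ (Suc m + N')" if "size (snd a) \<le> ?n" for a using elim(5) x that by blast
      have "\<epsilon> ^ (Suc m + N') \<le> 1" using \<epsilon> by (intro power_le_one) auto
      also have "1 \<le> 1 / \<epsilon> ^ N" using inverse_power_mono[OF \<epsilon>(2,3), of 0 N] by simp
      finally have UW: "\<forall>a. size (snd a) \<le> ?n \<longrightarrow> \<bar>?U a\<bar> \<le> 1 / \<epsilon> ^ N \<and> \<bar>?W a\<bar> \<le> 1 / \<epsilon> ^ N \<and> \<bar>?W a\<bar> \<le> \<epsilon> ^ (Suc m + N')"
        using Ub Wb by (meson order_trans)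
      have "\<bar>M' \<epsilon> (jet_proj (x, \<lambda>a. ?U a + ?W a)) - M' \<epsilon> (jet_proj (x, ?U))\<bar> \<le> \<epsilon> ^ (Suc m + N') * (1 / \<epsilon> ^ N')"
        using elim(4)[rule_format, OF x UW[rule_format]] by simp
      also have "\<dots> = \<epsilon> ^ Suc m" using \<epsilon> by (simp add: power_add)
      finally have 1: "\<bar>M' \<epsilon> (jet_proj (x, \<lambda>a. ?U a + ?W a)) - M' \<epsilon> (jet_proj (x, ?U))\<bar> \<le> \<epsilon> ^ Suc m" .
      have 2: "\<bar>M0 \<epsilon> (jet_proj (x, ?U)) - M \<epsilon> (jet_proj (x, ?U))\<bar> \<le> \<epsilon> ^ Suc m"
        using elim(1)[rule_format, OF x Ub] .
      have 3: "\<bar>M0 \<epsilon> (jet_proj (x, ?U)) - M' \<epsilon> (jet_proj (x, ?U))\<bar> \<le> \<epsilon> ^ Suc m"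
        using elim(2)[rule_format, OF x Ub] .
      have "3 * \<epsilon> * \<epsilon> ^ m \<le> 1 * \<epsilon> ^ m" using \<epsilon> by (intro mult_right_mono) auto
      then have "\<epsilon> ^ Suc m + \<epsilon> ^ Suc m + \<epsilon> ^ Suc m \<le> \<epsilon> ^ m" by simp
      then show "\<bar>M \<epsilon> (jet_of \<Omega> (\<lambda>\<beta>. v \<beta> \<epsilon>) x) - M' \<epsilon> (jet_of \<Omega> (\<lambda>\<beta>. v' \<beta> \<epsilon>) x)\<bar> \<le> \<epsilon> ^ m"
        unfolding j using 1 2 3 by linarith
    qed
  qed
qed

section \<open>The Euler-Lagrange equations\<close>

lemma moderate_smooth: "u \<in> moderate \<Omega> D \<Longrightarrow> \<epsilon> \<in> {0<..1} \<Longrightarrow> smooth_along Basis \<Omega> (u \<epsilon>)"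
  using moderateD(1)[of u \<Omega> D \<epsilon>] by (simp add: cinf_def)

theorem theorem3p4:
  fixes \<Omega> :: "(real ^ 'p::finite) set"
    and L :: "('p, 'q::finite, 'n::finite) jet net set"
    and u0 u :: "'q \<Rightarrow> (real ^ 'p) net set"
  assumes "open \<Omega>" and "connected \<Omega>" and "bounded \<Omega>" and "smooth_boundary \<Omega>"
    and "L \<in> tau_colombeau \<Omega>"
    and "\<forall>\<alpha>. u0 \<alpha> \<in> bd_colombeau \<Omega>"
    and "u \<in> admissible \<Omega> u0"
    and "\<forall>w \<in> admissible \<Omega> u0. greal_le (functional \<Omega> L u) (functional \<Omega> L w)"
  shows "\<forall>\<alpha>. euler_along \<Omega> \<alpha> L u = colombeau_zero \<Omega> \<Omega>"
proof
  fix \<alpha> :: 'q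
  note \<Omega> = assms(1,3) and L = assms(5) and u = assms(7) and minimal = assms(8)
  let ?R = "colombeau_rel \<Omega> (closure \<Omega>)"
  have "\<exists>v0. u \<beta> = ?R `` {v0} \<and> v0 \<in> moderate \<Omega> (closure \<Omega>)" for \<beta>
  proof -
    have "u \<beta> \<in> moderate \<Omega> (closure \<Omega>) // ?R" using u by (simp add: admissible_def colombeau_def)
    then show ?thesis by (rule quotientE) blast
  qed
  then obtain v0 where v0: "\<And>\<beta>. u \<beta> = ?R `` {v0 \<beta>}" "\<And>\<beta>. v0 \<beta> \<in> moderate \<Omega> (closure \<Omega>)" by metis
  have uD: "v \<beta> \<in> moderate \<Omega> (closure \<Omega>)" "(\<lambda>\<epsilon> x. v0 \<beta> \<epsilon> x - v \<beta> \<epsilon> x) \<in> negligible_nets \<Omega> (closure \<Omega>)"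
    if "v \<in> Pi UNIV u" for v \<beta>
  proof -
    have "v \<beta> \<in> ?R `` {v0 \<beta>}" using that v0(1) by blast
    then show "v \<beta> \<in> moderate \<Omega> (closure \<Omega>)" "(\<lambda>\<epsilon> x. v0 \<beta> \<epsilon> x - v \<beta> \<epsilon> x) \<in> negligible_nets \<Omega> (closure \<Omega>)"
      by (auto simp: colombeau_rel_def net_rel_def)
  qed
  have zero: "colombeau_rel \<Omega> \<Omega> `` {\<lambda>\<epsilon> x. euler_op \<alpha> (M \<epsilon>) (inf_jet_of \<Omega> (\<lambda>\<beta>. v \<beta> \<epsilon>) x)} = colombeau_zero \<Omega> \<Omega>"
    if M: "M \<in> L" and v: "v \<in> Pi UNIV u" for M v
  proof -
    let ?F = "\<lambda>\<epsilon>. M \<epsilon> \<circ> jet_proj" and ?n = "CARD('n)"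
    have "M \<in> tau_moderate \<Omega>" using L M unfolding tau_colombeau_def net_rel_def by (auto elim: quotientE)
    then have F: "jet_smooth \<Omega> ?n ?F" by (rule jet_smooth_tau_moderate[OF \<Omega>(2)])
    have jm: "jets_moderate \<Omega> v" by (rule jets_moderate_of_moderate[OF \<Omega>(2) uD(1)[OF v]])
    have sv: "smooth_along Basis \<Omega> (v \<beta> \<epsilon>)" if "\<epsilon> \<in> {0<..1}" for \<beta> \<epsilon> by (rule moderate_smooth[OF uD(1)[OF v] that])
    have min: "\<forall>\<^sub>F \<epsilon> in at_right 0.
        set_integrable lebesgue \<Omega> (\<lambda>x. ?F \<epsilon> (inf_jet_of \<Omega> (\<lambda>\<beta> x. v \<beta> \<epsilon> x + w \<beta> \<epsilon> x) x)) \<and>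
        set_integrable lebesgue \<Omega> (\<lambda>x. ?F \<epsilon> (inf_jet_of \<Omega> (\<lambda>\<beta>. v \<beta> \<epsilon>) x)) \<and>
        - (\<epsilon> ^ m) \<le> (LINT x:\<Omega>|lebesgue. ?F \<epsilon> (inf_jet_of \<Omega> (\<lambda>\<beta> x. v \<beta> \<epsilon> x + w \<beta> \<epsilon> x) x))
          - (LINT x:\<Omega>|lebesgue. ?F \<epsilon> (inf_jet_of \<Omega> (\<lambda>\<beta>. v \<beta> \<epsilon>) x))"
      if w: "\<And>\<beta>. w \<beta> \<in> moderate \<Omega> (closure \<Omega>)" and w0: "\<forall>\<beta>. \<forall>\<epsilon>\<in>{0<..1}. \<forall>x\<in>frontier \<Omega>. w \<beta> \<epsilon> x = 0"
      for w and m :: nat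
    proof -
      \<comment> \<open>perturbing the representatives \<open>v0\<close>, which generate the classes \<open>u\<close>, defines a competitor; any representative of it differs negligibly from the perturbation of \<open>v\<close>\<close>
      define W where "W \<beta> = ?R `` {\<lambda>\<epsilon> x. v0 \<beta> \<epsilon> x + w \<beta> \<epsilon> x}" for \<beta>
      have plus: "(\<lambda>\<epsilon> x. z \<epsilon> x + w \<beta> \<epsilon> x) \<in> moderate \<Omega> (closure \<Omega>)" if "z \<in> moderate \<Omega> (closure \<Omega>)" for z \<beta>
        using moderate_lincomb[OF \<Omega>(1) closure_subset order_refl that w, of 1 1] by simp
      have W: "W \<in> admissible \<Omega> u0"
        unfolding admissible_def
      proof (intro CollectI allI conjI)
        fix \<beta>
        show "W \<beta> \<in> colombeau \<Omega> (closure \<Omega>)"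
          unfolding W_def colombeau_def by (rule quotientI[OF plus[OF v0(2)]])
        have "bd_restrict \<Omega> (W \<beta>) = bd_restrict \<Omega> (u \<beta>)"
          unfolding W_def v0(1) by (rule bd_restrict_perturb[OF \<Omega>(1) v0(2) w]) (use w0 in blast)
        then show "bd_restrict \<Omega> (W \<beta>) = u0 \<beta>" using u by (simp add: admissible_def)
      qed
      obtain a b where ab: "a \<in> functional \<Omega> L u" "b \<in> functional \<Omega> L W"
        "\<And>m::nat. \<forall>\<^sub>F \<epsilon> in at_right 0. - (\<epsilon> ^ m) \<le> b \<epsilon> - a \<epsilon>"
        using greal_leE minimal W by metis
      let ?vw = "\<lambda>\<beta> \<epsilon> x. v \<beta> \<epsilon> x + w \<beta> \<epsilon> x"
      have svw: "smooth_along Basis \<Omega> (?vw \<beta> \<epsilon>)" if "\<epsilon> \<in> {0<..1}" for \<beta> \<epsilon>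
        by (rule moderate_smooth[OF plus[OF uD(1)[OF v]] that])
      have 1: "\<forall>\<^sub>F \<epsilon> in at_right 0. set_integrable lebesgue \<Omega> (\<lambda>x. ?F \<epsilon> (inf_jet_of \<Omega> (\<lambda>\<beta>. v \<beta> \<epsilon>) x)) \<and>
          \<bar>(LINT x:\<Omega>|lebesgue. ?F \<epsilon> (inf_jet_of \<Omega> (\<lambda>\<beta>. v \<beta> \<epsilon>) x)) - a \<epsilon>\<bar> \<le> \<epsilon> ^ Suc m"
      proof (rule functional_representative[OF \<Omega> ab(1)])
        show "continuous_on \<Omega> (\<lambda>x. ?F \<epsilon> (inf_jet_of \<Omega> (\<lambda>\<beta>. v \<beta> \<epsilon>) x))" if "\<epsilon> \<in> {0<..1}" for \<epsilon>
          by (rule smooth_along_continuous[OF smooth_along_along[OF \<Omega>(1) F that sv[OF that]]])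
        fix M' v' assume M': "M' \<in> L" and v': "v' \<in> Pi UNIV u"
        have "jets_negligible \<Omega> (\<lambda>\<beta> \<epsilon> x. v' \<beta> \<epsilon> x - v \<beta> \<epsilon> x)"
        proof (rule jets_negligible_of_negligible[OF \<Omega>(2)])
          fix \<beta>
          show "(\<lambda>\<epsilon> x. v' \<beta> \<epsilon> x - v \<beta> \<epsilon> x) \<in> negligible_nets \<Omega> (closure \<Omega>)"
            using negligible_nets_lincomb[OF \<Omega>(1) closure_subset order_refl uD(2)[OF v, of \<beta>] uD(2)[OF v', of \<beta>], of 1 "-1"]
            by simp
        qed
        then have "negligible_on \<Omega> (\<lambda>\<epsilon> x. M \<epsilon> (jet_of \<Omega> (\<lambda>\<beta>. v \<beta> \<epsilon>) x) - M' \<epsilon> (jet_of \<Omega> (\<lambda>\<beta>. v' \<beta> \<epsilon>) x))"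
          by (rule compose_well_defined[OF \<Omega> L M M' jm _ sv moderate_smooth[OF uD(1)[OF v']]])
        then show "negligible_on \<Omega> (\<lambda>\<epsilon> x. ?F \<epsilon> (inf_jet_of \<Omega> (\<lambda>\<beta>. v \<beta> \<epsilon>) x) - M' \<epsilon> (jet_of \<Omega> (\<lambda>\<beta>. v' \<beta> \<epsilon>) x))"
          by (simp add: jet_of_def)
      qed
      have 2: "\<forall>\<^sub>F \<epsilon> in at_right 0. set_integrable lebesgue \<Omega> (\<lambda>x. ?F \<epsilon> (inf_jet_of \<Omega> (\<lambda>\<beta>. ?vw \<beta> \<epsilon>) x)) \<and>
          \<bar>(LINT x:\<Omega>|lebesgue. ?F \<epsilon> (inf_jet_of \<Omega> (\<lambda>\<beta>. ?vw \<beta> \<epsilon>) x)) - b \<epsilon>\<bar> \<le> \<epsilon> ^ Suc m"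
      proof (rule functional_representative[OF \<Omega> ab(2)])
        show "continuous_on \<Omega> (\<lambda>x. ?F \<epsilon> (inf_jet_of \<Omega> (\<lambda>\<beta>. ?vw \<beta> \<epsilon>) x))" if "\<epsilon> \<in> {0<..1}" for \<epsilon>
          by (rule smooth_along_continuous[OF smooth_along_along[OF \<Omega>(1) F that svw[OF that]]])
        fix M' v' assume M': "M' \<in> L" and v': "v' \<in> Pi UNIV W"
        have v'D: "v' \<beta> \<in> moderate \<Omega> (closure \<Omega>)"
          "(\<lambda>\<epsilon> x. v0 \<beta> \<epsilon> x + w \<beta> \<epsilon> x - v' \<beta> \<epsilon> x) \<in> negligible_nets \<Omega> (closure \<Omega>)" for \<beta>
        proof -
          have "v' \<beta> \<in> ?R `` {\<lambda>\<epsilon> x. v0 \<beta> \<epsilon> x + w \<beta> \<epsilon> x}" using v' unfolding W_def by blast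
          then show "v' \<beta> \<in> moderate \<Omega> (closure \<Omega>)"
            "(\<lambda>\<epsilon> x. v0 \<beta> \<epsilon> x + w \<beta> \<epsilon> x - v' \<beta> \<epsilon> x) \<in> negligible_nets \<Omega> (closure \<Omega>)"
            by (auto simp: colombeau_rel_def net_rel_def)
        qed
        have "jets_negligible \<Omega> (\<lambda>\<beta> \<epsilon> x. v' \<beta> \<epsilon> x - ?vw \<beta> \<epsilon> x)"
        proof (rule jets_negligible_of_negligible[OF \<Omega>(2)])
          fix \<beta>
          have "(\<lambda>\<epsilon> x. 1 * (v0 \<beta> \<epsilon> x - v \<beta> \<epsilon> x) + (-1) * (v0 \<beta> \<epsilon> x + w \<beta> \<epsilon> x - v' \<beta> \<epsilon> x)) \<in> negligible_nets \<Omega> (closure \<Omega>)"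
            by (rule negligible_nets_lincomb[OF \<Omega>(1) closure_subset order_refl uD(2)[OF v] v'D(2)])
          moreover have "1 * (v0 \<beta> \<epsilon> x - v \<beta> \<epsilon> x) + (-1) * (v0 \<beta> \<epsilon> x + w \<beta> \<epsilon> x - v' \<beta> \<epsilon> x) = v' \<beta> \<epsilon> x - ?vw \<beta> \<epsilon> x" for \<epsilon> x
            by simp
          ultimately show "(\<lambda>\<epsilon> x. v' \<beta> \<epsilon> x - ?vw \<beta> \<epsilon> x) \<in> negligible_nets \<Omega> (closure \<Omega>)" by (simp only:)
        qed
        then have "negligible_on \<Omega> (\<lambda>\<epsilon> x. M \<epsilon> (jet_of \<Omega> (\<lambda>\<beta>. ?vw \<beta> \<epsilon>) x) - M' \<epsilon> (jet_of \<Omega> (\<lambda>\<beta>. v' \<beta> \<epsilon>) x))"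
          by (rule compose_well_defined[OF \<Omega> L M M' jets_moderate_of_moderate[OF \<Omega>(2) plus[OF uD(1)[OF v]]] _ svw moderate_smooth[OF v'D(1)]])
        then show "negligible_on \<Omega> (\<lambda>\<epsilon> x. ?F \<epsilon> (inf_jet_of \<Omega> (\<lambda>\<beta>. ?vw \<beta> \<epsilon>) x) - M' \<epsilon> (jet_of \<Omega> (\<lambda>\<beta>. v' \<beta> \<epsilon>) x))"
          by (simp add: jet_of_def)
      qed
      from 1 2 ab(3)[of "Suc m"] eventually_const_times_le_1[of 3] show ?thesis
      proof eventually_elim
        case (elim \<epsilon>)
        have "3 * \<epsilon> * \<epsilon> ^ m \<le> 1 * \<epsilon> ^ m" using elim(4) by (intro mult_right_mono) auto
        then have "\<epsilon> ^ Suc m + \<epsilon> ^ Suc m + \<epsilon> ^ Suc m \<le> \<epsilon> ^ m" by simp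
        then show ?case using elim(1-3) by linarith
      qed
    qed
    define E where "E \<epsilon> x = euler_op \<alpha> (M \<epsilon>) (inf_jet_of \<Omega> (\<lambda>\<beta>. v \<beta> \<epsilon>) x)" for \<epsilon> x
    have E: "E = (\<lambda>\<epsilon> x. euler_expr ?n \<alpha> (?F \<epsilon>) (inf_jet_of \<Omega> (\<lambda>\<beta>. v \<beta> \<epsilon>) x))"
      by (intro ext) (simp only: E_def euler_op_eq)
    note eF = jet_smooth_euler_expr[OF \<Omega>(1) F, of \<alpha>]
    have sE: "smooth_along Basis \<Omega> (E \<epsilon>)" if "\<epsilon> \<in> {0<..1}" for \<epsilon>
      unfolding E by (rule smooth_along_along[OF \<Omega>(1) eF that sv[OF that]])
    have bE: "moderate_on \<Omega> (\<lambda>\<epsilon> x. pdiffs bs (E \<epsilon>) x)" if "bs \<in> lists Basis" for bs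
      unfolding E by (rule along_pdiffs_bound[OF \<Omega>(1) eF jm sv that])
    have nE: "\<exists>r>0. cball x r \<subseteq> \<Omega> \<and> negligible_on (cball x r) E" if x: "x \<in> \<Omega>" for x
    proof -
      obtain R where R: "R > 0" "cball x R \<subseteq> \<Omega>" using \<Omega>(1) x open_contains_cball by blast
      have "negligible_on (cball x (R / 4)) E"
        unfolding E by (rule euler_expr_negligible[OF \<Omega> F jm sv min R])
      moreover have "cball x (R / 4) \<subseteq> \<Omega>" using R(1) by (intro order_trans[OF _ R(2)]) auto
      ultimately show ?thesis using R(1) by (intro exI[of _ "R / 4"]) simp
    qed
    have "colombeau_rel \<Omega> \<Omega> `` {E} = colombeau_zero \<Omega> \<Omega>"
    proof (rule negligible_class_eq_zero[OF \<Omega>(1) sE])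
      fix bs :: "(real ^ 'p) list" assume bs: "bs \<in> lists Basis"
      show "\<exists>N::nat. sup_bigo \<Omega> (\<lambda>\<epsilon>. pdiffs bs (E \<epsilon>)) (\<lambda>\<epsilon>. 1 / \<epsilon> ^ N)"
      proof -
        obtain N :: nat where "\<forall>\<^sub>F \<epsilon> in at_right 0. \<forall>x\<in>\<Omega>. \<bar>pdiffs bs (E \<epsilon>) x\<bar> \<le> 1 / \<epsilon> ^ N"
          using bE[OF bs] by blast
        then have "sup_bigo \<Omega> (\<lambda>\<epsilon>. pdiffs bs (E \<epsilon>)) (\<lambda>\<epsilon>. 1 / \<epsilon> ^ N)"
          unfolding sup_bigo_def by (intro exI[of _ 1]) simp
        then show ?thesis ..
      qed
      fix K assume K: "compact K" "K \<subseteq> \<Omega>"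
      show "negligible_on K (\<lambda>\<epsilon>. pdiffs bs (E \<epsilon>))"
        by (rule negligible_on_compact[OF K(1)])
           (use negligible_on_pdiffs[OF sE bE nE bs] K(2) in blast)
    qed
    then show ?thesis by (simp add: E_def[abs_def])
  qed
  \<comment> \<open>as \<open>u\<close> is a competitor of itself, its action is nonempty, hence so is the union of classes in \<open>euler_along\<close>\<close>
  obtain a b where "a \<in> functional \<Omega> L u" using greal_leE minimal u by metis
  then obtain M v where Mv: "M \<in> L" "v \<in> Pi UNIV u" by (rule functionalE)
  have "euler_along \<Omega> \<alpha> L u = (\<Union>M\<in>L. \<Union>v\<in>Pi UNIV u. colombeau_zero \<Omega> \<Omega>)"
    unfolding euler_along_def by (intro SUP_cong refl zero)
  also have "\<dots> = colombeau_zero \<Omega> \<Omega>" using Mv by auto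
  finally show "euler_along \<Omega> \<alpha> L u = colombeau_zero \<Omega> \<Omega>" .
qed

end
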